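(* Let $K\subset\mathbb{C}$ be non-polar, compact and polynomially convex, and let $(q_k)_{k\in\mathbb{N}}$ be a sequence of complex polynomials with degrees $n_k=\deg q_k\to\infty$. If $(q_k)_{k\in\mathbb{N}}$ is $K$-regular and centers on $K$, then for every integer $m\ge 1$ and every $r>0$ $$\omega_{(q_k^{(m)})^{-1}(\overline{\mathbb{D}(r)})}\to\omega_K\quad\text{weak* as } k\to\infty,$$ where $q_k^{(m)}$ denotes the $m$th derivative of $q_k$.
   Context: $\mathbb{D}(R)=\{z\in\mathbb{C}:|z|<R\}$. Polynomially convex (full) for a compact $K\subset\mathbb{C}$ means that $\Omega:=\mathbb{C}\setminus K$ is connected. For a non-polar compact set $C\subset\mathbb{C}$, $\omega_C$ is the equilibrium measure of $C$, i.e. the unique Borel probability measure on $C$ maximizing the energy $I(\mu)=\iint\log|z-w|\,d\mu(w)\,d\mu(z)$. The Green's function of $\Omega$ with pole at $\infty$ is $g_\Omega(z)=\int\log|z-w|\,d\omega_K(w)-I(\omega_K)$. Weak* convergence $\mu_k\to\mu$ of probability measures means $\int f\,d\mu_k\to\int f\,d\mu$ for every compactly supported continuous $f$ on $\mathbb{C}$. All sequences of polynomials considered have degrees tending to infinity, so finitely many terms of degree too small for the expressions to make sense are disregarded. Centering: a sequence $(q_k)_k$ of polynomials centers on a non-empty compact set $C\subset\mathbb{C}$ if there exist $N\in\mathbb{N}$ and $R>0$ such that (1) $q_k^{-1}(\{0\})\subset\mathbb{D}(R)$ for all $k\ge N$; and (2) for every closed set $L\subset\mathbb{C}$ with $L\cap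 C=\emptyset$ there exists $M=M(L)>0$ such that for all $k\ge N$ the number of zeros of $q_k$ in $L$, counted with multiplicity, is at most $M$. $K$-regularity: a sequence $(q_k)_k$ of polynomials of degrees $n_k$ is $K$-regular if for some $R>0$ (taken large enough that $K\subset\mathbb{D}(R)$) one has $\lim_{k\to\infty}\frac{1}{n_k}\log|q_k(z)|=g_\Omega(z)$ uniformly on $\mathbb{C}\setminus\mathbb{D}(R)$. *)

theory Defs
  imports "HOL-Probability.Probability" "HOL-Computational_Algebra.Polynomial"
begin

text \<open>Since \<^term>\<open>ln (0::real) = 0\<close>, the kernel of the logarithmic potential is made
  extended-real valued, with value \<^term>\<open>-\<infinity> :: ereal\<close> on the diagonal.\<close>

definition elog :: "real \<Rightarrow> ereal" where
  "elog x = (if x = 0 then -\<infinity> else ereal (ln x))"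

text \<open>Integral of an extended-real function as positive part minus negative part.  It is only
  meaningful if one of the two parts is finite; below the positive part always is, because
  \<^term>\<open>elog\<close> is bounded above on bounded sets and the measures live on compact sets.\<close>

definition ereal_integral :: "'a measure \<Rightarrow> ('a \<Rightarrow> ereal) \<Rightarrow> ereal" where
  "ereal_integral M f =
     enn2ereal (\<integral>\<^sup>+x. e2ennreal (f x) \<partial>M) - enn2ereal (\<integral>\<^sup>+x. e2ennreal (- f x) \<partial>M)"

definition log_potential :: "complex measure \<Rightarrow> complex \<Rightarrow> ereal" where
  "log_potential \<mu> z = ereal_integral \<mu> (\<lambda>w. elog (cmod (z - w)))"

definition log_energy :: "complex measure \<Rightarrow> ereal" where
  "log_energy \<mu> = ereal_integral \<mu> (log_potential \<mu>)"

text \<open>Borel probability measures on a compact set \<open>C\<close>, regarded as measures on the whole plane.\<close>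

definition prob_measures_on :: "complex set \<Rightarrow> complex measure set" where
  "prob_measures_on C = {\<mu>. prob_space \<mu> \<and> sets \<mu> = sets borel \<and> emeasure \<mu> C = 1}"

definition polar :: "complex set \<Rightarrow> bool" where
  "polar E \<longleftrightarrow>
     (\<forall>C \<mu>. compact C \<and> C \<subseteq> E \<and> \<mu> \<in> prob_measures_on C \<longrightarrow> log_energy \<mu> = -\<infinity>)"

text \<open>With the sign convention \<open>log |z - w|\<close> (not \<open>- log |z - w|\<close>), the equilibrium measure
  \<^emph>\<open>maximizes\<close> the energy.\<close>

definition equilibrium_measure :: "complex set \<Rightarrow> complex measure" where
  "equilibrium_measure C =
     (THE \<mu>. \<mu> \<in> prob_measures_on C \<and> (\<forall>\<nu>\<in>prob_measures_on C. log_energy \<nu> \<le> log_energy \<mu>))"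

definition polynomially_convex :: "complex set \<Rightarrow> bool" where
  "polynomially_convex K \<longleftrightarrow> connected (- K)"

text \<open>Green's function of \<open>- K\<close> with pole at infinity.  For \<open>K\<close> compact and non-polar and
  \<open>z \<notin> K\<close> the potential and the energy are both finite, so the conversion to a real number
  loses nothing there.\<close>

definition green :: "complex set \<Rightarrow> complex \<Rightarrow> real" where
  "green K z = real_of_ereal
     (log_potential (equilibrium_measure K) z - log_energy (equilibrium_measure K))"

definition weak_star_converges :: "(nat \<Rightarrow> complex measure) \<Rightarrow> complex measure \<Rightarrow> bool" where
  "weak_star_converges \<mu> \<nu> \<longleftrightarrow>
     (\<forall>f :: complex \<Rightarrow> real. continuous_on UNIV f \<and> compact (closure {z. f z \<noteq> 0}) \<longrightarrow>
        (\<lambda>k. \<integral>z. f z \<partial>\<mu> k) \<longlonglongrightarrow> (\<integral>z. f z \<partial>\<nu>))"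

definition centers_on :: "(nat \<Rightarrow> complex poly) \<Rightarrow> complex set \<Rightarrow> bool" where
  "centers_on q C \<longleftrightarrow>
     (\<exists>N R. R > 0 \<and>
        (\<forall>k\<ge>N. {z. poly (q k) z = 0} \<subseteq> ball 0 R) \<and>
        (\<forall>L. closed L \<and> L \<inter> C = {} \<longrightarrow>
           (\<exists>M>0. \<forall>k\<ge>N. size (filter_mset (\<lambda>z. z \<in> L) (proots (q k))) \<le> M)))"

text \<open>The non-vanishing clause is implicit in uniform convergence to a finite function when
  \<open>log 0 = -\<infinity>\<close>; it has to be spelled out because \<^term>\<open>ln (0::real) = 0\<close>.\<close>

definition K_regular :: "complex set \<Rightarrow> (nat \<Rightarrow> complex poly) \<Rightarrow> bool" where
  "K_regular K q \<longleftrightarrow>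
     (\<exists>R>0. K \<subseteq> ball 0 R \<and>
        (\<forall>\<^sub>F k in sequentially. \<forall>z\<in>- ball 0 R. poly (q k) z \<noteq> 0) \<and>
        uniform_limit (- ball 0 R)
          (\<lambda>k z. 1 / real (degree (q k)) * ln (cmod (poly (q k) z))) (green K) sequentially)"

end

theory Submission
  imports Defs
    "HOL-Complex_Analysis.Complex_Analysis"
    "HOL-Computational_Algebra.Fundamental_Theorem_Algebra"
    "HOL-Real_Asymp.Real_Asymp"
begin

text \<open>Let \<open>\<omega>\<close> be the equilibrium measure of \<open>K\<close>, with potential \<open>h\<close> and energy \<open>c\<close>, and let \<open>p\<close> be the
  \<open>m\<close>-th derivative of \<open>q\<^sub>k\<close>, of degree \<open>N\<close> and leading coefficient \<open>b\<close>.  The equilibrium measure of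
  \<open>{|p| \<le> r}\<close> has potential \<open>(ln (max r |p|) - ln |b|) / N\<close>, which is bounded below by a
  constant tending to \<open>c\<close>.  Let \<open>\<nu>\<close> be a weak limit point of these measures and \<open>\<sigma>\<close> one of the
  zero-counting measures of \<open>q\<^sub>k\<close>.  Centering puts \<open>\<sigma>\<close> on \<open>K\<close>, and \<open>K\<close>-regularity makes its potential
  equal to \<open>h\<close> near infinity, hence on the connected set \<open>- K\<close>.  By Cauchy's inequality, the principle of
  descent and Frostman's theorem (\<open>h \<ge> c\<close>), the potential of \<open>\<nu>\<close> is at most \<open>h\<close> off \<open>K\<close>; it equals \<open>h\<close>
  far out because \<open>|p|\<close> and \<open>|q\<^sub>k|\<close> have the same exponential growth there.  The strong maximum
  principle then forces \<open>\<nu>\<close> to live on \<open>K\<close>.  Finally the potential of \<open>\<nu>\<close> is at least \<open>c\<close>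
  everywhere, so \<open>\<nu>\<close> has energy at least \<open>c\<close>, and \<open>\<nu> = \<omega>\<close> by uniqueness of the maximizer.\<close>

text \<open>Weak limits control potentials on one side only: limits of potentials are at most the
  potential of the limit. The floor under the potentials of the lemniscate measures therefore passes
  to \<nu>, but the upper bound off \<open>K\<close> does not pass pointwise. It is first averaged
  over circles, where the kernel becomes the continuous function ln (max \<rho> |w - z|) and the
  averages converge; subharmonicity then leads back to the centre of the circle.

  Derivatives are controlled on one side as well: Cauchy's inequality bounds \<open>p\<close> from
  above only, and \<open>p\<close> may have zeros off \<open>K\<close>. A lower bound is at hand
  only beyond all zeros of \<open>q k\<close>, through the logarithmic derivative. The strong
  maximum principle turns equality at one such far point into information on all of
  \<open>- K\<close>.

  Frostman's theorem enters where |p| <= r: there the potential no longer sees \<open>p\<close> and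
  sits at its floor, which tends to c, and c <= h is exactly what is wanted.\<close>

section \<open>Integrals with values in the extended reals\<close>

text \<open>With d = u - g this is d = d^+ - d^- and u = u^+ - u^-, every term moved to the side
  where it is added. In this additive form the identity survives \<open>g = top\<close> and can be
  integrated termwise.\<close>

lemma e2ennreal_pos_neg_parts:
  fixes u :: real and g :: ennreal
  shows "e2ennreal (ereal u - enn2ereal g) + g + ennreal (- u)
         = e2ennreal (- (ereal u - enn2ereal g)) + ennreal u"
proof (cases g)
  case (real x)
  then have g: "enn2ereal g = ereal x" by (simp add: enn2ereal_ennreal)
  have "e2ennreal (ereal u - enn2ereal g) = ennreal (u - x)"
    "e2ennreal (- (ereal u - enn2ereal g)) = ennreal (x - u)"
    by (simp_all add: g e2ennreal_ereal)
  moreover have "ennreal (u - x) + ennreal x + ennreal (- u) = ennreal (x - u) + ennreal u"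
    using real(1)
    by (cases "u \<ge> x"; cases "u \<ge> 0")
       (simp_all add: ennreal_neg ennreal_plus[symmetric] del: ennreal_plus)
  ultimately show ?thesis using real by simp
next
  case top
  then show ?thesis by (simp add: e2ennreal_infty)
qed

text \<open>The positive part of the integrand is at most that of \<open>u\<close>, so
  \<open>P\<close> is finite. Only \<open>N\<close> and \<open>G\<close> can be infinite, and the
  additive identity makes them infinite together.\<close>

lemma ereal_integral_diff:
  fixes u :: "'a \<Rightarrow> real" and g :: "'a \<Rightarrow> ennreal"
  assumes u: "integrable M u" and g[measurable]: "g \<in> borel_measurable M"
  shows "ereal_integral M (\<lambda>x. ereal (u x) - enn2ereal (g x))
         = ereal (\<integral>x. u x \<partial>M) - enn2ereal (\<integral>\<^sup>+x. g x \<partial>M)"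
proof -
  have [measurable]: "u \<in> borel_measurable M" using u by auto
  define p where "p x = e2ennreal (ereal (u x) - enn2ereal (g x))" for x
  define n where "n x = e2ennreal (- (ereal (u x) - enn2ereal (g x)))" for x
  have [measurable]: "p \<in> borel_measurable M" "n \<in> borel_measurable M"
    unfolding p_def n_def by measurable
  define P N G U V where "P = (\<integral>\<^sup>+x. p x \<partial>M)" and "N = (\<integral>\<^sup>+x. n x \<partial>M)"
    and "G = (\<integral>\<^sup>+x. g x \<partial>M)" and "U = (\<integral>\<^sup>+x. ennreal (u x) \<partial>M)"
    and "V = (\<integral>\<^sup>+x. ennreal (- u x) \<partial>M)"
  have "(\<integral>\<^sup>+x. p x + g x + ennreal (- u x) \<partial>M) = (\<integral>\<^sup>+x. n x + ennreal (u x) \<partial>M)"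
    unfolding p_def n_def by (intro nn_integral_cong e2ennreal_pos_neg_parts)
  then have eq: "P + G + V = N + U"
    unfolding P_def N_def G_def U_def V_def by (simp add: nn_integral_add)
  have fin: "U < \<infinity>" "V < \<infinity>"
    using u unfolding U_def V_def real_integrable_def by (auto simp: top.not_eq_extremum)
  have "p x \<le> ennreal (u x)" for x
  proof -
    have "ereal (u x) - enn2ereal (g x) \<le> ereal (u x)"
      by (simp add: ereal_diff_le_self)
    then show ?thesis unfolding p_def using e2ennreal_mono by (fastforce simp: e2ennreal_ereal)
  qed
  then have "P \<le> U" unfolding P_def U_def by (intro nn_integral_mono)
  then have "P < \<infinity>" using fin by simp
  have intu: "(\<integral>x. u x \<partial>M) = enn2real U - enn2real V"
    unfolding U_def V_def by (rule real_lebesgue_integral_def[OF u])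
  from \<open>P < \<infinity>\<close> obtain P' where P': "P = ennreal P'" "0 \<le> P'" by (cases P) auto
  from fin obtain U' V' where UV: "U = ennreal U'" "0 \<le> U'" "V = ennreal V'" "0 \<le> V'"
    by (cases U; cases V) auto
  have "enn2ereal P - enn2ereal N = ereal (enn2real U - enn2real V) - enn2ereal G"
  proof (cases G)
    case (real G')
    then have "N \<noteq> \<infinity>" using eq P' UV by (metis ennreal_add_eq_top ennreal_neq_top infinity_ennreal_def)
    then obtain N' where N': "N = ennreal N'" "0 \<le> N'" by (cases N) auto
    have "P' + G' + V' = N' + U'"
      using eq real P' UV N'
      by (metis add_nonneg_nonneg ennreal_inj ennreal_plus)
    then show ?thesis using real P' UV N' by (simp add: enn2ereal_ennreal)
  next
    case top
    then have "N = \<infinity>" using eq UV by (metis ennreal_add_eq_top ennreal_neq_top infinity_ennreal_def top_add add.commute)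
    then show ?thesis using top P' by (simp add: enn2ereal_ennreal)
  qed
  then show ?thesis
    unfolding ereal_integral_def intu P_def N_def G_def p_def n_def by simp
qed

section \<open>The chordal kernel\<close>

definition wt :: "complex \<Rightarrow> real" where
  "wt z = 1 + (cmod z)\<^sup>2"

definition lwt :: "complex \<Rightarrow> real" where
  "lwt z = ln (wt z) / 2"

text \<open>The squared modulus of the Hermitian product of the unit vectors (1, z) / sqrt (wt z)
  and (1, w) / sqrt (wt w). On the Riemann sphere of diameter 1, \<open>1 - sph z w\<close> is the
  squared chordal distance.\<close>

definition sph :: "complex \<Rightarrow> complex \<Rightarrow> real" where
  "sph z w = (cmod (1 + z * cnj w))\<^sup>2 / (wt z * wt w)"

text \<open>Since \<open>1 - sph z w = |z - w|\<^sup>2 / (wt z * wt w)\<close>, expanding \<open>- ln (1 - sph z w) / 2\<close> shows that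
  this is \<open>lwt z + lwt w - ln |z - w|\<close>: the logarithmic kernel up to sign and rank-one terms.  Unlike the
  latter it is a series of nonnegative kernels, each positive definite and of finite rank, which gives
  definiteness and semicontinuity of the energy at once.\<close>

definition chordal :: "complex \<Rightarrow> complex \<Rightarrow> ennreal" where
  "chordal z w = (\<Sum>k. ennreal (sph z w ^ Suc k / (2 * real (Suc k))))"

lemma wt_pos[simp]: "wt z > 0" "wt z \<noteq> 0" "0 \<le> wt z"
proof -
  show "wt z > 0" unfolding wt_def by (simp add: add_pos_nonneg)
  then show "wt z \<noteq> 0" "0 \<le> wt z" by auto
qed

text \<open>Lagrange's identity for the vectors (1, z) and (1, w).\<close>

lemma one_minus_sph: "1 - sph z w = (cmod (z - w))\<^sup>2 / (wt z * wt w)"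
proof -
  have "wt z * wt w - (cmod (1 + z * cnj w))\<^sup>2 = (cmod (z - w))\<^sup>2"
    unfolding wt_def cmod_power2 by (simp add: power2_eq_square algebra_simps)
  then have "(cmod (z - w))\<^sup>2 / (wt z * wt w) = (wt z * wt w - (cmod (1 + z * cnj w))\<^sup>2) / (wt z * wt w)"
    by simp
  also have "\<dots> = 1 - sph z w" unfolding sph_def by (simp add: diff_divide_distrib)
  finally show ?thesis ..
qed

lemma sph_nonneg[simp]: "0 \<le> sph z w"
  unfolding sph_def by simp

lemma sph_le_1[simp]: "sph z w \<le> 1"
proof -
  have "0 \<le> 1 - sph z w" unfolding one_minus_sph by simp
  then show ?thesis by simp
qed

lemma sph_less_1_iff[simp]: "sph z w < 1 \<longleftrightarrow> z \<noteq> w"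
proof -
  have "sph z w < 1 \<longleftrightarrow> 0 < 1 - sph z w" by simp
  also have "\<dots> \<longleftrightarrow> z \<noteq> w" unfolding one_minus_sph by (auto simp: zero_less_divide_iff zero_less_mult_iff)
  finally show ?thesis .
qed

lemma sph_refl[simp]: "sph z z = 1"
  using one_minus_sph[of z z] by simp

lemma sph_commute: "sph z w = sph w z"
  using one_minus_sph[of z w] one_minus_sph[of w z] by (simp add: norm_minus_commute mult.commute)

lemma chordal_commute: "chordal z w = chordal w z"
  unfolding chordal_def by (simp add: sph_commute)

lemma ln_series_sums:
  fixes x :: real
  assumes "0 \<le> x" "x < 1"
  shows "(\<lambda>k. x ^ Suc k / real (Suc k)) sums (- ln (1 - x))"
proof -
  have "((\<lambda>n. - (x^n / of_nat n)) sums ln (1 - x))"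
    using ln_series'[of "-x"] assms by simp
  then have "((\<lambda>n. x^n / of_nat n) sums (- ln (1 - x)))"
    using sums_minus by fastforce
  then show ?thesis by (subst sums_Suc_iff) simp
qed

lemma chordal_eq:
  assumes "z \<noteq> w"
  shows "chordal z w = ennreal (lwt z + lwt w - ln (cmod (z - w)))"
    and "lwt z + lwt w - ln (cmod (z - w)) \<ge> 0"
proof -
  have "(\<lambda>k. (sph z w ^ Suc k / real (Suc k)) / 2) sums (- ln (1 - sph z w) / 2)"
    using assms by (intro sums_divide ln_series_sums) auto
  then have *: "(\<lambda>k. sph z w ^ Suc k / (2 * real (Suc k))) sums (- ln (1 - sph z w) / 2)"
    by (simp add: mult.commute)
  have "- ln (1 - sph z w) / 2 = lwt z + lwt w - ln (cmod (z - w))"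
    unfolding one_minus_sph lwt_def using assms
    by (simp add: ln_div ln_mult ln_realpow field_simps)
  then show "chordal z w = ennreal (lwt z + lwt w - ln (cmod (z - w)))"
    using * unfolding chordal_def by (auto intro!: suminf_ennreal_eq simp del: power_Suc)
  show "lwt z + lwt w - ln (cmod (z - w)) \<ge> 0"
    using sums_le[OF _ sums_zero *] \<open>_ = lwt z + lwt w - _\<close> by simp
qed

text \<open>On the diagonal \<open>sph\<close> is 1 and the series is half the harmonic
  series.\<close>

lemma chordal_refl: "chordal z z = \<infinity>"
proof (rule ccontr)
  assume "chordal z z \<noteq> \<infinity>"
  then have "(\<Sum>k. ennreal (1 / (2 * real (Suc k)))) \<noteq> top"
    by (simp add: chordal_def)
  then have "summable (\<lambda>k. 1 / (2 * real (Suc k)))"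
    by (intro summable_suminf_not_top) auto
  then have "summable (\<lambda>k. 2 * (1 / (2 * real (Suc k))))" by (rule summable_mult)
  also have "(\<lambda>k. 2 * (1 / (2 * real (Suc k)))) = (\<lambda>k. inverse (real (Suc k)))"
    by (rule ext) (simp add: field_simps)
  finally have "summable (\<lambda>k. inverse (real (Suc k)))" .
  then show False using not_summable_harmonic[where 'a=real]
    using summable_Suc_iff[of "\<lambda>n. inverse (real n)"] by blast
qed

text \<open>Valid on the diagonal too, where both sides are minus infinity. It translates potentials
  and energies into integrals of a nonnegative kernel.\<close>

lemma elog_eq_chordal: "elog (cmod (z - w)) = ereal (lwt z + lwt w) - enn2ereal (chordal z w)"
proof (cases "z = w")
  case True
  then show ?thesis by (simp add: elog_def chordal_refl)
next
  case False
  then show ?thesis using chordal_eq[OF False] by (simp add: elog_def enn2ereal_ennreal)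
qed

lemma cnj_measurable[measurable]: "cnj \<in> borel_measurable borel"
  by (intro borel_measurable_continuous_onI continuous_intros)

lemma wt_measurable[measurable]: "wt \<in> borel_measurable borel"
  unfolding wt_def by measurable

lemma sph_measurable[measurable]: "(\<lambda>p. sph (fst p) (snd p)) \<in> borel_measurable (borel \<Otimes>\<^sub>M borel)"
  unfolding sph_def by measurable

lemma chordal_measurable[measurable]:
  "case_prod chordal \<in> borel_measurable (borel \<Otimes>\<^sub>M borel)"
  unfolding chordal_def split_beta by measurable

lemma lwt_continuous[continuous_intros]: "continuous_on A lwt"
  unfolding lwt_def wt_def
  by (intro continuous_intros) (auto simp: add_nonneg_eq_0_iff)

lemma lwt_measurable[measurable]: "lwt \<in> borel_measurable borel"
  by (intro borel_measurable_continuous_onI lwt_continuous)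

lemma lwt_nonneg: "0 \<le> lwt z"
  unfolding lwt_def wt_def by simp

lemma prob_measures_onD:
  assumes "\<mu> \<in> prob_measures_on C" "closed C"
  shows "prob_space \<mu>" "sets \<mu> = sets borel" "space \<mu> = UNIV" "AE x in \<mu>. x \<in> C"
proof -
  show 1: "prob_space \<mu>" and 2: "sets \<mu> = sets borel" using assms by (auto simp: prob_measures_on_def)
  show "space \<mu> = UNIV" using 2 by (metis sets_eq_imp_space_eq space_borel)
  have "C \<in> sets \<mu>" using 2 assms by auto
  then show "AE x in \<mu>. x \<in> C"
    using assms(1) prob_space.AE_prob_1[OF 1] 
    by (simp add: prob_measures_on_def measure_def)
qed

lemma prob_measures_onI:
  assumes "prob_space \<mu>" "sets \<mu> = sets borel" "closed C" "AE x in \<mu>. x \<in> C"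
  shows "\<mu> \<in> prob_measures_on C"
proof -
  have "C \<in> sets \<mu>" using assms by auto
  then have "emeasure \<mu> C = 1" using assms(1,4) prob_space.emeasure_eq_1_AE by blast
  then show ?thesis using assms by (auto simp: prob_measures_on_def)
qed

lemma prob_measures_on_mono:
  assumes "\<mu> \<in> prob_measures_on C" "closed C" "closed D" "C \<subseteq> D"
  shows "\<mu> \<in> prob_measures_on D"
  using prob_measures_onD[OF assms(1,2)] assms by (intro prob_measures_onI) auto

lemma integrable_continuous_compact:
  fixes f :: "complex \<Rightarrow> 'b::{banach, second_countable_topology}"
  assumes "\<mu> \<in> prob_measures_on C" "compact C" "continuous_on C f" "f \<in> borel_measurable borel"
  shows "integrable \<mu> f"
proof -
  have cl: "closed C" using assms by (simp add: compact_imp_closed)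
  note D = prob_measures_onD[OF assms(1) cl]
  interpret prob_space \<mu> by fact
  obtain B where B: "\<And>x. x \<in> C \<Longrightarrow> norm (f x) \<le> B"
    using compact_imp_bounded[OF compact_continuous_image[OF assms(3,2)]]
    by (auto simp: bounded_iff)
  show ?thesis
  proof (rule integrable_const_bound[where B=B])
    show "AE x in \<mu>. norm (f x) \<le> B" using D(4) by eventually_elim (rule B)
    show "f \<in> borel_measurable \<mu>" using assms(4) D(2) by (simp cong: measurable_cong_sets)
  qed
qed

lemma integrable_lwt:
  assumes "\<mu> \<in> prob_measures_on C" "compact C"
  shows "integrable \<mu> lwt"
  using assms by (intro integrable_continuous_compact) (auto intro: lwt_continuous)

section \<open>Potential and mutual energy for the chordal kernel\<close>

text \<open>As integrals of nonnegative functions, this potential and the mutual energy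
  \<open>cen\<close> always exist, and Tonelli's theorem makes \<open>cen\<close> symmetric even
  where it is infinite.\<close>

definition cpot :: "complex measure \<Rightarrow> complex \<Rightarrow> ennreal" where
  "cpot \<mu> z = (\<integral>\<^sup>+w. chordal z w \<partial>\<mu>)"

definition cen :: "complex measure \<Rightarrow> complex measure \<Rightarrow> ennreal" where
  "cen \<mu> \<nu> = (\<integral>\<^sup>+z. cpot \<mu> z \<partial>\<nu>)"

lemma chordal_measurable1[measurable]: "chordal z \<in> borel_measurable borel"
  unfolding chordal_def sph_def by measurable

lemma cpot_measurable:
  assumes "prob_space \<mu>" "sets \<mu> = sets borel"
  shows "cpot \<mu> \<in> borel_measurable borel"
proof -
  interpret prob_space \<mu> by fact
  have "case_prod chordal \<in> borel_measurable (borel \<Otimes>\<^sub>M \<mu>)"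
    using assms(2) by (simp cong: measurable_cong_sets sets_pair_measure_cong add: chordal_measurable)
  from borel_measurable_nn_integral[OF this]
  show ?thesis unfolding cpot_def by simp
qed

lemma cen_commute:
  assumes "prob_space \<mu>" "sets \<mu> = sets borel" "prob_space \<nu>" "sets \<nu> = sets borel"
  shows "cen \<mu> \<nu> = cen \<nu> \<mu>"
proof -
  interpret m: prob_space \<mu> by fact
  interpret n: prob_space \<nu> by fact
  interpret pair_sigma_finite \<nu> \<mu> ..
  have *: "case_prod chordal \<in> borel_measurable (\<nu> \<Otimes>\<^sub>M \<mu>)"
    using assms by (simp cong: measurable_cong_sets sets_pair_measure_cong add: chordal_measurable)
  have "cen \<mu> \<nu> = (\<integral>\<^sup>+w. (\<integral>\<^sup>+z. chordal z w \<partial>\<nu>) \<partial>\<mu>)"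
    unfolding cen_def cpot_def using Fubini'[of chordal] * by simp
  also have "\<dots> = cen \<nu> \<mu>"
    unfolding cen_def cpot_def by (simp add: chordal_commute)
  finally show ?thesis .
qed

lemma log_potential_eq:
  assumes "\<mu> \<in> prob_measures_on C" "compact C"
  shows "log_potential \<mu> z = ereal (lwt z + (\<integral>w. lwt w \<partial>\<mu>)) - enn2ereal (cpot \<mu> z)"
proof -
  have cl: "closed C" using assms by (simp add: compact_imp_closed)
  note D = prob_measures_onD[OF assms(1) cl]
  interpret prob_space \<mu> by fact
  have i: "integrable \<mu> lwt" using assms by (rule integrable_lwt)
  have "log_potential \<mu> z = ereal_integral \<mu> (\<lambda>w. ereal (lwt z + lwt w) - enn2ereal (chordal z w))"
    unfolding log_potential_def elog_eq_chordal ..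
  also have "\<dots> = ereal (\<integral>w. lwt z + lwt w \<partial>\<mu>) - enn2ereal (cpot \<mu> z)"
    unfolding cpot_def using i D(2)
    by (intro ereal_integral_diff) (auto cong: measurable_cong_sets)
  also have "(\<integral>w. lwt z + lwt w \<partial>\<mu>) = lwt z + (\<integral>w. lwt w \<partial>\<mu>)"
    using i by (simp add: prob_space)
  finally show ?thesis .
qed

lemma log_energy_eq:
  assumes "\<mu> \<in> prob_measures_on C" "compact C"
  shows "log_energy \<mu> = ereal (2 * (\<integral>w. lwt w \<partial>\<mu>)) - enn2ereal (cen \<mu> \<mu>)"
proof -
  have cl: "closed C" using assms by (simp add: compact_imp_closed)
  note D = prob_measures_onD[OF assms(1) cl]
  interpret prob_space \<mu> by fact
  have i: "integrable \<mu> lwt" using assms by (rule integrable_lwt)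
  have "log_energy \<mu> = ereal_integral \<mu> (\<lambda>z. ereal (lwt z + (\<integral>w. lwt w \<partial>\<mu>)) - enn2ereal (cpot \<mu> z))"
    unfolding log_energy_def using log_potential_eq[OF assms] by presburger
  also have "\<dots> = ereal (\<integral>z. lwt z + (\<integral>w. lwt w \<partial>\<mu>) \<partial>\<mu>) - enn2ereal (cen \<mu> \<mu>)"
    unfolding cen_def using i D(2) cpot_measurable[OF D(1,2)]
    by (intro ereal_integral_diff) (auto cong: measurable_cong_sets)
  also have "(\<integral>z. lwt z + (\<integral>w. lwt w \<partial>\<mu>) \<partial>\<mu>) = 2 * (\<integral>w. lwt w \<partial>\<mu>)"
    using i by (simp add: prob_space)
  finally show ?thesis .
qed

section \<open>Finite-rank expansion of the kernel by moments\<close>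

text \<open>The functions into which the kernel \<open>sph z w ^ k\<close> splits. For indices
  \<open>i\<close> and \<open>j\<close> up to \<open>k\<close> they are bounded and continuous on
  the whole plane.\<close>

definition smono :: "nat \<Rightarrow> nat \<Rightarrow> nat \<Rightarrow> complex \<Rightarrow> complex" where
  "smono k i j z = z ^ i * cnj z ^ j / of_real (wt z) ^ k"

definition smom :: "complex measure \<Rightarrow> nat \<Rightarrow> nat \<Rightarrow> nat \<Rightarrow> complex" where
  "smom \<mu> k i j = (\<integral>z. smono k i j z \<partial>\<mu>)"

lemma wt_continuous[continuous_intros]: "continuous_on A f \<Longrightarrow> continuous_on A (\<lambda>x. wt (f x))"
  unfolding wt_def by (intro continuous_intros)

lemma smono_continuous: "continuous_on A (smono k i j)"
  unfolding smono_def by (intro continuous_intros) auto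

lemma smono_measurable[measurable]: "smono k i j \<in> borel_measurable borel"
  by (intro borel_measurable_continuous_onI smono_continuous)

lemma integrable_smono:
  assumes "\<mu> \<in> prob_measures_on C" "compact C"
  shows "integrable \<mu> (smono k i j)"
  using assms by (intro integrable_continuous_compact) (auto intro: smono_continuous)

text \<open>The binomial theorem for 1 + z * cnj w and for its conjugate. All weights are
  nonnegative and each term is a function of \<open>z\<close> times the conjugate of the same
  function of \<open>w\<close>, so the kernel is positive definite of finite rank, and measures
  enter its energy only through their moments \<open>smom\<close>.\<close>

lemma sph_power_expansion:
  "complex_of_real (sph z w ^ k) =
    (\<Sum>i\<le>k. \<Sum>j\<le>k. of_nat (k choose i) * of_nat (k choose j) * (smono k i j z * cnj (smono k i j w)))"
proof -
  let ?x = "1 + z * cnj w"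
  let ?d = "complex_of_real (wt z * wt w) ^ k"
  have 1: "?x ^ k = (\<Sum>i\<le>k. of_nat (k choose i) * (z * cnj w) ^ i)"
    using binomial_ring[of "z * cnj w" 1 k] by (simp add: add.commute)
  have 2: "cnj ?x ^ k = (\<Sum>j\<le>k. of_nat (k choose j) * (cnj z * w) ^ j)"
    using binomial_ring[of "cnj z * w" 1 k] by (simp add: add.commute)
  have "complex_of_real (sph z w ^ k) = (of_real ((cmod ?x)\<^sup>2)) ^ k / ?d"
    unfolding sph_def by (simp add: power_divide)
  also have "\<dots> = (?x ^ k * cnj ?x ^ k) / ?d"
    by (subst complex_norm_square) (rule arg_cong2[where f="(/)"], rule power_mult_distrib, rule refl)
  also have "\<dots> = (\<Sum>i\<le>k. \<Sum>j\<le>k. (of_nat (k choose i) * (z * cnj w) ^ i) * (of_nat (k choose j) * (cnj z * w) ^ j) / ?d)"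
    unfolding 1 2 sum_product sum_divide_distrib ..
  also have "\<dots> = (\<Sum>i\<le>k. \<Sum>j\<le>k. of_nat (k choose i) * of_nat (k choose j) * (smono k i j z * cnj (smono k i j w)))"
    by (intro sum.cong refl) (simp add: smono_def power_mult_distrib mult_ac)
  finally show ?thesis .
qed

definition sphint :: "complex measure \<Rightarrow> nat \<Rightarrow> complex \<Rightarrow> real" where
  "sphint \<mu> k z = (\<integral>w. sph z w ^ k \<partial>\<mu>)"

definition sphpair :: "complex measure \<Rightarrow> complex measure \<Rightarrow> nat \<Rightarrow> real" where
  "sphpair \<mu> \<nu> k = (\<integral>z. sphint \<mu> k z \<partial>\<nu>)"

lemma sph_continuous: "continuous_on A (sph z)"
  unfolding sph_def by (intro continuous_intros) auto

lemma sph_measurable1[measurable]: "sph z \<in> borel_measurable borel"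
  by (intro borel_measurable_continuous_onI sph_continuous)

lemma integrable_sph:
  assumes "\<mu> \<in> prob_measures_on C" "compact C"
  shows "integrable \<mu> (\<lambda>w. sph z w ^ k)"
  using assms by (intro integrable_continuous_compact continuous_intros sph_continuous) auto

lemma sphint_expansion:
  assumes "\<mu> \<in> prob_measures_on C" "compact C"
  shows "complex_of_real (sphint \<mu> k z) =
    (\<Sum>i\<le>k. \<Sum>j\<le>k. of_nat (k choose i) * of_nat (k choose j) * (smono k i j z * cnj (smom \<mu> k i j)))"
proof -
  have "complex_of_real (sphint \<mu> k z) = (\<integral>w. complex_of_real (sph z w ^ k) \<partial>\<mu>)"
    unfolding sphint_def by (simp del: of_real_power)
  also have "\<dots> = (\<Sum>i\<le>k. \<Sum>j\<le>k. of_nat (k choose i) * of_nat (k choose j) * (smono k i j z * cnj (smom \<mu> k i j)))"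
    unfolding sph_power_expansion smom_def
    using integrable_smono[OF assms] by (simp add: Bochner_Integration.integral_sum)
  finally show ?thesis .
qed

lemma sphint_continuous:
  assumes "\<mu> \<in> prob_measures_on C" "compact C"
  shows "continuous_on A (sphint \<mu> k)"
proof -
  have "sphint \<mu> k = (\<lambda>z. Re (\<Sum>i\<le>k. \<Sum>j\<le>k. of_nat (k choose i) * of_nat (k choose j) * (smono k i j z * cnj (smom \<mu> k i j))))"
    using sphint_expansion[OF assms] by (metis Re_complex_of_real)
  then show ?thesis
    by (simp only:) (intro continuous_intros smono_continuous)
qed

lemma sphint_measurable:
  assumes "\<mu> \<in> prob_measures_on C" "compact C"
  shows "sphint \<mu> k \<in> borel_measurable borel"
  using assms by (intro borel_measurable_continuous_onI sphint_continuous)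

lemma sphint_nonneg: "0 \<le> sphint \<mu> k z"
  unfolding sphint_def by (intro Bochner_Integration.integral_nonneg) auto

lemma sphpair_nonneg: "0 \<le> sphpair \<mu> \<nu> k"
  unfolding sphpair_def by (intro Bochner_Integration.integral_nonneg) (auto simp: sphint_nonneg)

lemma integrable_sphint:
  assumes "\<mu> \<in> prob_measures_on C" "compact C" "\<nu> \<in> prob_measures_on D" "compact D"
  shows "integrable \<nu> (sphint \<mu> k)"
  by (intro integrable_continuous_compact[OF assms(3,4)] sphint_continuous[OF assms(1,2)] sphint_measurable[OF assms(1,2)])

lemma sphpair_expansion:
  assumes "\<mu> \<in> prob_measures_on C" "compact C" "\<nu> \<in> prob_measures_on D" "compact D"
  shows "complex_of_real (sphpair \<mu> \<nu> k) =
    (\<Sum>i\<le>k. \<Sum>j\<le>k. of_nat (k choose i) * of_nat (k choose j) * (smom \<nu> k i j * cnj (smom \<mu> k i j)))"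
proof -
  have "complex_of_real (sphpair \<mu> \<nu> k) = (\<integral>z. complex_of_real (sphint \<mu> k z) \<partial>\<nu>)"
    unfolding sphpair_def by simp
  also have "\<dots> = (\<Sum>i\<le>k. \<Sum>j\<le>k. of_nat (k choose i) * of_nat (k choose j) * (smom \<nu> k i j * cnj (smom \<mu> k i j)))"
    unfolding sphint_expansion[OF assms(1,2)] smom_def[of \<nu>]
    using integrable_smono[OF assms(3,4)] by (simp add: Bochner_Integration.integral_sum)
  finally show ?thesis .
qed

lemma cpot_eq_suminf:
  assumes "\<mu> \<in> prob_measures_on C" "compact C"
  shows "cpot \<mu> z = (\<Sum>k. ennreal (sphint \<mu> (Suc k) z / (2 * real (Suc k))))"
proof -
  have s: "sets \<mu> = sets borel" using assms by (simp add: prob_measures_on_def)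
  have "cpot \<mu> z = (\<Sum>k. \<integral>\<^sup>+w. ennreal (sph z w ^ Suc k / (2 * real (Suc k))) \<partial>\<mu>)"
    unfolding cpot_def chordal_def using s
    by (intro nn_integral_suminf) (auto cong: measurable_cong_sets)
  moreover have "(\<integral>\<^sup>+w. ennreal (sph z w ^ Suc k / (2 * real (Suc k))) \<partial>\<mu>)
      = ennreal (sphint \<mu> (Suc k) z / (2 * real (Suc k)))" for k
    unfolding sphint_def using integrable_sph[OF assms, of z "Suc k"]
    by (subst nn_integral_eq_integral) (auto simp del: power_Suc)
  ultimately show ?thesis by presburger
qed

lemma cen_eq_suminf:
  assumes "\<mu> \<in> prob_measures_on C" "compact C" "\<nu> \<in> prob_measures_on D" "compact D"
  shows "cen \<mu> \<nu> = (\<Sum>k. ennreal (sphpair \<mu> \<nu> (Suc k) / (2 * real (Suc k))))"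
proof -
  have s: "sets \<nu> = sets borel" using assms by (simp add: prob_measures_on_def)
  have [measurable]: "sphint \<mu> k \<in> borel_measurable \<nu>" for k
    using sphint_measurable[OF assms(1,2)] s by (simp cong: measurable_cong_sets)
  have "cen \<mu> \<nu> = (\<Sum>k. \<integral>\<^sup>+z. ennreal (sphint \<mu> (Suc k) z / (2 * real (Suc k))) \<partial>\<nu>)"
    unfolding cen_def cpot_eq_suminf[OF assms(1,2)]
    by (intro nn_integral_suminf) auto
  moreover have "(\<integral>\<^sup>+z. ennreal (sphint \<mu> (Suc k) z / (2 * real (Suc k))) \<partial>\<nu>)
      = ennreal (sphpair \<mu> \<nu> (Suc k) / (2 * real (Suc k)))" for k
    unfolding sphpair_def using integrable_sphint[OF assms, of "Suc k"]
    by (subst nn_integral_eq_integral) (auto simp: sphint_nonneg)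
  ultimately show ?thesis by presburger
qed

lemma Re_of_real_mult: "Re (of_real r * z) = r * Re z"
  by simp

lemma sum_sum_polarization:
  fixes x y z c :: "'a \<Rightarrow> 'b \<Rightarrow> real"
  shows "(\<Sum>i\<in>A. \<Sum>j\<in>B. c i j * x i j) + (\<Sum>i\<in>A. \<Sum>j\<in>B. c i j * y i j) - 2 * (\<Sum>i\<in>A. \<Sum>j\<in>B. c i j * z i j)
    = (\<Sum>i\<in>A. \<Sum>j\<in>B. c i j * (x i j + y i j - 2 * z i j))"
  by (simp add: sum.distrib sum_subtractf sum_distrib_left ring_distribs mult.left_commute)

text \<open>The left side is the energy of the signed measure \<mu> - \<nu> for the kernel
  \<open>sph z w ^ k\<close>; the right side shows it as a sum of squares, with weights that are
  strictly positive in the range of summation.\<close>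

lemma sphpair_defect:
  assumes "\<mu> \<in> prob_measures_on C" "compact C" "\<nu> \<in> prob_measures_on D" "compact D"
  shows "sphpair \<mu> \<mu> k + sphpair \<nu> \<nu> k - 2 * sphpair \<mu> \<nu> k =
    (\<Sum>i\<le>k. \<Sum>j\<le>k. real (k choose i) * real (k choose j) * (cmod (smom \<mu> k i j - smom \<nu> k i j))\<^sup>2)"
proof -
  have *: "sphpair \<mu>' \<nu>' k = (\<Sum>i\<le>k. \<Sum>j\<le>k. real (k choose i) * real (k choose j) * Re (smom \<nu>' k i j * cnj (smom \<mu>' k i j)))"
    if "\<mu>' \<in> prob_measures_on C'" "compact C'" "\<nu>' \<in> prob_measures_on D'" "compact D'" for \<mu>' \<nu>' C' D'
  proof -
    have "sphpair \<mu>' \<nu>' k = Re (complex_of_real (sphpair \<mu>' \<nu>' k))" by simp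
    also have "\<dots> = (\<Sum>i\<le>k. \<Sum>j\<le>k. Re (of_real (real (k choose i) * real (k choose j)) * (smom \<nu>' k i j * cnj (smom \<mu>' k i j))))"
      unfolding sphpair_expansion[OF that] Re_sum of_real_mult of_real_of_nat_eq ..
    finally show ?thesis by (simp only: Re_of_real_mult)
  qed
  have sq: "(cmod (a - b))\<^sup>2 = Re (a * cnj a) + Re (b * cnj b) - 2 * Re (b * cnj a)" for a b
    unfolding cmod_power2 by (simp add: power2_eq_square algebra_simps)
  show ?thesis
    unfolding *[OF assms] *[OF assms(1,2,1,2)] *[OF assms(3,4,3,4)] sq
    by (rule sum_sum_polarization[where c="\<lambda>i j. real (k choose i) * real (k choose j)"])
qed

section \<open>Moments determine the measure\<close>

text \<open>Products add the indices and conjugation swaps \<open>i\<close> with \<open>j\<close>,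
  so this span is a self-conjugate algebra. The bounds on \<open>i\<close> and \<open>j\<close>
  admit exactly the moments that occur in \<open>sphpair_defect\<close>.\<close>

inductive_set salg :: "(complex \<Rightarrow> complex) set" where
  smono: "i \<le> k \<Longrightarrow> j \<le> k \<Longrightarrow> smono k i j \<in> salg"
| add: "f \<in> salg \<Longrightarrow> g \<in> salg \<Longrightarrow> (\<lambda>z. f z + g z) \<in> salg"
| scale: "f \<in> salg \<Longrightarrow> (\<lambda>z. c * f z) \<in> salg"

lemma salg_cnj: "f \<in> salg \<Longrightarrow> (\<lambda>z. cnj (f z)) \<in> salg"
proof (induction rule: salg.induct)
  case (smono i k j)
  have "(\<lambda>z. cnj (smono k i j z)) = smono k j i"
    by (rule ext) (simp add: smono_def mult.commute)
  then show ?case using smono by (auto intro: salg.smono)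
next
  case (add f g)
  show ?case using salg.add[OF add.IH] by simp
next
  case (scale f c)
  show ?case using salg.scale[OF scale.IH, of "cnj c"] by simp
qed

lemma salg_mult_smono: "f \<in> salg \<Longrightarrow> i \<le> k \<Longrightarrow> j \<le> k \<Longrightarrow> (\<lambda>z. f z * smono k i j z) \<in> salg"
proof (induction rule: salg.induct)
  case (smono i' k' j')
  have "(\<lambda>z. smono k' i' j' z * smono k i j z) = smono (k' + k) (i' + i) (j' + j)"
    by (rule ext) (simp add: smono_def power_add mult_ac)
  then show ?case using smono by (auto intro: salg.smono)
next
  case (add f g)
  show ?case using salg.add[OF add.IH(1)[OF add.prems] add.IH(2)[OF add.prems]] by (simp add: distrib_right)
next
  case (scale f c)
  show ?case using salg.scale[OF scale.IH[OF scale.prems], of c] by (simp add: mult.assoc)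
qed

lemma salg_mult: "g \<in> salg \<Longrightarrow> f \<in> salg \<Longrightarrow> (\<lambda>z. f z * g z) \<in> salg"
proof (induction rule: salg.induct)
  case (smono i k j)
  then show ?case using salg_mult_smono by blast
next
  case (add g h)
  show ?case using salg.add[OF add.IH(1)[OF add.prems] add.IH(2)[OF add.prems]] by (simp add: distrib_left)
next
  case (scale g c)
  show ?case using salg.scale[OF scale.IH[OF scale.prems], of c] by (simp add: mult.left_commute)
qed

lemma salg_continuous: "f \<in> salg \<Longrightarrow> continuous_on A f"
  by (induction rule: salg.induct) (auto intro!: continuous_intros smono_continuous)

lemma salg_const: "(\<lambda>_. c) \<in> salg"
proof -
  have "smono 0 0 0 \<in> salg" by (intro salg.smono) auto
  from salg.scale[OF this, of c] show ?thesis by (simp add: smono_def)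
qed

text \<open>The functions 1 / wt z and z / wt z both belong to the algebra, and their values
  determine z.\<close>

lemma salg_separates:
  assumes "z \<noteq> w"
  shows "\<exists>f\<in>salg. f z \<noteq> f w"
proof (rule ccontr)
  assume "\<not> ?thesis"
  then have eq: "f z = f w" if "f \<in> salg" for f using that by blast
  have "smono 1 0 0 \<in> salg" "smono 1 1 0 \<in> salg" by (intro salg.smono; simp)+
  from eq[OF this(1)] eq[OF this(2)] have "wt z = wt w" "z / of_real (wt z) = w / of_real (wt w)"
    by (simp_all add: smono_def)
  then show False using assms by simp
qed

lemma salg_dense:
  fixes f :: "complex \<Rightarrow> real"
  assumes "compact S" "continuous_on S f" "e > 0"
  shows "\<exists>g\<in>salg. \<forall>z\<in>S. \<bar>f z - Re (g z)\<bar> < e"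
proof -
  interpret function_ring_on "{h. \<exists>g\<in>salg. h = (\<lambda>z. Re (g z))}" S
  proof
    show "compact S" by fact
  next
    fix f assume "f \<in> {h. \<exists>g\<in>salg. h = (\<lambda>z. Re (g z))}"
    then show "continuous_on S f" by (auto intro!: continuous_intros salg_continuous)
  next
    fix f g assume "f \<in> {h. \<exists>g\<in>salg. h = (\<lambda>z. Re (g z))}" "g \<in> {h. \<exists>g\<in>salg. h = (\<lambda>z. Re (g z))}"
    then obtain f' g' where fg: "f' \<in> salg" "g' \<in> salg" and [simp]: "f = (\<lambda>z. Re (f' z))" "g = (\<lambda>z. Re (g' z))"
      by blast
    show "(\<lambda>x. f x + g x) \<in> {h. \<exists>g\<in>salg. h = (\<lambda>z. Re (g z))}"
      using salg.add[OF fg] by (auto intro!: bexI[of _ "\<lambda>z. f' z + g' z"])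
    \<comment> \<open>Real parts of complex functions are not multiplicative; this combination has
      real part Re f' * Re g'.\<close>
    have "(\<lambda>z. 1/2 * (f' z * g' z + f' z * cnj (g' z))) \<in> salg"
      by (intro salg.scale salg.add salg_mult salg_cnj fg)
    moreover have "f z * g z = Re (1/2 * (f' z * g' z + f' z * cnj (g' z)))" for z
      by (simp add: field_simps)
    ultimately show "(\<lambda>x. f x * g x) \<in> {h. \<exists>g\<in>salg. h = (\<lambda>z. Re (g z))}" by (intro CollectI bexI ext)
  next
    fix c
    have "(\<lambda>_. complex_of_real c) \<in> salg" by (rule salg_const)
    then show "(\<lambda>_. c) \<in> {h. \<exists>g\<in>salg. h = (\<lambda>z. Re (g z))}" by (auto intro!: bexI[of _ "\<lambda>_. complex_of_real c"])
  next
    fix x y :: complex assume "x \<noteq> y"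
    then obtain f where f: "f \<in> salg" "f x \<noteq> f y" using salg_separates by blast
    \<comment> \<open>Multiplication by - \<i> turns the imaginary part into a real part, so a
      difference in either part is visible in the ring of real parts.\<close>
    then have "Re (f x) \<noteq> Re (f y) \<or> Re (- \<i> * f x) \<noteq> Re (- \<i> * f y)"
      by (auto simp: complex_eq_iff)
    then show "\<exists>f\<in>{h. \<exists>g\<in>salg. h = (\<lambda>z. Re (g z))}. f x \<noteq> f y"
    proof
      assume "Re (f x) \<noteq> Re (f y)"
      then show ?thesis using f(1) by (intro bexI[of _ "\<lambda>z. Re (f z)"] CollectI bexI[of _ f]) auto
    next
      assume "Re (- \<i> * f x) \<noteq> Re (- \<i> * f y)"
      then show ?thesis using salg.scale[OF f(1), of "- \<i>"]
        by (intro bexI[of _ "\<lambda>z. Re (- \<i> * f z)"] CollectI bexI[of _ "\<lambda>z. - \<i> * f z"]) auto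
    qed
  qed
  from Stone_Weierstrass_basic[OF assms(2,3)] show ?thesis by auto
qed

text \<open>Closed sets generate the Borel sets and are stable under intersection, and the indicator
  of a closed set is a pointwise limit of the continuous cutoffs \<open>f n\<close>.\<close>

lemma measure_eq_if_continuous_integrals_eq:
  fixes \<mu> \<nu> :: "complex measure"
  assumes "prob_space \<mu>" "sets \<mu> = sets borel" "prob_space \<nu>" "sets \<nu> = sets borel"
    and eq: "\<And>f :: complex \<Rightarrow> real. continuous_on UNIV f \<Longrightarrow> (\<And>x. 0 \<le> f x \<and> f x \<le> 1) \<Longrightarrow> (\<integral>x. f x \<partial>\<mu>) = (\<integral>x. f x \<partial>\<nu>)"
  shows "\<mu> = \<nu>"
proof (rule measure_eqI_generator_eq[where E="Collect closed" and \<Omega>=UNIV and A="\<lambda>_. UNIV"])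
  interpret m: prob_space \<mu> by fact
  interpret n: prob_space \<nu> by fact
  show "Int_stable (Collect closed :: complex set set)" by (auto simp: Int_stable_def)
  show "sets \<mu> = sigma_sets UNIV (Collect closed)" "sets \<nu> = sigma_sets UNIV (Collect closed)"
    using assms by (auto simp: borel_eq_closed)
  show "emeasure \<mu> UNIV \<noteq> \<infinity>" by simp
  fix F :: "complex set" assume "F \<in> Collect closed"
  then have F: "closed F" by simp
  show "emeasure \<mu> F = emeasure \<nu> F"
  \<comment> \<open>The distance \<open>infdist\<close> to the empty set is 0 by convention, so the
    cutoffs would converge to 1 there.\<close>
  proof (cases "F = {}")
    case False
    define f where "f n x = max 0 (1 - real n * infdist x F)" for n x
    have fc: "continuous_on UNIV (f n)" for n
      unfolding f_def by (intro continuous_intros)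
    have fb: "0 \<le> f n x \<and> f n x \<le> 1" for n x
      unfolding f_def using infdist_nonneg[of x F] by auto
    have lim: "(\<lambda>n. f n x) \<longlonglongrightarrow> indicator F x" for x
    proof (cases "x \<in> F")
      case True
      then show ?thesis by (simp add: f_def)
    next
      case x: False
      then have d: "infdist x F > 0" using F False by (metis in_closed_iff_infdist_zero infdist_nonneg less_eq_real_def)
      obtain N :: nat where N: "1 < real N * infdist x F" using d reals_Archimedean3 by blast
      have "f n x = 0" if "n \<ge> N" for n
      proof -
        have "real N * infdist x F \<le> real n * infdist x F" using that d by (intro mult_right_mono) auto
        then show ?thesis using N unfolding f_def by simp
      qed
      then have "eventually (\<lambda>n. f n x = indicator F x) sequentially"
        using x by (auto simp: eventually_sequentially)
      then show ?thesis by (rule tendsto_eventually)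
    qed
    have conv: "(\<lambda>n. \<integral>x. f n x \<partial>M) \<longlonglongrightarrow> measure M F" if "prob_space M" "sets M = sets borel" for M
    proof -
      interpret prob_space M by fact
      have "(\<lambda>n. \<integral>x. f n x \<partial>M) \<longlonglongrightarrow> (\<integral>x. indicator F x \<partial>M)"
      proof (rule integral_dominated_convergence[where w="\<lambda>_. 1"])
        show "indicator F \<in> borel_measurable M" "f n \<in> borel_measurable M" for n
          using F that(2) fc by (auto simp: borel_measurable_continuous_onI cong: measurable_cong_sets)
      qed (use lim fb in auto)
      moreover have "F \<in> sets M" using F that by auto
      ultimately show ?thesis by simp
    qed
    have "measure \<mu> F = measure \<nu> F"
      using LIMSEQ_unique[OF conv[OF assms(1,2)]] conv[OF assms(3,4)] eq[OF fc fb] by simp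
    then show ?thesis by (simp add: m.emeasure_eq_measure n.emeasure_eq_measure)
  qed simp
qed auto

text \<open>By Stone-Weierstrass on \<open>C \<union> D\<close>, the moments determine the integral
  of every continuous function.\<close>

lemma measure_eq_if_smom_eq:
  assumes "\<mu> \<in> prob_measures_on C" "compact C" "\<nu> \<in> prob_measures_on D" "compact D"
    and eq: "\<And>k i j. 0 < k \<Longrightarrow> i \<le> k \<Longrightarrow> j \<le> k \<Longrightarrow> smom \<mu> k i j = smom \<nu> k i j"
  shows "\<mu> = \<nu>"
proof -
  note D1 = prob_measures_onD[OF assms(1) compact_imp_closed[OF assms(2)]]
  note D2 = prob_measures_onD[OF assms(3) compact_imp_closed[OF assms(4)]]
  interpret m: prob_space \<mu> by fact
  interpret n: prob_space \<nu> by fact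
  have intsalg: "integrable \<mu> f \<and> integrable \<nu> f \<and> (\<integral>z. f z \<partial>\<mu>) = (\<integral>z. f z \<partial>\<nu>)" if "f \<in> salg" for f
    using that
  proof (induction rule: salg.induct)
    case (smono i k j)
    have "smom \<mu> k i j = smom \<nu> k i j"
    \<comment> \<open>Here \<open>i\<close> and \<open>j\<close> are 0 as well, and the moment is
      the total mass 1.\<close>
    proof (cases "k = 0")
      case True
      then show ?thesis using smono by (simp add: smom_def smono_def m.prob_space n.prob_space)
    qed (use eq smono in auto)
    then show ?case using integrable_smono assms by (auto simp: smom_def)
  qed auto
  show ?thesis
  proof (rule measure_eq_if_continuous_integrals_eq)
    fix f :: "complex \<Rightarrow> real" assume f: "continuous_on UNIV f"
    have c: "compact (C \<union> D)" using assms by (intro compact_Un)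
    have fm: "f \<in> borel_measurable borel" using f by (rule borel_measurable_continuous_onI)
    have fi: "integrable \<mu> f" "integrable \<nu> f"
      using assms f fm continuous_on_subset[OF f] by (auto intro: integrable_continuous_compact)
    have le: "\<bar>(\<integral>x. f x \<partial>\<mu>) - (\<integral>x. f x \<partial>\<nu>)\<bar> \<le> 2 * e" if e: "e > 0" for e
    proof -
      obtain g where g: "g \<in> salg" "\<And>z. z \<in> C \<union> D \<Longrightarrow> \<bar>f z - Re (g z)\<bar> < e"
        using salg_dense[OF c continuous_on_subset[OF f] e] by blast
      note G = intsalg[OF g(1)]
      have G': "(\<integral>z. Re (g z) \<partial>\<mu>) = (\<integral>z. Re (g z) \<partial>\<nu>)" using G by (metis integral_Re)
      have B: "\<bar>\<integral>x. f x - Re (g x) \<partial>M\<bar> \<le> e"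
        if "prob_space M" "integrable M f" "integrable M g" "AE x in M. x \<in> C \<union> D" for M
      proof -
        interpret prob_space M by fact
        have "\<bar>\<integral>x. f x - Re (g x) \<partial>M\<bar> \<le> (\<integral>x. \<bar>f x - Re (g x)\<bar> \<partial>M)"
          by (rule integral_abs_bound)
        also have "\<dots> \<le> (\<integral>x. e \<partial>M)"
        proof (rule integral_mono_AE)
          show "integrable M (\<lambda>x. \<bar>f x - Re (g x)\<bar>)" using that by simp
          show "AE x in M. \<bar>f x - Re (g x)\<bar> \<le> e"
            using that(4) by eventually_elim (rule less_imp_le[OF g(2)])
        qed simp
        finally show ?thesis by (simp add: prob_space)
      qed
      have AE: "AE x in \<mu>. x \<in> C \<union> D" "AE x in \<nu>. x \<in> C \<union> D"
        using D1(4) D2(4) by (auto elim: eventually_mono)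
      have "\<bar>\<integral>x. f x - Re (g x) \<partial>\<mu>\<bar> \<le> e" "\<bar>\<integral>x. f x - Re (g x) \<partial>\<nu>\<bar> \<le> e"
        using B[OF D1(1) fi(1) _ AE(1)] B[OF D2(1) fi(2) _ AE(2)] G by blast+
      then show ?thesis using fi G G' by simp
    qed
    then have "\<bar>(\<integral>x. f x \<partial>\<mu>) - (\<integral>x. f x \<partial>\<nu>)\<bar> \<le> 0 + e" if "e > 0" for e
    proof -
      have "e / 2 > 0" using that by simp
      then show ?thesis using le[of "e / 2"] by simp
    qed
    from field_le_epsilon[OF this] show "(\<integral>x. f x \<partial>\<mu>) = (\<integral>x. f x \<partial>\<nu>)" by simp
  qed (use D1 D2 in auto)
qed

text \<open>Strict definiteness of the energy. The difference of the two sides of the last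
  hypothesis is the energy of \<mu> - \<nu>, a series whose terms are the nonnegative sums of
  squares of \<open>sphpair_defect\<close>. A nonpositive sum forces every term to vanish, hence
  every moment difference.\<close>

lemma cen_parallelogram_unique:
  assumes "\<mu> \<in> prob_measures_on C" "compact C" "\<nu> \<in> prob_measures_on D" "compact D"
    and fin: "cen \<mu> \<mu> < \<infinity>" "cen \<nu> \<nu> < \<infinity>" and le: "cen \<mu> \<mu> + cen \<nu> \<nu> \<le> 2 * cen \<mu> \<nu>"
  shows "\<mu> = \<nu>"
proof -
  define a b c where "a k = sphpair \<mu> \<mu> (Suc k) / (2 * real (Suc k))"
    and "b k = sphpair \<nu> \<nu> (Suc k) / (2 * real (Suc k))"
    and "c k = sphpair \<mu> \<nu> (Suc k) / (2 * real (Suc k))" for k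
  have nn: "0 \<le> a k" "0 \<le> b k" "0 \<le> c k" for k
    unfolding a_def b_def c_def by (auto intro!: divide_nonneg_nonneg sphpair_nonneg)
  have e: "cen \<mu> \<mu> = (\<Sum>k. ennreal (a k))" "cen \<nu> \<nu> = (\<Sum>k. ennreal (b k))" "cen \<mu> \<nu> = (\<Sum>k. ennreal (c k))"
    unfolding a_def b_def c_def by (intro cen_eq_suminf[OF assms(1,2,1,2)] cen_eq_suminf[OF assms(3,4,3,4)] cen_eq_suminf[OF assms(1-4)])+
  have sa: "summable a" and sb: "summable b"
  proof -
    have "(\<Sum>k. ennreal (a k)) \<noteq> top" "(\<Sum>k. ennreal (b k)) \<noteq> top"
      using fin unfolding e by auto
    then show "summable a" "summable b"
      using summable_suminf_not_top[of a] summable_suminf_not_top[of b] nn by blast+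
  qed
  have d: "a k + b k - 2 * c k =
    (\<Sum>i\<le>Suc k. \<Sum>j\<le>Suc k. real (Suc k choose i) * real (Suc k choose j) * (cmod (smom \<mu> (Suc k) i j - smom \<nu> (Suc k) i j))\<^sup>2) / (2 * real (Suc k))" for k
    unfolding sphpair_defect[OF assms(1-4), symmetric] a_def b_def c_def
    by (simp only: add_divide_distrib diff_divide_distrib times_divide_eq_right)
  have d0: "0 \<le> a k + b k - 2 * c k" for k
    unfolding d by (intro divide_nonneg_nonneg sum_nonneg mult_nonneg_nonneg) auto
  \<comment> \<open>The mixed energy is finite because the termwise defects give 2 c <= a +
    b.\<close>
  have sc: "summable c"
  proof (rule summable_comparison_test')
    show "summable (\<lambda>k. a k + b k)" by (intro summable_add sa sb)
    show "norm (c k) \<le> a k + b k" for k using d0[of k] nn[of k] by simp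
  qed
  have "ennreal (suminf a) + ennreal (suminf b) \<le> 2 * ennreal (suminf c)"
    using le unfolding e by (simp add: suminf_ennreal2 nn sa sb sc)
  also have "2 * ennreal (suminf c) = ennreal (2 * suminf c)"
    using nn by (simp add: ennreal_mult suminf_nonneg sc)
  finally have "suminf a + suminf b \<le> 2 * suminf c"
    using nn sa sb sc by (simp add: suminf_nonneg ennreal_plus[symmetric] del: ennreal_plus)
  moreover have sums: "(\<lambda>k. a k + b k - 2 * c k) sums (suminf a + suminf b - 2 * suminf c)"
    by (intro sums_diff sums_add sums_mult summable_sums sa sb sc)
  ultimately have le0: "(\<Sum>k. a k + b k - 2 * c k) \<le> 0"
    using sums_unique[OF sums] by linarith
  have sd: "summable (\<lambda>k. a k + b k - 2 * c k)" using sums by (rule sums_summable)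
  have "(\<Sum>k. a k + b k - 2 * c k) = 0"
    using le0 suminf_nonneg[OF sd d0] by linarith
  then have z: "a k + b k - 2 * c k = 0" for k
    using suminf_eq_zero_iff[OF sd d0] by blast
  have "smom \<mu> (Suc k) i j = smom \<nu> (Suc k) i j" if "i \<le> Suc k" "j \<le> Suc k" for k i j
  proof -
    have "(\<Sum>i\<le>Suc k. \<Sum>j\<le>Suc k. real (Suc k choose i) * real (Suc k choose j) * (cmod (smom \<mu> (Suc k) i j - smom \<nu> (Suc k) i j))\<^sup>2) = 0"
      using z[of k] unfolding d by (simp del: sum.atMost_Suc)
    then have "\<forall>i\<in>{..Suc k}. (\<Sum>j\<le>Suc k. real (Suc k choose i) * real (Suc k choose j) * (cmod (smom \<mu> (Suc k) i j - smom \<nu> (Suc k) i j))\<^sup>2) = 0"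
      by (subst (asm) sum_nonneg_eq_0_iff) (auto intro!: sum_nonneg simp del: sum.atMost_Suc)
    then have "(\<Sum>j\<le>Suc k. real (Suc k choose i) * real (Suc k choose j) * (cmod (smom \<mu> (Suc k) i j - smom \<nu> (Suc k) i j))\<^sup>2) = 0"
      using that by blast
    then have "\<forall>j\<in>{..Suc k}. real (Suc k choose i) * real (Suc k choose j) * (cmod (smom \<mu> (Suc k) i j - smom \<nu> (Suc k) i j))\<^sup>2 = 0"
      by (subst (asm) sum_nonneg_eq_0_iff) (auto simp del: sum.atMost_Suc)
    then have "real (Suc k choose i) * real (Suc k choose j) * (cmod (smom \<mu> (Suc k) i j - smom \<nu> (Suc k) i j))\<^sup>2 = 0"
      using that by blast
    moreover have "Suc k choose i \<noteq> 0" "Suc k choose j \<noteq> 0"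
      using zero_less_binomial[OF that(1)] zero_less_binomial[OF that(2)] by auto
    ultimately show ?thesis by (simp del: binomial_Suc_Suc)
  qed
  note eq = this
  show ?thesis
  proof (rule measure_eq_if_smom_eq[OF assms(1-4)])
    fix k i j :: nat assume "0 < k" "i \<le> k" "j \<le> k"
    then show "smom \<mu> k i j = smom \<nu> k i j" using eq[of i "k - 1" j] by simp
  qed
qed

section \<open>Weak compactness\<close>

definition wconv :: "(nat \<Rightarrow> complex measure) \<Rightarrow> complex measure \<Rightarrow> bool" where
  "wconv X \<mu> \<longleftrightarrow> (\<forall>f :: complex \<Rightarrow> real. continuous_on UNIV f \<longrightarrow>
     (\<lambda>k. \<integral>z. f z \<partial>X k) \<longlonglongrightarrow> (\<integral>z. f z \<partial>\<mu>))"

lemma wconvD: "wconv X \<mu> \<Longrightarrow> continuous_on UNIV f \<Longrightarrow> (\<lambda>k. \<integral>z. f z \<partial>X k) \<longlonglongrightarrow> (\<integral>z. (f z::real) \<partial>\<mu>)"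
  unfolding wconv_def by blast

lemma wconv_subseq:
  assumes "wconv X \<mu>" "strict_mono s"
  shows "wconv (X \<circ> s) \<mu>"
  unfolding wconv_def
proof (intro allI impI)
  fix f :: "complex \<Rightarrow> real" assume "continuous_on UNIV f"
  from LIMSEQ_subseq_LIMSEQ[OF wconvD[OF assms(1) this] assms(2)]
  show "(\<lambda>k. \<integral>z. f z \<partial>(X \<circ> s) k) \<longlonglongrightarrow> (\<integral>z. f z \<partial>\<mu>)" by (simp add: o_def)
qed

text \<open>The truncated distance to \<open>C\<close> is a continuous test function whose zero set
  is exactly the closed set \<open>C\<close>.\<close>

lemma wconv_support:
  assumes "prob_space \<mu>" "sets \<mu> = sets borel" "wconv X \<mu>" "closed C" "C \<noteq> {}"
    and lim: "(\<lambda>k. \<integral>z. min 1 (infdist z C) \<partial>X k) \<longlonglongrightarrow> 0"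
  shows "\<mu> \<in> prob_measures_on C"
proof -
  interpret prob_space \<mu> by fact
  have c: "continuous_on UNIV (\<lambda>z. min 1 (infdist z C))" by (intro continuous_intros)
  have m: "(\<lambda>z. min 1 (infdist z C)) \<in> borel_measurable \<mu>"
    using borel_measurable_continuous_onI[OF c] assms(2) by (simp cong: measurable_cong_sets)
  have i: "integrable \<mu> (\<lambda>z. min 1 (infdist z C))"
    by (rule integrable_const_bound[where B=1]) (use m in \<open>auto simp: infdist_nonneg\<close>)
  have "(\<integral>z. min 1 (infdist z C) \<partial>\<mu>) = 0"
    by (rule LIMSEQ_unique[OF wconvD[OF assms(3) c] lim])
  then have "AE z in \<mu>. min 1 (infdist z C) = 0"
    by (subst (asm) integral_nonneg_eq_0_iff_AE[OF i]) (auto simp: infdist_nonneg)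
  then have "AE z in \<mu>. z \<in> C"
  proof eventually_elim
    case (elim z)
    then have "infdist z C = 0" by (auto simp: min_def split: if_splits)
    then show ?case using in_closed_iff_infdist_zero[OF assms(4,5)] by simp
  qed
  then show ?thesis using assms by (intro prob_measures_onI) auto
qed

text \<open>Compactness is pulled back from Helly's theorem on the line along Schoenberg's space-filling
  curve, which has a Borel right inverse: interleave the binary digits of the two coordinates.\<close>

definition cantor :: "(nat \<Rightarrow> real) \<Rightarrow> real" where
  "cantor d = (\<Sum>j. 2 * d j / 3 ^ Suc j)"

text \<open>Continuous, of period 2, equal to 0 within distance 1/3 of the even integers and to 1
  within distance 1/3 of the odd ones. The clamping provides the plateaus on which a ternary digit
  can be read off.\<close>

definition plateau :: "real \<Rightarrow> real" where
  "plateau t = max 0 (min 1 (1 / 2 - cos (pi * t)))"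

lemma cantor_summable:
  fixes d :: "nat \<Rightarrow> real"
  assumes "\<And>j. d j \<in> {0, 1}"
  shows "summable (\<lambda>j. 2 * d j / 3 ^ Suc j)"
proof (rule summable_comparison_test')
  show "summable (\<lambda>j. 2 / 3 * (1 / 3 :: real) ^ j)"
    by (intro summable_mult summable_geometric) auto
  show "norm (2 * d j / 3 ^ Suc j) \<le> 2 / 3 * (1 / 3) ^ j" for j
    using assms[of j] by (auto simp: power_divide)
qed

lemma cantor_bounds:
  assumes "\<And>j. d j \<in> {0, 1}"
  shows "0 \<le> cantor d" "cantor d \<le> 1"
proof -
  have nn: "0 \<le> d j" "d j \<le> 1" for j using assms[of j] by auto
  show "0 \<le> cantor d" unfolding cantor_def
    using nn by (intro suminf_nonneg cantor_summable assms) auto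
  have g: "summable (\<lambda>j. 2 / 3 * (1 / 3 :: real) ^ j)"
    by (intro summable_mult summable_geometric) auto
  have "cantor d \<le> (\<Sum>j. 2 / 3 * (1 / 3) ^ j)"
    unfolding cantor_def
    using nn by (intro suminf_le cantor_summable assms g) (auto simp: power_divide intro!: divide_right_mono)
  also have "\<dots> = 1"
    using suminf_mult[OF summable_geometric, of "1/3::real" "2/3"] suminf_geometric[of "1/3::real"] by simp
  finally show "cantor d \<le> 1" .
qed

lemma cantor_rec:
  assumes "\<And>j. d j \<in> {0, 1}"
  shows "3 * cantor d = 2 * d 0 + cantor (\<lambda>j. d (Suc j))"
proof -
  have s: "summable (\<lambda>j. 2 * d (Suc j) / 3 ^ Suc j)"
    by (rule cantor_summable) (use assms in auto)
  have "cantor d = 2 * d 0 / 3 + (\<Sum>j. 2 * d (Suc j) / 3 ^ Suc (Suc j))"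
    unfolding cantor_def
    using suminf_split_head[OF cantor_summable[of d, OF assms]] by simp
  also have "(\<Sum>j. 2 * d (Suc j) / 3 ^ Suc (Suc j)) = (\<Sum>j. (1/3) * (2 * d (Suc j) / 3 ^ Suc j))"
    by (rule arg_cong[where f=suminf]) (rule ext, simp)
  also have "\<dots> = (1/3) * cantor (\<lambda>j. d (Suc j))"
    unfolding cantor_def by (rule suminf_mult[OF s])
  finally show ?thesis by simp
qed

lemma plateau_add_even: "plateau (2 * of_int m + t) = plateau t"
proof -
  have "cos (pi * (2 * of_int m + t)) = cos (2 * pi * of_int m + pi * t)"
    by (simp add: algebra_simps)
  also have "\<dots> = cos (pi * t)"
    unfolding cos_add by (simp add: cos_int_2pin sin_int_2pin)
  finally show ?thesis unfolding plateau_def by simp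
qed

text \<open>In \<open>3 ^ k * cantor d\<close> the digits before place \<open>k\<close> contribute
  even integers, which periodicity removes. The rest is a point of the Cantor set, lying in [0, 1/3]
  or in [2/3, 1] according to its first digit, hence on a plateau.\<close>

lemma plateau_cantor:
  assumes "\<And>j. d j \<in> {0, 1}"
  shows "plateau (3 ^ k * cantor d) = d k"
  using assms
proof (induction k arbitrary: d)
  case 0
  let ?c = "cantor (\<lambda>j. d (Suc j))"
  have c: "0 \<le> ?c" "?c \<le> 1" using cantor_bounds[of "\<lambda>j. d (Suc j)"] 0 by auto
  have e: "cantor d = (2 * d 0 + ?c) / 3" using cantor_rec[of d] 0 by auto
  from 0[of 0] consider "d 0 = 0" | "d 0 = 1" by auto
  then show ?case
  proof cases
    case 1
    have "cos (pi / 3) \<le> cos (pi * cantor d)"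
      using c e 1 by (intro cos_monotone_0_pi_le) (auto intro!: mult_nonneg_nonneg)
    then show ?thesis using 1 by (simp add: plateau_def cos_60)
  next
    case 2
    have "pi * (2 + ?c) \<le> pi * 3" using c by (intro mult_left_mono) auto
    then have "cos (pi * cantor d) \<le> cos (2 * pi / 3)"
      using c e 2 by (intro cos_monotone_0_pi_le) (auto simp: field_simps)
    then show ?thesis using 2 by (simp add: plateau_def cos_120)
  qed
next
  case (Suc k)
  have "3 ^ Suc k * cantor d = 3 ^ k * (2 * d 0) + 3 ^ k * cantor (\<lambda>j. d (Suc j))"
  proof -
    have "3 ^ Suc k * cantor d = 3 ^ k * (3 * cantor d)" by simp
    then show ?thesis unfolding cantor_rec[of d, OF Suc.prems] distrib_left .
  qed
  also have "3 ^ k * (2 * d 0) = 2 * of_int (if d 0 = 0 then 0 else 3 ^ k)"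
    using Suc.prems[of 0] by auto
  finally have "plateau (3 ^ Suc k * cantor d) = plateau (3 ^ k * cantor (\<lambda>j. d (Suc j)))"
    by (simp only: plateau_add_even)
  also have "\<dots> = d (Suc k)" by (rule Suc.IH) (rule Suc.prems)
  finally show ?case .
qed

definition binary_digit :: "real \<Rightarrow> nat \<Rightarrow> real" where
  "binary_digit x k = of_int (\<lfloor>2 ^ Suc k * x\<rfloor> mod 2)"

lemma binary_digit_01: "binary_digit x k \<in> {0, 1}"
  unfolding binary_digit_def by (cases "even \<lfloor>2 ^ Suc k * x\<rfloor>") (auto simp: odd_iff_mod_2_eq_one)

lemma binary_digit_measurable[measurable]: "(\<lambda>x. binary_digit x k) \<in> borel_measurable borel"
  unfolding binary_digit_def by measurable

lemma floor_double: "\<lfloor>2 * y\<rfloor> = 2 * \<lfloor>y::real\<rfloor> + \<lfloor>2 * y\<rfloor> mod 2"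
proof -
  have "\<lfloor>2 * y\<rfloor> div 2 = \<lfloor>y\<rfloor>" by linarith
  then show ?thesis by (metis mult_div_mod_eq)
qed

lemma binary_digit_sums:
  assumes "0 \<le> x" "x < 1"
  shows "(\<lambda>k. binary_digit x k / 2 ^ Suc k) sums x"
proof -
  have part: "(\<Sum>k<n. binary_digit x k / 2 ^ Suc k) = of_int \<lfloor>2 ^ n * x\<rfloor> / 2 ^ n" for n
  proof (induction n)
    case 0
    then show ?case using assms by (simp add: floor_eq_iff)
  next
    case (Suc n)
    have "of_int \<lfloor>2 ^ Suc n * x\<rfloor> = 2 * of_int \<lfloor>2 ^ n * x\<rfloor> + binary_digit x n"
      unfolding binary_digit_def using floor_double[of "2 ^ n * x"]
      by (metis (no_types, lifting) mult.assoc of_int_add of_int_mult of_int_numeral power_Suc)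
    then show ?case using Suc by (simp add: field_simps)
  qed
  have "(\<lambda>n. of_int \<lfloor>2 ^ n * x\<rfloor> / 2 ^ n) \<longlonglongrightarrow> x"
  proof (rule real_tendsto_sandwich)
    have "x - (1/2)^n \<le> of_int \<lfloor>2 ^ n * x\<rfloor> / 2 ^ n" for n
    proof -
      have "x - (1/2)^n = (2 ^ n * x - 1) / 2 ^ n" by (simp add: field_simps)
      also have "\<dots> \<le> of_int \<lfloor>2 ^ n * x\<rfloor> / 2 ^ n" by (intro divide_right_mono, linarith, simp)
      finally show ?thesis .
    qed
    then show "\<forall>\<^sub>F n in sequentially. x - (1/2)^n \<le> of_int \<lfloor>2 ^ n * x\<rfloor> / 2 ^ n" by simp
    have "of_int \<lfloor>2 ^ n * x\<rfloor> / 2 ^ n \<le> x" for n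
    proof -
      have "of_int \<lfloor>2 ^ n * x\<rfloor> \<le> 2 ^ n * x" by linarith
      then show ?thesis by (simp add: field_simps)
    qed
    then show "\<forall>\<^sub>F n in sequentially. of_int \<lfloor>2 ^ n * x\<rfloor> / 2 ^ n \<le> x" by simp
    have "(\<lambda>n. x - (1/2)^n) \<longlonglongrightarrow> x - 0"
      by (intro tendsto_intros LIMSEQ_power_zero) auto
    then show "(\<lambda>n. x - (1/2)^n) \<longlonglongrightarrow> x" by simp
  qed auto
  then show ?thesis unfolding sums_def part .
qed

definition interleave :: "real \<Rightarrow> real \<Rightarrow> nat \<Rightarrow> real" where
  "interleave x y j = (if even j then binary_digit x (j div 2) else binary_digit y (j div 2))"

text \<open>Coordinate \<open>e\<close> of the curve: its binary digits are what
  \<open>plateau\<close> reads at the ternary places of parity \<open>e\<close>. Off the Cantor set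
  the plateau values interpolate, and uniform convergence keeps the sum continuous.\<close>

definition schoenberg :: "nat \<Rightarrow> real \<Rightarrow> real" where
  "schoenberg e t = (\<Sum>i. plateau (3 ^ (2 * i + e) * t) / 2 ^ Suc i)"

lemma plateau_bounds: "0 \<le> plateau t" "plateau t \<le> 1"
  unfolding plateau_def by auto

lemma geometric_half_summable: "summable (\<lambda>i. 1 / 2 ^ Suc i :: real)"
proof -
  have "summable (\<lambda>i. 1 / 2 * (1 / 2 :: real) ^ i)" by (intro summable_mult summable_geometric) auto
  then show ?thesis by (simp add: power_divide)
qed

lemma schoenberg_summable: "summable (\<lambda>i. plateau (3 ^ (2 * i + e) * t) / 2 ^ Suc i)"
  by (rule summable_comparison_test'[OF geometric_half_summable])
     (auto simp: plateau_bounds divide_right_mono)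

lemma schoenberg_bounds: "0 \<le> schoenberg e t" "schoenberg e t \<le> 1"
proof -
  show "0 \<le> schoenberg e t"
    unfolding schoenberg_def by (intro suminf_nonneg schoenberg_summable) (auto simp: plateau_bounds)
  have "schoenberg e t \<le> (\<Sum>i. 1 / 2 ^ Suc i)"
    unfolding schoenberg_def
    by (intro suminf_le schoenberg_summable geometric_half_summable) (auto simp: plateau_bounds divide_right_mono)
  also have "\<dots> = 1" using power_half_series by (simp add: sums_iff power_divide)
  finally show "schoenberg e t \<le> 1" .
qed

lemma schoenberg_continuous: "continuous_on UNIV (schoenberg e)"
proof -
  have "uniform_limit UNIV (\<lambda>n t. \<Sum>i<n. plateau (3 ^ (2 * i + e) * t) / 2 ^ Suc i) (schoenberg e) sequentially"
    unfolding schoenberg_def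
    by (rule Weierstrass_m_test[OF _ geometric_half_summable])
       (auto simp: plateau_bounds divide_right_mono)
  moreover have "continuous_on UNIV (\<lambda>t. \<Sum>i<n. plateau (3 ^ (2 * i + e) * t) / 2 ^ Suc i)" for n
    unfolding plateau_def by (intro continuous_intros) auto
  ultimately show ?thesis
    by (intro uniform_limit_theorem[where F=sequentially]) auto
qed

lemma schoenberg_interleave:
  assumes "0 \<le> x" "x < 1" "0 \<le> y" "y < 1"
  shows "schoenberg 0 (cantor (interleave x y)) = x" "schoenberg 1 (cantor (interleave x y)) = y"
proof -
  have d: "interleave x y j \<in> {0, 1}" for j unfolding interleave_def using binary_digit_01 by simp
  show "schoenberg 0 (cantor (interleave x y)) = x"
    unfolding schoenberg_def plateau_cantor[OF d]
    using binary_digit_sums[OF assms(1,2)] by (simp add: interleave_def sums_iff)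
  show "schoenberg 1 (cantor (interleave x y)) = y"
    unfolding schoenberg_def plateau_cantor[OF d]
    using binary_digit_sums[OF assms(3,4)] by (simp add: interleave_def sums_iff)
qed

text \<open>Measures are pushed to the line by \<sigma>, for which measurability suffices; only
  \<phi>, which brings weak limits back to the plane, is asked to be continuous.\<close>

lemma space_filling_retraction:
  assumes "compact C"
  obtains \<phi> :: "real \<Rightarrow> complex" and \<sigma> :: "complex \<Rightarrow> real" and D :: "complex set"
  where "continuous_on UNIV \<phi>" "\<sigma> \<in> borel_measurable borel" "compact D" "range \<phi> \<subseteq> D"
    "\<And>z. 0 \<le> \<sigma> z \<and> \<sigma> z \<le> 1" "\<And>z. z \<in> C \<Longrightarrow> \<phi> (\<sigma> z) = z"
proof -
  \<comment> \<open>The strict bound keeps the coordinates, rescaled from (- R, R) to (0, 1), below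
    1, as the binary expansion requires.\<close>
  obtain R where R: "R > 0" "\<And>z. z \<in> C \<Longrightarrow> cmod z < R"
    using compact_imp_bounded[OF assms] unfolding bounded_pos_less by blast
  define \<phi> where "\<phi> t = Complex (R * (2 * schoenberg 0 t - 1)) (R * (2 * schoenberg 1 t - 1))" for t
  define \<sigma> where "\<sigma> z = cantor (interleave ((Re z / R + 1) / 2) ((Im z / R + 1) / 2))" for z
  show thesis
  proof (rule that[of \<phi> \<sigma> "cball 0 (2 * R)"])
    show "continuous_on UNIV \<phi>"
      unfolding \<phi>_def by (intro continuous_intros schoenberg_continuous)
    have [measurable]: "(\<lambda>z. interleave ((Re z / R + 1) / 2) ((Im z / R + 1) / 2) j) \<in> borel_measurable borel" for j
      unfolding interleave_def by (cases "even j") (simp_all, measurable)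
    show "\<sigma> \<in> borel_measurable borel"
      unfolding \<sigma>_def cantor_def by measurable
    show "range \<phi> \<subseteq> cball 0 (2 * R)"
    proof
      fix w assume "w \<in> range \<phi>"
      then obtain t where t: "w = \<phi> t" by blast
      have *: "\<bar>R * (2 * s - 1)\<bar> \<le> R" if "0 \<le> s" "s \<le> 1" for s
      proof -
        have "\<bar>2 * s - 1\<bar> \<le> 1" using that by auto
        then have "R * \<bar>2 * s - 1\<bar> \<le> R * 1" using R by (intro mult_left_mono) auto
        then show ?thesis using R by (simp add: abs_mult)
      qed
      have "cmod w \<le> \<bar>Re w\<bar> + \<bar>Im w\<bar>" by (rule cmod_le)
      also have "\<dots> \<le> R + R"
        unfolding t \<phi>_def by (intro add_mono) (auto intro!: * schoenberg_bounds)
      finally show "w \<in> cball 0 (2 * R)" by simp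
    qed
    show "0 \<le> \<sigma> z \<and> \<sigma> z \<le> 1" for z
      unfolding \<sigma>_def by (intro conjI cantor_bounds) (auto simp: interleave_def binary_digit_01[simplified])
    fix z assume "z \<in> C"
    then have z: "\<bar>Re z\<bar> < R" "\<bar>Im z\<bar> < R"
      using R(2)[of z] abs_Re_le_cmod[of z] abs_Im_le_cmod[of z] by auto
    have *: "0 \<le> (x / R + 1) / 2" "(x / R + 1) / 2 < 1" if "\<bar>x\<bar> < R" for x
      using that R(1) by (auto simp: field_simps abs_less_iff)
    show "\<phi> (\<sigma> z) = z"
      unfolding \<phi>_def \<sigma>_def schoenberg_interleave[OF *[OF z(1)] *[OF z(2)]]
      using R(1) by (simp add: complex_eq_iff field_simps)
  qed simp
qed

text \<open>The images on the line all live on [0, 1], so they are tight and Helly's selection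
  theorem applies. Since \<phi> inverts \<sigma> on \<open>C\<close>, the integral of
  \<open>f\<close> against \<open>X k\<close> is that of the continuous function f o \<phi> against
  the image \<open>Y k\<close>.\<close>

lemma wconv_compactness:
  fixes X :: "nat \<Rightarrow> complex measure"
  assumes X: "\<And>k. X k \<in> prob_measures_on C" and C: "compact C"
  obtains s \<mu> where "strict_mono s" "\<mu> \<in> prob_measures_on C" "wconv (X \<circ> s) \<mu>"
proof -
  obtain \<phi> :: "real \<Rightarrow> complex" and \<sigma> :: "complex \<Rightarrow> real" and D :: "complex set"
    where \<phi>: "continuous_on UNIV \<phi>" and \<sigma>: "\<sigma> \<in> borel_measurable borel" and D: "compact D" "range \<phi> \<subseteq> D"
    and \<sigma>b: "\<And>z. 0 \<le> \<sigma> z \<and> \<sigma> z \<le> 1" and inv: "\<And>z. z \<in> C \<Longrightarrow> \<phi> (\<sigma> z) = z"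
    by (rule space_filling_retraction[OF C]) blast
  note XD = prob_measures_onD[OF X compact_imp_closed[OF C]]
  have [measurable]: "\<sigma> \<in> measurable (X k) borel" for k
    using \<sigma> XD(2)[of k] by (simp cong: measurable_cong_sets)
  define Y where "Y k = distr (X k) borel \<sigma>" for k
  have Y: "real_distribution (Y k)" for k
    unfolding Y_def using prob_space.prob_space_distr[OF XD(1)[of k], of \<sigma> borel] by (simp add: real_distribution_def real_distribution_axioms_def)
  have "tight Y"
    unfolding tight_def
  proof (intro conjI allI impI)
    fix \<epsilon> :: real assume \<epsilon>: "\<epsilon> > 0"
    have "measure (Y k) {-1<..2} > 1 - \<epsilon>" for k
    proof -
      interpret prob_space "X k" by (rule XD)
      have "\<sigma> -` {-1<..2} = UNIV"
      proof (intro set_eqI iffI UNIV_I)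
        fix z show "z \<in> \<sigma> -` {-1<..2}" using \<sigma>b[of z] by simp
      qed
      then have "measure (Y k) {-1<..2} = prob (space (X k))"
        unfolding Y_def by (subst measure_distr) auto
      then show ?thesis using \<epsilon> prob_space by simp
    qed
    then show "\<exists>a b::real. a < b \<and> (\<forall>k. measure (Y k) {a<..b} > 1 - \<epsilon>)"
      by (intro exI[of _ "-1"] exI[of _ 2]) auto
  qed (rule Y)
  from tight_imp_convergent_subsubsequence[OF this strict_mono_id]
  obtain s M where s: "strict_mono s" and M: "real_distribution M" and conv: "weak_conv_m (Y \<circ> s) M"
    by (auto simp: o_def id_def)
  interpret M: real_distribution M by fact
  have \<phi>m[measurable]: "\<phi> \<in> measurable M borel"
    using borel_measurable_continuous_onI[OF \<phi>] by simp
  define \<mu> where "\<mu> = distr M borel \<phi>"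
  have \<mu>: "prob_space \<mu>" "sets \<mu> = sets borel"
    unfolding \<mu>_def using M.prob_space_distr[OF \<phi>m] by auto
  have w: "wconv (X \<circ> s) \<mu>"
    unfolding wconv_def
  proof (intro allI impI)
    fix f :: "complex \<Rightarrow> real" assume f: "continuous_on UNIV f"
    have [measurable]: "f \<in> borel_measurable borel" using f by (rule borel_measurable_continuous_onI)
    obtain B where B: "\<And>x. x \<in> D \<Longrightarrow> norm (f x) \<le> B"
      using compact_imp_bounded[OF compact_continuous_image[OF continuous_on_subset[OF f] D(1)]]
      by (auto simp: bounded_iff)
    have c: "continuous_on UNIV (\<lambda>t. f (\<phi> t))"
      using continuous_on_compose2[OF f \<phi>] by simp
    have "(\<lambda>n. \<integral>t. f (\<phi> t) \<partial>(Y \<circ> s) n) \<longlonglongrightarrow> (\<integral>t. f (\<phi> t) \<partial>M)"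
    proof (rule weak_conv_imp_integral_bdd_continuous_conv[OF _ M conv])
      show "isCont (\<lambda>t. f (\<phi> t)) x" for x using c by (simp add: continuous_on_eq_continuous_at)
      show "norm (f (\<phi> x)) \<le> B" for x using B D(2) by auto
      show "real_distribution ((Y \<circ> s) n)" for n using Y by simp
    qed
    moreover have "(\<integral>t. f (\<phi> t) \<partial>M) = (\<integral>z. f z \<partial>\<mu>)"
      unfolding \<mu>_def by (subst integral_distr) auto
    moreover have "(\<integral>t. f (\<phi> t) \<partial>(Y \<circ> s) n) = (\<integral>z. f z \<partial>(X \<circ> s) n)" for n
    proof -
      have m: "(\<lambda>t. f (\<phi> t)) \<in> borel_measurable borel" using c by (rule borel_measurable_continuous_onI)
      have f': "f \<in> borel_measurable (X (s n))"
        using XD(2)[of "s n"] by (simp cong: measurable_cong_sets)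
      have "(\<integral>t. f (\<phi> t) \<partial>(Y \<circ> s) n) = (\<integral>z. f (\<phi> (\<sigma> z)) \<partial>X (s n))"
        unfolding Y_def o_def by (subst integral_distr) (use m in auto)
      also have "\<dots> = (\<integral>z. f z \<partial>X (s n))"
      proof (rule integral_cong_AE)
        show "AE z in X (s n). f (\<phi> (\<sigma> z)) = f z"
          using XD(4)[of "s n"] by eventually_elim (simp add: inv)
        show "(\<lambda>z. f (\<phi> (\<sigma> z))) \<in> borel_measurable (X (s n))"
          using measurable_compose[OF _ m] by simp
      qed (rule f')
      finally show ?thesis by simp
    qed
    ultimately show "(\<lambda>k. \<integral>z. f z \<partial>(X \<circ> s) k) \<longlonglongrightarrow> (\<integral>z. f z \<partial>\<mu>)" by simp
  qed
  have "C \<noteq> {}" using X[of 0] by (auto simp: prob_measures_on_def)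
  have "\<mu> \<in> prob_measures_on C"
  proof (rule wconv_support[OF \<mu> w compact_imp_closed[OF C] \<open>C \<noteq> {}\<close>])
    have "(\<integral>z. min 1 (infdist z C) \<partial>X k) = 0" for k
    proof -
      have "AE z in X k. min 1 (infdist z C) = 0"
        using XD(4)[of k] by eventually_elim simp
      then show ?thesis by (rule integral_eq_zero_AE)
    qed
    then show "(\<lambda>k. \<integral>z. min 1 (infdist z C) \<partial>(X \<circ> s) k) \<longlonglongrightarrow> 0" by simp
  qed
  then show thesis using that s w by blast
qed

section \<open>Energy maximizers\<close>

lemma wconv_complex:
  fixes f :: "complex \<Rightarrow> complex"
  assumes "\<And>k. X k \<in> prob_measures_on C" "compact C" "\<mu> \<in> prob_measures_on D" "compact D" "wconv X \<mu>"
    and f: "continuous_on UNIV f"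
  shows "(\<lambda>k. \<integral>z. f z \<partial>X k) \<longlonglongrightarrow> (\<integral>z. f z \<partial>\<mu>)"
proof -
  have fm: "f \<in> borel_measurable borel" using f by (rule borel_measurable_continuous_onI)
  have i: "integrable (X k) f" "integrable \<mu> f" for k
    by (rule integrable_continuous_compact[OF assms(1,2) continuous_on_subset[OF f] fm], simp)
       (rule integrable_continuous_compact[OF assms(3,4) continuous_on_subset[OF f] fm], simp)
  have "(\<lambda>k. \<integral>z. Re (f z) \<partial>X k) \<longlonglongrightarrow> (\<integral>z. Re (f z) \<partial>\<mu>)"
    by (intro wconvD[OF assms(5)] continuous_intros f)
  moreover have "(\<lambda>k. \<integral>z. Im (f z) \<partial>X k) \<longlonglongrightarrow> (\<integral>z. Im (f z) \<partial>\<mu>)"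
    by (intro wconvD[OF assms(5)] continuous_intros f)
  ultimately show ?thesis
    unfolding tendsto_complex_iff using i by (simp add: integral_Re integral_Im)
qed

lemma wconv_smom:
  assumes "\<And>k. X k \<in> prob_measures_on C" "compact C" "\<mu> \<in> prob_measures_on D" "compact D" "wconv X \<mu>"
  shows "(\<lambda>k. smom (X k) n i j) \<longlonglongrightarrow> smom \<mu> n i j"
  unfolding smom_def by (intro wconv_complex[OF assms] smono_continuous)

text \<open>The measure and the point may move simultaneously because the finite-rank expansion
  separates them: moments converge by weak convergence, the functions of the point by
  continuity.\<close>

lemma wconv_sphint:
  assumes "\<And>k. X k \<in> prob_measures_on C" "compact C" "\<mu> \<in> prob_measures_on D" "compact D" "wconv X \<mu>"
    and z: "zs \<longlonglongrightarrow> z"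
  shows "(\<lambda>k. sphint (X k) n (zs k)) \<longlonglongrightarrow> sphint \<mu> n z"
proof -
  have s: "(\<lambda>k. smono n i j (zs k)) \<longlonglongrightarrow> smono n i j z" for i j
    using continuous_on_tendsto_compose[OF smono_continuous[of UNIV] z] by simp
  have "(\<lambda>k. complex_of_real (sphint (X k) n (zs k))) \<longlonglongrightarrow> complex_of_real (sphint \<mu> n z)"
    unfolding sphint_expansion[OF assms(1,2)] sphint_expansion[OF assms(3,4)]
    by (intro tendsto_intros s wconv_smom[OF assms(1-5)])
  then show ?thesis by (simp only: tendsto_of_real_iff)
qed

lemma wconv_sphpair:
  assumes "\<And>k. X k \<in> prob_measures_on C" "compact C" "\<mu> \<in> prob_measures_on D" "compact D" "wconv X \<mu>"
  shows "(\<lambda>k. sphpair (X k) (X k) n) \<longlonglongrightarrow> sphpair \<mu> \<mu> n"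
proof -
  have "(\<lambda>k. complex_of_real (sphpair (X k) (X k) n)) \<longlonglongrightarrow> complex_of_real (sphpair \<mu> \<mu> n)"
    unfolding sphpair_expansion[OF assms(1,2,1,2)] sphpair_expansion[OF assms(3,4,3,4)]
    by (intro tendsto_intros wconv_smom[OF assms])
  then show ?thesis by (simp only: tendsto_of_real_iff)
qed

text \<open>A lower bound for the extended-real expression becomes a family of upper bounds on
  finite sums. Each of these is a closed condition, so the bound survives limits even where the
  series may diverge.\<close>

lemma le_diff_suminf_ennreal_iff:
  fixes a :: "nat \<Rightarrow> real"
  assumes "\<And>k. 0 \<le> a k"
  shows "ereal c \<le> ereal A - enn2ereal (\<Sum>k. ennreal (a k)) \<longleftrightarrow> (\<forall>n. sum a {..<n} \<le> A - c)"
proof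
  assume L: "ereal c \<le> ereal A - enn2ereal (\<Sum>k. ennreal (a k))"
  then have "(\<Sum>k. ennreal (a k)) \<noteq> top" by auto
  then have s: "summable a" using summable_suminf_not_top[of a] assms by blast
  then have "ereal c \<le> ereal A - ereal (suminf a)"
    using L by (simp add: suminf_ennreal2 assms enn2ereal_ennreal suminf_nonneg)
  then have "suminf a \<le> A - c" by simp
  then show "\<forall>n. sum a {..<n} \<le> A - c"
    using sum_le_suminf[OF s, of "{..<n}" for n] assms by (meson finite_lessThan order_trans)
next
  assume R: "\<forall>n. sum a {..<n} \<le> A - c"
  have s: "summable a" using assms R by (intro summableI_nonneg_bounded) auto
  then have "suminf a \<le> A - c" using R by (intro suminf_le_const) auto
  then show "ereal c \<le> ereal A - enn2ereal (\<Sum>k. ennreal (a k))"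
    using s by (simp add: suminf_ennreal2 assms enn2ereal_ennreal suminf_nonneg)
qed

lemma log_potential_ge_iff:
  assumes "\<mu> \<in> prob_measures_on C" "compact C"
  shows "ereal c \<le> log_potential \<mu> z \<longleftrightarrow>
    (\<forall>n. (\<Sum>k<n. sphint \<mu> (Suc k) z / (2 * real (Suc k))) \<le> lwt z + (\<integral>w. lwt w \<partial>\<mu>) - c)"
  unfolding log_potential_eq[OF assms] cpot_eq_suminf[OF assms]
  by (intro le_diff_suminf_ennreal_iff divide_nonneg_nonneg sphint_nonneg) auto

lemma log_energy_ge_iff:
  assumes "\<mu> \<in> prob_measures_on C" "compact C"
  shows "ereal c \<le> log_energy \<mu> \<longleftrightarrow>
    (\<forall>n. (\<Sum>k<n. sphpair \<mu> \<mu> (Suc k) / (2 * real (Suc k))) \<le> 2 * (\<integral>w. lwt w \<partial>\<mu>) - c)"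
  unfolding log_energy_eq[OF assms] cen_eq_suminf[OF assms assms]
  by (intro le_diff_suminf_ennreal_iff divide_nonneg_nonneg sphpair_nonneg) auto

text \<open>The principle of descent: every partial sum of the chordal kernel is continuous.\<close>

lemma log_potential_descent:
  assumes X: "\<And>k. X k \<in> prob_measures_on C" "compact C" "\<mu> \<in> prob_measures_on D" "compact D" "wconv X \<mu>"
    and z: "zs \<longlonglongrightarrow> z" and c: "cs \<longlonglongrightarrow> c"
    and le: "\<And>k. ereal (cs k) \<le> log_potential (X k) (zs k)"
  shows "ereal c \<le> log_potential \<mu> z"
  unfolding log_potential_ge_iff[OF assms(3,4)]
proof
  fix n
  have l: "(\<lambda>k. lwt (zs k)) \<longlonglongrightarrow> lwt z"
    using continuous_on_tendsto_compose[OF lwt_continuous[of UNIV] z] by simp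
  show "(\<Sum>k<n. sphint \<mu> (Suc k) z / (2 * real (Suc k))) \<le> lwt z + (\<integral>w. lwt w \<partial>\<mu>) - c"
  proof (rule LIMSEQ_le)
    show "(\<lambda>l. \<Sum>k<n. sphint (X l) (Suc k) (zs l) / (2 * real (Suc k))) \<longlonglongrightarrow> (\<Sum>k<n. sphint \<mu> (Suc k) z / (2 * real (Suc k)))"
      by (intro tendsto_intros wconv_sphint[OF X z]) auto
    show "(\<lambda>k. lwt (zs k) + (\<integral>w. lwt w \<partial>X k) - cs k) \<longlonglongrightarrow> lwt z + (\<integral>w. lwt w \<partial>\<mu>) - c"
      by (intro tendsto_intros l c wconvD[OF X(5)] lwt_continuous)
    show "\<exists>N. \<forall>l\<ge>N. (\<Sum>k<n. sphint (X l) (Suc k) (zs l) / (2 * real (Suc k))) \<le> lwt (zs l) + (\<integral>w. lwt w \<partial>X l) - cs l"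
      using le unfolding log_potential_ge_iff[OF X(1,2)] by blast
  qed
qed

lemma log_energy_upper_semicontinuous:
  assumes X: "\<And>k. X k \<in> prob_measures_on C" "compact C" "\<mu> \<in> prob_measures_on D" "compact D" "wconv X \<mu>"
    and c: "cs \<longlonglongrightarrow> c"
    and le: "\<And>k. ereal (cs k) \<le> log_energy (X k)"
  shows "ereal c \<le> log_energy \<mu>"
  unfolding log_energy_ge_iff[OF assms(3,4)]
proof
  fix n
  show "(\<Sum>k<n. sphpair \<mu> \<mu> (Suc k) / (2 * real (Suc k))) \<le> 2 * (\<integral>w. lwt w \<partial>\<mu>) - c"
  proof (rule LIMSEQ_le)
    show "(\<lambda>l. \<Sum>k<n. sphpair (X l) (X l) (Suc k) / (2 * real (Suc k))) \<longlonglongrightarrow> (\<Sum>k<n. sphpair \<mu> \<mu> (Suc k) / (2 * real (Suc k)))"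
      by (intro tendsto_intros wconv_sphpair[OF X]) auto
    show "(\<lambda>k. 2 * (\<integral>w. lwt w \<partial>X k) - cs k) \<longlonglongrightarrow> 2 * (\<integral>w. lwt w \<partial>\<mu>) - c"
      by (intro tendsto_intros c wconvD[OF X(5)] lwt_continuous)
    show "\<exists>N. \<forall>l\<ge>N. (\<Sum>k<n. sphpair (X l) (X l) (Suc k) / (2 * real (Suc k))) \<le> 2 * (\<integral>w. lwt w \<partial>X l) - cs l"
      using le unfolding log_energy_ge_iff[OF X(1,2)] by blast
  qed
qed

text \<open>The direct method. Non-polarity bounds the supremum from below, boundedness of
  \<open>lwt\<close> on \<open>K\<close> from above, and the weak limit of a maximizing sequence
  loses no energy by upper semicontinuity.\<close>

lemma ex_energy_maximizer:
  assumes K: "compact K" "\<not> polar K"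
  obtains \<mu> c where "\<mu> \<in> prob_measures_on K" "log_energy \<mu> = ereal c"
    "\<And>\<nu>. \<nu> \<in> prob_measures_on K \<Longrightarrow> log_energy \<nu> \<le> ereal c"
proof -
  obtain C \<mu>0 where C: "compact C" "C \<subseteq> K" "\<mu>0 \<in> prob_measures_on C" "log_energy \<mu>0 \<noteq> -\<infinity>"
    using K unfolding polar_def by blast
  have \<mu>0: "\<mu>0 \<in> prob_measures_on K"
    using C K by (intro prob_measures_on_mono[OF C(3)]) (auto simp: compact_imp_closed)
  obtain B where B: "\<And>z. z \<in> K \<Longrightarrow> lwt z \<le> B"
    using compact_imp_bounded[OF compact_continuous_image[OF lwt_continuous K(1)]]
    by (auto simp: bounded_iff abs_le_iff)
  have ub: "log_energy \<nu> \<le> ereal (2 * B)" if \<nu>: "\<nu> \<in> prob_measures_on K" for \<nu>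
  proof -
    note D = prob_measures_onD[OF \<nu> compact_imp_closed[OF K(1)]]
    interpret prob_space \<nu> by (rule D)
    have "(\<integral>z. lwt z \<partial>\<nu>) \<le> (\<integral>z. B \<partial>\<nu>)"
    proof (rule integral_mono_AE)
      show "AE z in \<nu>. lwt z \<le> B" using D(4) by eventually_elim (rule B)
    qed (use integrable_lwt[OF \<nu> K(1)] in auto)
    then have "(\<integral>z. lwt z \<partial>\<nu>) \<le> B" by (simp add: prob_space)
    moreover have "log_energy \<nu> \<le> ereal (2 * (\<integral>w. lwt w \<partial>\<nu>))"
      unfolding log_energy_eq[OF \<nu> K(1)] by (simp add: ereal_diff_le_self)
    ultimately show ?thesis by (meson ereal_less_eq(3) mult_left_mono order_trans zero_le_numeral)
  qed
  define S where "S = Sup (log_energy ` prob_measures_on K)"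
  have "S \<le> ereal (2 * B)" unfolding S_def using ub by (intro Sup_least) auto
  moreover have "log_energy \<mu>0 \<le> S" unfolding S_def using \<mu>0 by (intro Sup_upper) auto
  ultimately obtain c where c: "S = ereal c" using C(4) by (cases S) auto
  have "\<exists>\<nu>\<in>prob_measures_on K. ereal (c - 1 / real (Suc k)) \<le> log_energy \<nu>" for k
  proof -
    have "ereal (c - 1 / real (Suc k)) < S" unfolding c by simp
    then show ?thesis unfolding S_def less_Sup_iff by (auto intro: less_imp_le)
  qed
  then obtain X where X: "\<And>k. X k \<in> prob_measures_on K" "\<And>k. ereal (c - 1 / real (Suc k)) \<le> log_energy (X k)"
    by metis
  obtain s \<mu> where s: "strict_mono s" and \<mu>: "\<mu> \<in> prob_measures_on K" and w: "wconv (X \<circ> s) \<mu>"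
    by (rule wconv_compactness[of X K, OF X(1) K(1)]) blast
  have "(\<lambda>k. c - 1 / real (Suc k)) \<longlonglongrightarrow> c - 0"
    by (intro tendsto_intros LIMSEQ_Suc lim_1_over_n)
  then have "(\<lambda>k. c - 1 / real (Suc (s k))) \<longlonglongrightarrow> c"
    using LIMSEQ_subseq_LIMSEQ[OF _ s, of "\<lambda>k. c - 1 / real (Suc k)" c] by (simp add: o_def)
  then have "ereal c \<le> log_energy \<mu>"
    using X by (intro log_energy_upper_semicontinuous[OF _ K(1) \<mu> K(1) w]) auto
  moreover have le: "log_energy \<nu> \<le> ereal c" if "\<nu> \<in> prob_measures_on K" for \<nu>
    unfolding c[symmetric] S_def using that by (intro Sup_upper) auto
  ultimately show thesis using that[OF \<mu>] le \<mu> by (metis antisym)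
qed

section \<open>Convex combinations and uniqueness of the maximizer\<close>

text \<open>The convex combination t \<mu> + (1 - t) \<nu>, realized by letting a coin choose the
  measure, so that its integrals come from those of \<open>bind\<close>.\<close>

definition mixture :: "real \<Rightarrow> complex measure \<Rightarrow> complex measure \<Rightarrow> complex measure" where
  "mixture t \<mu> \<nu> = measure_pmf (bernoulli_pmf t) \<bind> (\<lambda>b. if b then \<mu> else \<nu>)"

lemma mixture_kernel:
  assumes "prob_space \<mu>" "sets \<mu> = sets borel" "prob_space \<nu>" "sets \<nu> = sets borel"
  shows "(\<lambda>b. if b then \<mu> else \<nu>) \<in> measurable (measure_pmf p) (subprob_algebra borel)"
  using assms by (auto simp: space_subprob_algebra prob_space_imp_subprob_space)

lemma nn_integral_mixture:
  assumes "prob_space \<mu>" "sets \<mu> = sets borel" "prob_space \<nu>" "sets \<nu> = sets borel"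
    and f: "f \<in> borel_measurable borel" and t: "0 \<le> t" "t \<le> 1"
  shows "(\<integral>\<^sup>+z. f z \<partial>mixture t \<mu> \<nu>) = ennreal t * (\<integral>\<^sup>+z. f z \<partial>\<mu>) + ennreal (1 - t) * (\<integral>\<^sup>+z. f z \<partial>\<nu>)"
  unfolding mixture_def nn_integral_bind[OF f mixture_kernel[OF assms(1-4)]]
  using t by (subst nn_integral_bernoulli_pmf) (auto simp: mult.commute)

lemma mixture_on:
  assumes "\<mu> \<in> prob_measures_on C" "\<nu> \<in> prob_measures_on C" "closed C" and t: "0 \<le> t" "t \<le> 1"
  shows "mixture t \<mu> \<nu> \<in> prob_measures_on C"
proof -
  note D = prob_measures_onD[OF assms(1,3)] and D' = prob_measures_onD[OF assms(2,3)]
  have s: "sets (mixture t \<mu> \<nu>) = sets borel"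
    unfolding mixture_def by (subst sets_bind[where N=borel]) (auto simp: D D')
  then have sp: "space (mixture t \<mu> \<nu>) = UNIV" by (metis sets_eq_imp_space_eq space_borel)
  have e: "emeasure (mixture t \<mu> \<nu>) A = ennreal t * emeasure \<mu> A + ennreal (1 - t) * emeasure \<nu> A"
    if "A \<in> sets borel" for A
    using nn_integral_mixture[OF D(1,2) D'(1,2), of "indicator A" t] that s D(2) D'(2) t by simp
  have "ennreal t * 1 + ennreal (1 - t) * 1 = 1"
    using t by (simp add: ennreal_plus[symmetric] del: ennreal_plus)
  moreover have "emeasure \<mu> UNIV = 1" "emeasure \<nu> UNIV = 1"
    using prob_space.emeasure_space_1[OF D(1)] prob_space.emeasure_space_1[OF D'(1)] D(3) D'(3) by auto
  moreover have "emeasure \<mu> C = 1" "emeasure \<nu> C = 1" using assms by (auto simp: prob_measures_on_def)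
  ultimately have "emeasure (mixture t \<mu> \<nu>) UNIV = 1" "emeasure (mixture t \<mu> \<nu>) C = 1"
    using e[of UNIV] e[of C] assms(3) by auto
  then show ?thesis unfolding prob_measures_on_def using s sp by (auto intro: prob_spaceI)
qed

lemma log_energy_mixture:
  assumes \<mu>: "\<mu> \<in> prob_measures_on C" and \<nu>: "\<nu> \<in> prob_measures_on C" and C: "compact C"
    and cen: "cen \<mu> \<mu> = ennreal x" "cen \<mu> \<nu> = ennreal y" "cen \<nu> \<nu> = ennreal z"
    and nn: "0 \<le> x" "0 \<le> y" "0 \<le> z" and t: "0 \<le> t" "t \<le> 1"
  shows "log_energy (mixture t \<mu> \<nu>) = ereal (2 * (t * (\<integral>w. lwt w \<partial>\<mu>) + (1 - t) * (\<integral>w. lwt w \<partial>\<nu>))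
    - (t\<^sup>2 * x + 2 * t * (1 - t) * y + (1 - t)\<^sup>2 * z))"
proof -
  have cl: "closed C" using C by (rule compact_imp_closed)
  note D = prob_measures_onD[OF \<mu> cl] and D' = prob_measures_onD[OF \<nu> cl]
  let ?\<tau> = "mixture t \<mu> \<nu>"
  have \<tau>: "?\<tau> \<in> prob_measures_on C" by (rule mixture_on[OF \<mu> \<nu> cl t])
  note int = nn_integral_mixture[OF D(1,2) D'(1,2) _ t]
  define a b where "a = (\<integral>w. lwt w \<partial>\<mu>)" and "b = (\<integral>w. lwt w \<partial>\<nu>)"
  have ab: "0 \<le> a" "0 \<le> b" unfolding a_def b_def by (auto simp: lwt_nonneg intro!: Bochner_Integration.integral_nonneg)
  have L: "(\<integral>w. lwt w \<partial>?\<tau>) = t * a + (1 - t) * b"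
  proof -
    have L': "(\<integral>\<^sup>+w. ennreal (lwt w) \<partial>\<rho>) = ennreal (\<integral>w. lwt w \<partial>\<rho>)" if "\<rho> \<in> prob_measures_on C" for \<rho>
      by (intro nn_integral_eq_integral integrable_lwt[OF that C]) (simp add: lwt_nonneg)
    have "ennreal (\<integral>w. lwt w \<partial>?\<tau>) = ennreal t * ennreal a + ennreal (1 - t) * ennreal b"
      unfolding L'[OF \<tau>, symmetric] a_def b_def L'[OF \<mu>, symmetric] L'[OF \<nu>, symmetric]
      by (rule int) measurable
    also have "\<dots> = ennreal (t * a + (1 - t) * b)"
      using ab t by (simp add: ennreal_mult)
    finally show ?thesis using ab t
      by (subst (asm) ennreal_inj) (auto intro!: Bochner_Integration.integral_nonneg simp: lwt_nonneg)
  qed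
  have cm: "cpot \<mu> \<in> borel_measurable borel" "cpot \<nu> \<in> borel_measurable borel"
    by (rule cpot_measurable[OF D(1,2)], rule cpot_measurable[OF D'(1,2)])
  have cp: "cpot ?\<tau> z = ennreal t * cpot \<mu> z + ennreal (1 - t) * cpot \<nu> z" for z
    unfolding cpot_def by (rule int) measurable
  have m: "(\<lambda>z. ennreal t * cpot \<mu> z + ennreal (1 - t) * cpot \<nu> z) \<in> borel_measurable borel"
    using cm by simp
  have lin: "(\<integral>\<^sup>+z. ennreal t * cpot \<mu> z + ennreal (1 - t) * cpot \<nu> z \<partial>\<rho>) = ennreal t * cen \<mu> \<rho> + ennreal (1 - t) * cen \<nu> \<rho>"
    if "sets \<rho> = sets borel" for \<rho>
    unfolding cen_def using cm that by (simp add: nn_integral_add nn_integral_cmult cong: measurable_cong_sets)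
  have "cen ?\<tau> ?\<tau> = ennreal t * (ennreal t * ennreal x + ennreal (1 - t) * ennreal y)
      + ennreal (1 - t) * (ennreal t * ennreal y + ennreal (1 - t) * ennreal z)"
    unfolding cen_def[of ?\<tau>] cp int[OF m] lin[OF D(2)] lin[OF D'(2)]
    unfolding cen cen_commute[OF D'(1,2) D(1,2)] ..
  also have "\<dots> = ennreal (t * (t * x + (1 - t) * y) + (1 - t) * (t * y + (1 - t) * z))"
    using nn t by (simp add: ennreal_mult)
  also have "t * (t * x + (1 - t) * y) + (1 - t) * (t * y + (1 - t) * z) = t\<^sup>2 * x + 2 * t * (1 - t) * y + (1 - t)\<^sup>2 * z"
    by (simp add: power2_eq_square algebra_simps)
  finally have ct: "cen ?\<tau> ?\<tau> = ennreal (t\<^sup>2 * x + 2 * t * (1 - t) * y + (1 - t)\<^sup>2 * z)" .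
  have "0 \<le> t\<^sup>2 * x + 2 * t * (1 - t) * y + (1 - t)\<^sup>2 * z"
    using nn t by (intro add_nonneg_nonneg mult_nonneg_nonneg) auto
  then show ?thesis
    unfolding log_energy_eq[OF \<tau> C] L ct a_def b_def by (simp add: enn2ereal_ennreal)
qed

lemma cen_eq_of_log_energy:
  assumes "\<mu> \<in> prob_measures_on C" "compact C" "log_energy \<mu> = ereal c"
  shows "cen \<mu> \<mu> = ennreal (2 * (\<integral>w. lwt w \<partial>\<mu>) - c)" "0 \<le> 2 * (\<integral>w. lwt w \<partial>\<mu>) - c"
proof -
  have e: "ereal (2 * (\<integral>w. lwt w \<partial>\<mu>)) - enn2ereal (cen \<mu> \<mu>) = ereal c"
    using assms(3) unfolding log_energy_eq[OF assms(1,2)] .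
  obtain x where x: "cen \<mu> \<mu> = ennreal x" "0 \<le> x"
    using e by (cases "cen \<mu> \<mu>") auto
  then have "x = 2 * (\<integral>w. lwt w \<partial>\<mu>) - c" using e by (simp add: enn2ereal_ennreal)
  then show "cen \<mu> \<mu> = ennreal (2 * (\<integral>w. lwt w \<partial>\<mu>) - c)" "0 \<le> 2 * (\<integral>w. lwt w \<partial>\<mu>) - c" using x by auto
qed

text \<open>That the midpoint of \<mu> and \<nu> has energy at most \<open>c\<close> is precisely
  the inequality of \<open>cen_parallelogram_unique\<close>; with infinite mixed energy the
  inequality is trivial.\<close>

lemma energy_maximizer_unique:
  assumes C: "compact C" and \<mu>: "\<mu> \<in> prob_measures_on C" and \<nu>: "\<nu> \<in> prob_measures_on C"
    and e: "log_energy \<mu> = ereal c" "log_energy \<nu> = ereal c"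
    and max: "\<And>\<tau>. \<tau> \<in> prob_measures_on C \<Longrightarrow> log_energy \<tau> \<le> ereal c"
  shows "\<mu> = \<nu>"
proof -
  define a b where "a = (\<integral>w. lwt w \<partial>\<mu>)" and "b = (\<integral>w. lwt w \<partial>\<nu>)"
  have m: "cen \<mu> \<mu> = ennreal (2 * a - c)" "0 \<le> 2 * a - c"
    using cen_eq_of_log_energy[OF \<mu> C e(1)] unfolding a_def .
  have n: "cen \<nu> \<nu> = ennreal (2 * b - c)" "0 \<le> 2 * b - c"
    using cen_eq_of_log_energy[OF \<nu> C e(2)] unfolding b_def .
  have "cen \<mu> \<mu> + cen \<nu> \<nu> \<le> 2 * cen \<mu> \<nu>"
  proof (cases "cen \<mu> \<nu>")
    case (real y)
    have t: "0 \<le> (1 / 2 :: real)" "1 / 2 \<le> (1 :: real)" by auto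
    have "ereal (2 * (1 / 2 * a + (1 - 1 / 2) * b) - ((1 / 2)\<^sup>2 * (2 * a - c) + 2 * (1 / 2) * (1 - 1 / 2) * y + (1 - 1 / 2)\<^sup>2 * (2 * b - c))) \<le> ereal c"
      using max[OF mixture_on[OF \<mu> \<nu> compact_imp_closed[OF C] t]]
      unfolding log_energy_mixture[OF \<mu> \<nu> C m(1) real(2) n(1) m(2) real(1) n(2) t] a_def b_def .
    then have "2 * a - c + (2 * b - c) \<le> 2 * y" by (simp add: field_simps power2_eq_square)
    then have "ennreal (2 * a - c + (2 * b - c)) \<le> ennreal (2 * y)" by (rule ennreal_leI)
    then show ?thesis unfolding m n real using m(2) n(2) real(1)
      by (simp only: ennreal_plus ennreal_mult zero_le_numeral ennreal_numeral)
  qed (simp add: ennreal_mult_top)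
  then show ?thesis
    using m n by (intro cen_parallelogram_unique[OF \<mu> C \<nu> C]) auto
qed

lemma equilibrium_measure_eqI:
  assumes "compact C" "\<mu> \<in> prob_measures_on C" "log_energy \<mu> = ereal c"
    and "\<And>\<nu>. \<nu> \<in> prob_measures_on C \<Longrightarrow> log_energy \<nu> \<le> ereal c"
  shows "equilibrium_measure C = \<mu>"
  unfolding equilibrium_measure_def
proof (rule the_equality)
  show "\<mu> \<in> prob_measures_on C \<and> (\<forall>\<nu>\<in>prob_measures_on C. log_energy \<nu> \<le> log_energy \<mu>)"
    using assms by auto
  fix \<nu> assume \<nu>: "\<nu> \<in> prob_measures_on C \<and> (\<forall>\<tau>\<in>prob_measures_on C. log_energy \<tau> \<le> log_energy \<nu>)"
  then have "log_energy \<nu> = ereal c" using assms by (metis antisym)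
  then show "\<nu> = \<mu>" using energy_maximizer_unique[OF assms(1)] \<nu> assms by blast
qed

section \<open>Real-valued potentials\<close>

text \<open>Because of \<open>ln 0 = 0\<close> (and \<open>0\<close> for divergent integrals), this is the potential only at points where
  \<^const>\<open>log_potential\<close> is finite.\<close>

definition lpot :: "complex measure \<Rightarrow> complex \<Rightarrow> real" where
  "lpot \<mu> z = (\<integral>w. ln (cmod (z - w)) \<partial>\<mu>)"

lemma ln_cmod_measurable[measurable]: "(\<lambda>w. ln (cmod (z - w))) \<in> borel_measurable borel"
  by measurable

lemma log_potential_eq_lpot:
  assumes \<mu>: "\<mu> \<in> prob_measures_on C" "compact C"
    and i: "integrable \<mu> (\<lambda>w. ln (cmod (z - w)))" and ae: "AE w in \<mu>. w \<noteq> z"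
  shows "log_potential \<mu> z = ereal (lpot \<mu> z)"
proof -
  note D = prob_measures_onD[OF \<mu>(1) compact_imp_closed[OF \<mu>(2)]]
  interpret prob_space \<mu> by (rule D)
  have l: "integrable \<mu> lwt" by (rule integrable_lwt[OF \<mu>])
  have nn: "AE w in \<mu>. 0 \<le> lwt z + lwt w - ln (cmod (z - w))"
    using ae by eventually_elim (rule chordal_eq(2), simp)
  have "cpot \<mu> z = (\<integral>\<^sup>+w. ennreal (lwt z + lwt w - ln (cmod (z - w))) \<partial>\<mu>)"
    unfolding cpot_def
  proof (rule nn_integral_cong_AE)
    show "AE w in \<mu>. chordal z w = ennreal (lwt z + lwt w - ln (cmod (z - w)))"
      using ae by eventually_elim (rule chordal_eq(1), simp)
  qed
  also have "\<dots> = ennreal (\<integral>w. lwt z + lwt w - ln (cmod (z - w)) \<partial>\<mu>)"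
    using l i nn by (intro nn_integral_eq_integral) auto
  also have "(\<integral>w. lwt z + lwt w - ln (cmod (z - w)) \<partial>\<mu>) = lwt z + (\<integral>w. lwt w \<partial>\<mu>) - lpot \<mu> z"
    unfolding lpot_def using l i by (simp add: prob_space)
  finally have "cpot \<mu> z = ennreal (lwt z + (\<integral>w. lwt w \<partial>\<mu>) - lpot \<mu> z)" .
  moreover have "0 \<le> lwt z + (\<integral>w. lwt w \<partial>\<mu>) - lpot \<mu> z"
    using integral_nonneg_AE[OF nn] l i by (simp add: prob_space lpot_def)
  ultimately show ?thesis
    unfolding log_potential_eq[OF \<mu>] by (simp add: enn2ereal_ennreal)
qed

text \<open>A finite potential excludes an atom at \<open>z\<close>, since the chordal kernel is
  infinite there. The value of \<open>ln 0\<close> then matters on a null set only.\<close>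

lemma log_potential_finiteD:
  assumes \<mu>: "\<mu> \<in> prob_measures_on C" "compact C" and fin: "log_potential \<mu> z \<noteq> -\<infinity>"
  shows "integrable \<mu> (\<lambda>w. ln (cmod (z - w)))" "AE w in \<mu>. w \<noteq> z"
    "log_potential \<mu> z = ereal (lpot \<mu> z)"
proof -
  note D = prob_measures_onD[OF \<mu>(1) compact_imp_closed[OF \<mu>(2)]]
  interpret prob_space \<mu> by (rule D)
  have l: "integrable \<mu> lwt" by (rule integrable_lwt[OF \<mu>])
  have c: "(\<integral>\<^sup>+w. chordal z w \<partial>\<mu>) \<noteq> \<infinity>"
    using fin unfolding log_potential_eq[OF \<mu>] cpot_def by auto
  have m: "chordal z \<in> borel_measurable \<mu>" using D(2) by (simp cong: measurable_cong_sets)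
  have lm: "(\<lambda>w. ln (cmod (z - w))) \<in> borel_measurable \<mu>" using D(2) by (simp cong: measurable_cong_sets)
  have "AE w in \<mu>. chordal z w \<noteq> \<infinity>" by (rule nn_integral_PInf_AE[OF m c])
  then show ae: "AE w in \<mu>. w \<noteq> z" by eventually_elim (auto simp: chordal_refl)
  have d: "integrable \<mu> (\<lambda>w. lwt z + lwt w - ln (cmod (z - w)))"
  proof (rule integrableI_nonneg)
    show "AE w in \<mu>. 0 \<le> lwt z + lwt w - ln (cmod (z - w))"
      using ae by eventually_elim (rule chordal_eq(2), simp)
    have "(\<integral>\<^sup>+w. ennreal (lwt z + lwt w - ln (cmod (z - w))) \<partial>\<mu>) = (\<integral>\<^sup>+w. chordal z w \<partial>\<mu>)"
    proof (rule nn_integral_cong_AE)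
      show "AE w in \<mu>. ennreal (lwt z + lwt w - ln (cmod (z - w))) = chordal z w"
        using ae by eventually_elim (rule chordal_eq(1)[symmetric], simp)
    qed
    then show "(\<integral>\<^sup>+w. ennreal (lwt z + lwt w - ln (cmod (z - w))) \<partial>\<mu>) < \<infinity>"
      using c by (simp add: top.not_eq_extremum)
    show "(\<lambda>w. lwt z + lwt w - ln (cmod (z - w))) \<in> borel_measurable \<mu>"
      using lm l by measurable
  qed
  have "integrable \<mu> (\<lambda>w. lwt z + lwt w)" using l by simp
  from Bochner_Integration.integrable_diff[OF this d] show i: "integrable \<mu> (\<lambda>w. ln (cmod (z - w)))" by simp
  show "log_potential \<mu> z = ereal (lpot \<mu> z)" by (rule log_potential_eq_lpot[OF \<mu> i ae])
qed

lemma log_potential_off: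
  assumes \<mu>: "\<mu> \<in> prob_measures_on C" "compact C" and z: "z \<notin> C"
  shows "integrable \<mu> (\<lambda>w. ln (cmod (z - w)))" "AE w in \<mu>. w \<noteq> z"
    "log_potential \<mu> z = ereal (lpot \<mu> z)"
proof -
  note D = prob_measures_onD[OF \<mu>(1) compact_imp_closed[OF \<mu>(2)]]
  show i: "integrable \<mu> (\<lambda>w. ln (cmod (z - w)))"
    by (rule integrable_continuous_compact[OF \<mu>]) (use z in \<open>auto intro!: continuous_intros\<close>)
  show ae: "AE w in \<mu>. w \<noteq> z" using D(4) by eventually_elim (use z in auto)
  show "log_potential \<mu> z = ereal (lpot \<mu> z)" by (rule log_potential_eq_lpot[OF \<mu> i ae])
qed

text \<open>Truncating the logarithm below the distance from \<open>z\<close> to \<open>C\<close>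
  changes nothing on \<open>C\<close> and yields a test function continuous on the whole
  plane.\<close>

lemma wconv_lpot_off:
  assumes X: "\<And>k. X k \<in> prob_measures_on C" and C: "compact C" and \<mu>: "\<mu> \<in> prob_measures_on C"
    and w: "wconv X \<mu>" and z: "z \<notin> C"
  shows "(\<lambda>k. lpot (X k) z) \<longlonglongrightarrow> lpot \<mu> z"
proof -
  have "open (- C)" using C by (simp add: compact_imp_closed open_Compl)
  then obtain d where d: "d > 0" "ball z d \<subseteq> - C" using z openE by blast
  have e: "lpot \<nu> z = (\<integral>w. ln (max d (cmod (z - w))) \<partial>\<nu>)" if \<nu>: "\<nu> \<in> prob_measures_on C" for \<nu>
  proof -
    note D = prob_measures_onD[OF \<nu> compact_imp_closed[OF C]]
    show ?thesis unfolding lpot_def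
    proof (rule integral_cong_AE)
      show "AE w in \<nu>. ln (cmod (z - w)) = ln (max d (cmod (z - w)))"
        using D(4)
      proof eventually_elim
        case (elim w)
        then have "\<not> dist z w < d" using d by auto
        then show ?case by (simp add: dist_norm max_def)
      qed
    qed (use D(2) in \<open>auto cong: measurable_cong_sets\<close>)
  qed
  show ?thesis unfolding e[OF X] e[OF \<mu>]
    using d(1) by (intro wconvD[OF w] continuous_intros) (auto simp: max_def)
qed

lemma cpot_of_log_potential:
  assumes "\<mu> \<in> prob_measures_on C" "compact C" "log_potential \<mu> z = ereal c"
  shows "cpot \<mu> z = ennreal (lwt z + (\<integral>w. lwt w \<partial>\<mu>) - c)" "0 \<le> lwt z + (\<integral>w. lwt w \<partial>\<mu>) - c"
proof -
  have e: "ereal (lwt z + (\<integral>w. lwt w \<partial>\<mu>)) - enn2ereal (cpot \<mu> z) = ereal c"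
    using assms(3) unfolding log_potential_eq[OF assms(1,2)] .
  obtain x where x: "cpot \<mu> z = ennreal x" "0 \<le> x"
    using e by (cases "cpot \<mu> z") auto
  then have "x = lwt z + (\<integral>w. lwt w \<partial>\<mu>) - c" using e by (simp add: enn2ereal_ennreal)
  then show "cpot \<mu> z = ennreal (lwt z + (\<integral>w. lwt w \<partial>\<mu>) - c)" "0 \<le> lwt z + (\<integral>w. lwt w \<partial>\<mu>) - c" using x by auto
qed

text \<open>The relation between potential and \<open>cpot\<close>, integrated against \<nu>: the
  mutual energy is known as soon as one potential is known almost everywhere.\<close>

lemma cen_of_log_potential:
  assumes \<mu>: "\<mu> \<in> prob_measures_on C" "compact C" and \<nu>: "\<nu> \<in> prob_measures_on D" "compact D"
    and u: "AE z in \<nu>. log_potential \<mu> z = ereal (u z)" and ui: "integrable \<nu> u"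
  shows "cen \<mu> \<nu> = ennreal ((\<integral>w. lwt w \<partial>\<nu>) + (\<integral>w. lwt w \<partial>\<mu>) - (\<integral>z. u z \<partial>\<nu>))"
    and "0 \<le> (\<integral>w. lwt w \<partial>\<nu>) + (\<integral>w. lwt w \<partial>\<mu>) - (\<integral>z. u z \<partial>\<nu>)"
proof -
  note D = prob_measures_onD[OF \<nu>(1) compact_imp_closed[OF \<nu>(2)]]
  interpret prob_space \<nu> by (rule D)
  have l: "integrable \<nu> lwt" by (rule integrable_lwt[OF \<nu>])
  have nn: "AE z in \<nu>. 0 \<le> lwt z + (\<integral>w. lwt w \<partial>\<mu>) - u z"
    using u by eventually_elim (rule cpot_of_log_potential(2)[OF \<mu>])
  have e: "(\<integral>z. lwt z + (\<integral>w. lwt w \<partial>\<mu>) - u z \<partial>\<nu>) = (\<integral>w. lwt w \<partial>\<nu>) + (\<integral>w. lwt w \<partial>\<mu>) - (\<integral>z. u z \<partial>\<nu>)"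
    using l ui by (simp add: prob_space)
  show "0 \<le> (\<integral>w. lwt w \<partial>\<nu>) + (\<integral>w. lwt w \<partial>\<mu>) - (\<integral>z. u z \<partial>\<nu>)"
    using integral_nonneg_AE[OF nn] unfolding e .
  have "cen \<mu> \<nu> = (\<integral>\<^sup>+z. ennreal (lwt z + (\<integral>w. lwt w \<partial>\<mu>) - u z) \<partial>\<nu>)"
    unfolding cen_def
  proof (rule nn_integral_cong_AE)
    show "AE z in \<nu>. cpot \<mu> z = ennreal (lwt z + (\<integral>w. lwt w \<partial>\<mu>) - u z)"
      using u by eventually_elim (rule cpot_of_log_potential(1)[OF \<mu>])
  qed
  also have "\<dots> = ennreal (\<integral>z. lwt z + (\<integral>w. lwt w \<partial>\<mu>) - u z \<partial>\<nu>)"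
    using l ui nn by (intro nn_integral_eq_integral) auto
  finally show "cen \<mu> \<nu> = ennreal ((\<integral>w. lwt w \<partial>\<nu>) + (\<integral>w. lwt w \<partial>\<mu>) - (\<integral>z. u z \<partial>\<nu>))"
    unfolding e .
qed

lemma cen_le_of_log_potential_ge:
  assumes \<mu>: "\<mu> \<in> prob_measures_on C" "compact C" and \<nu>: "\<nu> \<in> prob_measures_on D" "compact D"
    and u: "AE z in \<nu>. ereal c \<le> log_potential \<mu> z"
  shows "cen \<mu> \<nu> \<le> ennreal ((\<integral>w. lwt w \<partial>\<nu>) + (\<integral>w. lwt w \<partial>\<mu>) - c)"
    and "0 \<le> (\<integral>w. lwt w \<partial>\<nu>) + (\<integral>w. lwt w \<partial>\<mu>) - c"
proof -
  note D = prob_measures_onD[OF \<nu>(1) compact_imp_closed[OF \<nu>(2)]]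
  interpret prob_space \<nu> by (rule D)
  have l: "integrable \<nu> lwt" by (rule integrable_lwt[OF \<nu>])
  have le: "cpot \<mu> z \<le> ennreal (lwt z + (\<integral>w. lwt w \<partial>\<mu>) - c) \<and> 0 \<le> lwt z + (\<integral>w. lwt w \<partial>\<mu>) - c"
    if "ereal c \<le> log_potential \<mu> z" for z
  proof -
    have fin: "log_potential \<mu> z = ereal (lpot \<mu> z)"
      using that by (intro log_potential_finiteD(3)[OF \<mu>]) auto
    then have "c \<le> lpot \<mu> z" using that by simp
    then show ?thesis using cpot_of_log_potential[OF \<mu> fin] by (simp add: ennreal_leI)
  qed
  have nn: "AE z in \<nu>. 0 \<le> lwt z + (\<integral>w. lwt w \<partial>\<mu>) - c"
    using u by eventually_elim (rule le[THEN conjunct2])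
  have e: "(\<integral>z. lwt z + (\<integral>w. lwt w \<partial>\<mu>) - c \<partial>\<nu>) = (\<integral>w. lwt w \<partial>\<nu>) + (\<integral>w. lwt w \<partial>\<mu>) - c"
    using l by (simp add: prob_space)
  show "0 \<le> (\<integral>w. lwt w \<partial>\<nu>) + (\<integral>w. lwt w \<partial>\<mu>) - c"
    using integral_nonneg_AE[OF nn] unfolding e .
  have "cen \<mu> \<nu> \<le> (\<integral>\<^sup>+z. ennreal (lwt z + (\<integral>w. lwt w \<partial>\<mu>) - c) \<partial>\<nu>)"
    unfolding cen_def
  proof (rule nn_integral_mono_AE)
    show "AE z in \<nu>. cpot \<mu> z \<le> ennreal (lwt z + (\<integral>w. lwt w \<partial>\<mu>) - c)"
      using u by eventually_elim (rule le[THEN conjunct1])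
  qed
  also have "\<dots> = ennreal (\<integral>z. lwt z + (\<integral>w. lwt w \<partial>\<mu>) - c \<partial>\<nu>)"
    using l nn by (intro nn_integral_eq_integral) auto
  finally show "cen \<mu> \<nu> \<le> ennreal ((\<integral>w. lwt w \<partial>\<nu>) + (\<integral>w. lwt w \<partial>\<mu>) - c)"
    unfolding e .
qed

lemma log_energy_ge_of_log_potential_ge:
  assumes \<mu>: "\<mu> \<in> prob_measures_on C" "compact C" and u: "AE z in \<mu>. ereal c \<le> log_potential \<mu> z"
  shows "ereal c \<le> log_energy \<mu>"
proof -
  have "cen \<mu> \<mu> \<le> ennreal (2 * (\<integral>w. lwt w \<partial>\<mu>) - c)" "0 \<le> 2 * (\<integral>w. lwt w \<partial>\<mu>) - c"
    using cen_le_of_log_potential_ge[OF \<mu> \<mu> u] unfolding mult_2 .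
  then have "enn2ereal (cen \<mu> \<mu>) \<le> ereal (2 * (\<integral>w. lwt w \<partial>\<mu>) - c)"
    by (simp only: less_eq_ennreal.rep_eq enn2ereal_ennreal)
  then have "ereal (2 * (\<integral>w. lwt w \<partial>\<mu>)) - ereal (2 * (\<integral>w. lwt w \<partial>\<mu>) - c) \<le> log_energy \<mu>"
    unfolding log_energy_eq[OF \<mu>] by (intro ereal_minus_mono) auto
  then show ?thesis by simp
qed

section \<open>Zero-counting measures and lemniscates\<close>

text \<open>Drawing an index of a root list instead of a root counts multiplicities
  automatically.\<close>

definition zero_measure :: "complex poly \<Rightarrow> complex measure" where
  "zero_measure p =
     distr (measure_pmf (pmf_of_set {..<degree p})) borel (\<lambda>i. (SOME xs. mset xs = proots p) ! i)"

lemma integral_zero_measure: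
  fixes f :: "complex \<Rightarrow> real"
  assumes p: "degree p > 0" and f: "f \<in> borel_measurable borel"
  shows "(\<integral>w. f w \<partial>zero_measure p) = (\<Sum>w\<in>#proots p. f w) / degree p"
proof -
  define xs where "xs = (SOME xs. mset xs = proots p)"
  have xs: "mset xs = proots p" unfolding xs_def by (rule someI_ex) (rule ex_mset)
  have len: "length xs = degree p" using size_proots_complex[of p] xs by (metis size_mset)
  have "(\<integral>w. f w \<partial>zero_measure p) = (\<integral>i. f (xs ! i) \<partial>measure_pmf (pmf_of_set {..<degree p}))"
    unfolding zero_measure_def xs_def[symmetric] using f by (subst integral_distr) auto
  also have "\<dots> = (\<Sum>i<degree p. f (xs ! i)) / degree p"
    using p by (subst integral_pmf_of_set) (auto simp: lessThan_empty_iff)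
  also have "(\<Sum>i<degree p. f (xs ! i)) = sum_list (map f xs)"
    by (simp add: sum_list_sum_nth len atLeast0LessThan)
  also have "\<dots> = (\<Sum>w\<in>#proots p. f w)"
    unfolding xs[symmetric] by (metis mset_map sum_mset_sum_list)
  finally show ?thesis .
qed

lemma zero_measure_on:
  assumes p: "degree p > 0" and C: "closed C" "{z. poly p z = 0} \<subseteq> C"
  shows "zero_measure p \<in> prob_measures_on C"
proof -
  define xs where "xs = (SOME xs. mset xs = proots p)"
  have xs: "mset xs = proots p" unfolding xs_def by (rule someI_ex) (rule ex_mset)
  have len: "length xs = degree p" using size_proots_complex[of p] xs by (metis size_mset)
  have "p \<noteq> 0" using p by auto
  then have "set xs = {z. poly p z = 0}" using xs by (metis set_count_proots set_mset_mset)
  then have in_C: "xs ! i \<in> C" if "i < degree p" for i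
    using that C(2) len by (metis nth_mem subsetD)
  have "prob_space (zero_measure p)" "sets (zero_measure p) = sets borel"
    unfolding zero_measure_def by (auto intro!: measure_pmf.prob_space_distr)
  moreover have "AE z in zero_measure p. z \<in> C"
    unfolding zero_measure_def xs_def[symmetric]
    using p in_C C by (subst AE_distr_iff) (auto simp: AE_measure_pmf_iff lessThan_empty_iff)
  ultimately show ?thesis using C by (intro prob_measures_onI) auto
qed

lemma poly_prod_linear: "poly (\<Prod>x\<in>#M. [:- x, 1:]) z = (\<Prod>x\<in>#M. z - x)" for z :: complex
  by (induction M) (auto simp: algebra_simps)

lemma poly_eq_prod_proots: "poly p z = lead_coeff p * (\<Prod>x\<in>#proots p. z - x)" for z :: complex
  by (subst complex_poly_decompose_multiset[of p, symmetric]) (simp only: poly_smult poly_prod_linear)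

text \<open>Non-vanishing is carried through the induction because the logarithm of a product splits
  only for nonzero factors.\<close>

lemma ln_cmod_prod_mset:
  "(\<forall>x\<in>#M. z \<noteq> x) \<Longrightarrow> ln (cmod (\<Prod>x\<in>#M. z - x)) = (\<Sum>x\<in>#M. ln (cmod (z - x))) \<and> (\<Prod>x\<in>#M. z - x) \<noteq> 0"
  by (induction M) (auto simp: norm_mult ln_mult)

lemma ln_cmod_poly:
  assumes "poly p z \<noteq> 0"
  shows "ln (cmod (poly p z)) = ln (cmod (lead_coeff p)) + (\<Sum>x\<in>#proots p. ln (cmod (z - x)))"
proof -
  have p: "p \<noteq> 0" using assms by auto
  then have "\<forall>x\<in>#proots p. z \<noteq> x" using assms by auto
  from ln_cmod_prod_mset[OF this] show ?thesis
    using p by (subst poly_eq_prod_proots) (simp add: norm_mult ln_mult)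
qed

lemma finite_imp_compact_roots: "p \<noteq> 0 \<Longrightarrow> compact {z. poly p z = (0::complex)}"
  by (intro finite_imp_compact poly_roots_finite)

lemma lpot_zero_measure:
  assumes p: "degree p > 0" and z: "poly p z \<noteq> 0"
  shows "lpot (zero_measure p) z = (ln (cmod (poly p z)) - ln (cmod (lead_coeff p))) / degree p"
    and "log_potential (zero_measure p) z = ereal (lpot (zero_measure p) z)"
proof -
  show "lpot (zero_measure p) z = (ln (cmod (poly p z)) - ln (cmod (lead_coeff p))) / degree p"
    unfolding lpot_def using p ln_cmod_poly[OF z] by (subst integral_zero_measure) auto
  have "p \<noteq> 0" using p by auto
  then have c: "compact {z. poly p z = 0}" by (rule finite_imp_compact_roots)
  show "log_potential (zero_measure p) z = ereal (lpot (zero_measure p) z)"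
    using z by (intro log_potential_off(3)[OF zero_measure_on c]) (auto simp: p compact_imp_closed c)
qed

lemma measure_zero_measure:
  assumes p: "degree p > 0" and L: "L \<in> sets borel"
  shows "measure (zero_measure p) L = size (filter_mset (\<lambda>z. z \<in> L) (proots p)) / degree p"
proof -
  have s: "sets (zero_measure p) = sets borel" unfolding zero_measure_def by simp
  have "measure (zero_measure p) L = (\<integral>w. indicator L w \<partial>zero_measure p)"
    using L s by simp
  also have "\<dots> = (\<Sum>w\<in>#proots p. indicator L w) / degree p"
    using L by (intro integral_zero_measure p) auto
  also have "(\<Sum>w\<in>#M. indicator L w) = real (size (filter_mset (\<lambda>z. z \<in> L) M))" for M
    by (induction M) (auto simp: indicator_def)
  finally show ?thesis .
qed

lemma cmod_poly_ge:
  assumes "{z. poly p z = 0} \<subseteq> cball 0 R" "cmod z \<ge> R" "R \<ge> 0" "p \<noteq> 0"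
  shows "cmod (poly p z) \<ge> cmod (lead_coeff p) * (cmod z - R) ^ degree p"
proof -
  have "(cmod z - R) ^ size M \<le> cmod (\<Prod>x\<in>#M. z - x)" if "\<forall>x\<in>#M. cmod x \<le> R" for M
    using that
  proof (induction M)
    case (add x M)
    have "cmod z - R \<le> cmod (z - x)" using norm_triangle_ineq2[of z x] add.prems by auto
    then have "(cmod z - R) * (cmod z - R) ^ size M \<le> cmod (z - x) * cmod (\<Prod>x\<in>#M. z - x)"
      using add assms(2) by (intro mult_mono) auto
    then show ?case by (simp add: norm_mult)
  qed simp
  moreover have "\<forall>x\<in>#proots p. cmod x \<le> R" using assms(1,4) by (auto simp: subset_iff)
  ultimately have "(cmod z - R) ^ degree p \<le> cmod (\<Prod>x\<in>#proots p. z - x)"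
    by (metis size_proots_complex)
  then show ?thesis
    by (subst poly_eq_prod_proots) (simp add: norm_mult mult_left_mono)
qed

lemma compact_poly_vimage:
  fixes p :: "complex poly"
  assumes p: "degree p > 0"
  shows "compact (poly p -` cball 0 r)"
proof -
  have p0: "p \<noteq> 0" using p by auto
  obtain R where R: "R > 0" "{z. poly p z = 0} \<subseteq> cball 0 R"
    using compact_imp_bounded[OF finite_imp_compact_roots[OF p0]] unfolding bounded_pos
    by (auto simp: subset_iff)
  \<comment> \<open>\<open>M \<ge> 1\<close> lets \<open>M\<close> be replaced by its power, and
    \<open>M\<close> times the modulus of the leading coefficient exceeds \<open>r\<close>. At
    distance \<open>M\<close> beyond the roots the polynomial is therefore larger than
    \<open>r\<close>.\<close>
  define M where "M = max 1 ((r + 1) / cmod (lead_coeff p))"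
  have M: "M \<ge> 1" "cmod (lead_coeff p) * M \<ge> r + 1"
    unfolding M_def using p0 by (auto simp: max_def field_simps)
  have "poly p -` cball 0 r \<subseteq> cball 0 (R + M)"
  proof
    fix z assume z: "z \<in> poly p -` cball 0 r"
    show "z \<in> cball 0 (R + M)"
    proof (rule ccontr)
      assume "z \<notin> cball 0 (R + M)"
      then have zl: "cmod z - R \<ge> M" by auto
      have "M \<le> M ^ degree p" using M p self_le_power[of M "degree p"] by simp
      also have "\<dots> \<le> (cmod z - R) ^ degree p" using zl M by (intro power_mono) auto
      finally have "cmod (lead_coeff p) * M \<le> cmod (lead_coeff p) * (cmod z - R) ^ degree p"
        by (intro mult_left_mono) auto
      also have "\<dots> \<le> cmod (poly p z)" using zl M R p0 by (intro cmod_poly_ge) auto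
      finally show False using M z by auto
    qed
  qed
  moreover have "closed (poly p -` cball 0 r)"
    by (intro continuous_closed_vimage) (auto intro: poly_isCont)
  ultimately show ?thesis
    by (metis bounded_cball bounded_subset compact_eq_bounded_closed)
qed

text \<open>Factoring out the dominant power leaves 1 - (u / v) ^ n, which tends to 1. This is how
  the maximum in the lemniscate potential arises.\<close>

lemma ln_cmod_power_diff_limit:
  fixes u v :: complex
  assumes "cmod u < cmod v"
  shows "(\<lambda>n. ln (cmod (v ^ Suc n - u ^ Suc n)) / real (Suc n)) \<longlonglongrightarrow> ln (cmod v)"
proof -
  have v: "v \<noteq> 0" using assms by auto
  have "cmod (u / v) < 1" using assms v by (simp add: norm_divide)
  then have p: "(\<lambda>n. (u / v) ^ n) \<longlonglongrightarrow> 0" by (rule LIMSEQ_power_zero)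
  have "(\<lambda>n. ln (cmod (1 - (u / v) ^ n))) \<longlonglongrightarrow> ln (cmod (1 - 0))"
    by (intro tendsto_intros p) auto
  then have "(\<lambda>n. ln (cmod (1 - (u / v) ^ Suc n))) \<longlonglongrightarrow> 0"
    by (intro LIMSEQ_Suc) simp
  then have "(\<lambda>n. ln (cmod (1 - (u / v) ^ Suc n)) * (1 / real (Suc n))) \<longlonglongrightarrow> 0 * 0"
    by (intro tendsto_mult LIMSEQ_Suc[OF lim_1_over_n])
  then have "(\<lambda>n. ln (cmod v) + ln (cmod (1 - (u / v) ^ Suc n)) * (1 / real (Suc n))) \<longlonglongrightarrow> ln (cmod v) + 0"
    by (intro tendsto_intros) simp
  moreover have "ln (cmod (v ^ Suc n - u ^ Suc n)) / real (Suc n)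
      = ln (cmod v) + ln (cmod (1 - (u / v) ^ Suc n)) * (1 / real (Suc n))" for n
  proof -
    have "v ^ Suc n - u ^ Suc n = v ^ Suc n * (1 - (u / v) ^ Suc n)"
      using v by (simp add: power_divide right_diff_distrib del: power_Suc)
    moreover have "(u / v) ^ Suc n \<noteq> 1"
    proof
      assume "(u / v) ^ Suc n = 1"
      then have "cmod (u / v) ^ Suc n = 1" by (metis norm_one norm_power)
      moreover have "cmod (u / v) ^ Suc n < 1 ^ Suc n"
        using \<open>cmod (u / v) < 1\<close> by (intro power_strict_mono) auto
      ultimately show False by (simp only: power_one)
    qed
    ultimately have "ln (cmod (v ^ Suc n - u ^ Suc n)) = real (Suc n) * ln (cmod v) + ln (cmod (1 - (u / v) ^ Suc n))"
      using v by (simp add: norm_mult norm_power ln_mult ln_realpow del: power_Suc of_nat_Suc)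
    then show ?thesis by (simp only: add_divide_distrib) simp
  qed
  ultimately show ?thesis by simp
qed

lemma integral_sum_mset:
  fixes F :: "'b \<Rightarrow> 'a \<Rightarrow> real"
  assumes "\<And>x. x \<in># A \<Longrightarrow> integrable M (F x)"
  shows "integrable M (\<lambda>w. \<Sum>x\<in>#A. F x w) \<and> (\<integral>w. (\<Sum>x\<in>#A. F x w) \<partial>M) = (\<Sum>x\<in>#A. \<integral>w. F x w \<partial>M)"
  using assms
proof (induction A)
  case (add x A)
  have x: "integrable M (F x)" by (rule add.prems) simp
  have A: "integrable M (\<lambda>w. \<Sum>x\<in>#A. F x w)" "(\<integral>w. (\<Sum>x\<in>#A. F x w) \<partial>M) = (\<Sum>x\<in>#A. \<integral>w. F x w \<partial>M)"
  proof -
    have "integrable M (F y)" if "y \<in># A" for y using that by (intro add.prems) simp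
    from add.IH[OF this] show "integrable M (\<lambda>w. \<Sum>x\<in>#A. F x w)" "(\<integral>w. (\<Sum>x\<in>#A. F x w) \<partial>M) = (\<Sum>x\<in>#A. \<integral>w. F x w \<partial>M)"
      by blast+
  qed
  show ?case
    unfolding image_mset_add_mset sum_mset.add_mset
    using Bochner_Integration.integrable_add[OF x A(1)] Bochner_Integration.integral_add[OF x A(1)] A(2) by argo
qed simp

text \<open>The measure is a weak limit of the zero-counting measures of \<open>p ^ n - r ^ n\<close>.\<close>

lemma lemniscate_measure_aux:
  fixes p :: "complex poly"
  assumes p: "degree p > 0" and r: "r > 0"
  obtains \<omega> where "\<omega> \<in> prob_measures_on {z. cmod (poly p z) = r}"
    "\<And>z. cmod (poly p z) \<noteq> r \<Longrightarrow>
      lpot \<omega> z = (ln (max r (cmod (poly p z))) - ln (cmod (lead_coeff p))) / degree p"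
proof -
  define C where "C = {z. cmod (poly p z) = r}"
  have clC: "closed C" unfolding C_def by (intro closed_Collect_eq continuous_intros)
  have "C = C \<inter> (poly p -` cball 0 r)" unfolding C_def by auto
  then have C: "compact C" using compact_poly_vimage[OF p, of r] clC by (metis closed_Int_compact)
  have p0: "p \<noteq> 0" using p by auto
  define P where "P n = p ^ Suc n - [:complex_of_real r ^ Suc n:]" for n
  have dpow: "degree (p ^ Suc n) = Suc n * degree p" for n using degree_power_eq[OF p0] by blast
  have dP: "degree (P n) = Suc n * degree p" for n
  proof -
    have "degree (- [:complex_of_real r ^ Suc n:]) < degree (p ^ Suc n)"
      unfolding dpow using p by simp
    then have "degree (p ^ Suc n + - [:complex_of_real r ^ Suc n:]) = degree (p ^ Suc n)"
      by (rule degree_add_eq_left)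
    then show ?thesis unfolding P_def diff_conv_add_uminus dpow .
  qed
  have lcP: "lead_coeff (P n) = lead_coeff p ^ Suc n" for n
  proof -
    have "degree (p ^ Suc n) \<noteq> 0" unfolding dpow using p by simp
    then have "coeff [:complex_of_real r ^ Suc n:] (degree (p ^ Suc n)) = 0"
      by (simp add: coeff_pCons split: nat.splits del: power_Suc)
    then have "coeff (P n) (degree (p ^ Suc n)) = lead_coeff (p ^ Suc n)"
      unfolding P_def by (simp del: power_Suc)
    then show ?thesis by (simp only: dP dpow lead_coeff_power[symmetric])
  qed
  have dP0: "degree (P n) > 0" for n using dP p by simp
  have polyP: "poly (P n) z = poly p z ^ Suc n - complex_of_real r ^ Suc n" for n z
    unfolding P_def by (simp del: power_Suc)
  have roots: "{z. poly (P n) z = 0} \<subseteq> C" for n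
  proof
    fix z assume "z \<in> {z. poly (P n) z = 0}"
    then have "poly p z ^ Suc n = complex_of_real r ^ Suc n" unfolding polyP by (simp del: power_Suc)
    then have "cmod (poly p z ^ Suc n) = cmod (complex_of_real r ^ Suc n)" by (rule arg_cong)
    then have "cmod (poly p z) ^ Suc n = r ^ Suc n"
      using r by (simp only: norm_power norm_of_real abs_of_pos)
    then have "cmod (poly p z) = r" by (rule power_inject_base) (use r in auto)
    then show "z \<in> C" unfolding C_def by simp
  qed
  obtain s \<omega> where s: "strict_mono s" and \<omega>: "\<omega> \<in> prob_measures_on C" and w: "wconv ((\<lambda>n. zero_measure (P n)) \<circ> s) \<omega>"
    by (rule wconv_compactness[of "\<lambda>n. zero_measure (P n)" C, OF zero_measure_on[OF dP0 clC roots] C]) blast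
  \<comment> \<open>Off \<open>C\<close> one of \<open>r\<close> and |p z| is strictly larger and
    decides the limit. Points of the curve itself escape this argument.\<close>
  have "lpot \<omega> z = (ln (max r (cmod (poly p z))) - ln (cmod (lead_coeff p))) / degree p"
    if z: "cmod (poly p z) \<noteq> r" for z
  proof -
    have zC: "z \<notin> C" using z unfolding C_def by simp
    have 1: "(\<lambda>k. lpot (((\<lambda>n. zero_measure (P n)) \<circ> s) k) z) \<longlonglongrightarrow> lpot \<omega> z"
      by (rule wconv_lpot_off[OF _ C \<omega> w zC]) (auto intro!: zero_measure_on dP0 clC roots)
    have "(\<lambda>n. ln (cmod (poly p z ^ Suc n - complex_of_real r ^ Suc n)) / real (Suc n)) \<longlonglongrightarrow> ln (max r (cmod (poly p z)))"
    proof (cases "r < cmod (poly p z)")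
      case True
      then show ?thesis using ln_cmod_power_diff_limit[of "complex_of_real r" "poly p z"] r
        by (simp add: max_def del: power_Suc of_nat_Suc)
    next
      case False
      then have "cmod (poly p z) < cmod (complex_of_real r)" using z r by simp
      from ln_cmod_power_diff_limit[OF this] show ?thesis using False r
        by (simp add: max_def norm_minus_commute del: power_Suc of_nat_Suc)
    qed
    then have "(\<lambda>n. (ln (cmod (poly p z ^ Suc n - complex_of_real r ^ Suc n)) / real (Suc n) - ln (cmod (lead_coeff p))) / degree p)
        \<longlonglongrightarrow> (ln (max r (cmod (poly p z))) - ln (cmod (lead_coeff p))) / degree p"
      using p by (intro tendsto_intros) auto
    moreover have "(ln (cmod (poly p z ^ Suc n - complex_of_real r ^ Suc n)) / real (Suc n) - ln (cmod (lead_coeff p))) / degree p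
        = lpot (zero_measure (P n)) z" for n
    proof -
      have nz: "poly (P n) z \<noteq> 0" using roots[of n] zC by blast
      have "lpot (zero_measure (P n)) z = (ln (cmod (poly p z ^ Suc n - complex_of_real r ^ Suc n)) - real (Suc n) * ln (cmod (lead_coeff p))) / (real (Suc n) * degree p)"
      proof -
        have A: "ln (cmod (lead_coeff (P n))) = real (Suc n) * ln (cmod (lead_coeff p))"
          unfolding lcP using p0 by (simp add: norm_power ln_realpow del: power_Suc of_nat_Suc)
        have B: "real (degree (P n)) = real (Suc n) * real (degree p)" unfolding dP by (rule of_nat_mult)
        show ?thesis by (simp only: lpot_zero_measure(1)[OF dP0 nz] A B polyP)
      qed
      also have "\<dots> = (ln (cmod (poly p z ^ Suc n - complex_of_real r ^ Suc n)) / real (Suc n) - ln (cmod (lead_coeff p))) / degree p"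
        using p by (simp add: diff_divide_distrib del: power_Suc of_nat_Suc)
      finally show ?thesis ..
    qed
    ultimately have "(\<lambda>n. lpot (zero_measure (P n)) z) \<longlonglongrightarrow> (ln (max r (cmod (poly p z))) - ln (cmod (lead_coeff p))) / degree p"
      by (simp only:)
    from LIMSEQ_subseq_LIMSEQ[OF this s] 1 show ?thesis by (intro LIMSEQ_unique) (simp_all add: o_def)
  qed
  then show thesis using that \<omega> unfolding C_def by blast
qed

section \<open>The lemniscate potential on the curve itself\<close>

text \<open>By the open mapping theorem a small ball is mapped onto a neighbourhood of
  \<open>poly p z\<close>, which contains a slightly dilated copy of that value.\<close>

lemma poly_near_larger_value:
  fixes p :: "complex poly"
  assumes p: "degree p > 0" and nz: "poly p z \<noteq> 0" and e: "e > 0"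
  obtains y where "cmod (y - z) < e" "cmod (poly p y) > cmod (poly p z)"
proof -
  have "\<not> poly p constant_on UNIV"
  proof
    assume "poly p constant_on UNIV"
    then obtain c where "\<And>x. poly p x = c" unfolding constant_on_def by blast
    then have "constant (poly p)" unfolding constant_def by simp
    then show False using p by (simp add: constant_degree)
  qed
  then have o: "open (poly p ` ball z e)"
    by (intro open_mapping_thm[where S=UNIV]) (auto intro!: holomorphic_intros)
  moreover have "poly p z \<in> poly p ` ball z e" using e by auto
  ultimately obtain d where d: "d > 0" "ball (poly p z) d \<subseteq> poly p ` ball z e"
    using openE by blast
  define t where "t = d / (2 * cmod (poly p z))"
  have t: "t > 0" unfolding t_def using d nz by simp
  have "dist (poly p z) (of_real (1 + t) * poly p z) = t * cmod (poly p z)"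
    using t by (simp add: dist_norm algebra_simps norm_mult)
  also have "\<dots> < d" unfolding t_def using d nz by (simp add: field_simps)
  finally obtain y where y: "y \<in> ball z e" "poly p y = of_real (1 + t) * poly p z"
    using d by (metis imageE mem_ball subsetD)
  have "cmod (poly p y) = (1 + t) * cmod (poly p z)"
    unfolding y(2) norm_mult norm_of_real using t by simp
  then have "cmod (poly p y) > cmod (poly p z)" using t nz by simp
  then show thesis using that y(1) by (auto simp: dist_norm norm_minus_commute)
qed

text \<open>Moving \<open>b\<close> radially outward from the circle that carries \<open>a\<close>
  increases its distance from \<open>a\<close>.\<close>

lemma cmod_diff_le_scaled:
  assumes "cmod a = cmod b" "e \<ge> 0"
  shows "cmod (a - b) \<le> cmod (a - of_real (1 + e) * b)"
proof -
  have inner: "Re (a * cnj b) \<le> (cmod b)\<^sup>2"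
    using complex_Re_le_cmod[of "a * cnj b"] assms(1) by (simp add: norm_mult power2_eq_square)
  have "(cmod (a - of_real (1 + e) * b))\<^sup>2 - (cmod (a - b))\<^sup>2 = e\<^sup>2 * (cmod b)\<^sup>2 + 2 * e * ((cmod b)\<^sup>2 - Re (a * cnj b))"
    unfolding cmod_power2 by (simp add: power2_eq_square algebra_simps)
  also have "\<dots> \<ge> 0" using assms(2) inner by (intro add_nonneg_nonneg mult_nonneg_nonneg) auto
  finally have "(cmod (a - b))\<^sup>2 \<le> (cmod (a - of_real (1 + e) * b))\<^sup>2" by simp
  then show ?thesis by (rule power2_le_imp_le) simp
qed

lemma degree_diff_const:
  fixes p :: "complex poly"
  assumes "degree p > 0"
  shows "degree (p - [:c:]) = degree p"
proof -
  have "degree (- [:c:]) < degree p" using assms by simp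
  from degree_add_eq_left[OF this] show ?thesis unfolding diff_conv_add_uminus .
qed

lemma lead_coeff_diff_const:
  fixes p :: "complex poly"
  assumes "degree p > 0"
  shows "lead_coeff (p - [:c:]) = lead_coeff p"
  unfolding degree_diff_const[OF assms] using assms by (simp add: coeff_pCons split: nat.splits)

lemma tendsto_if_cmod_less:
  assumes "\<And>j. cmod (y j - z) < 1 / real (Suc j)"
  shows "y \<longlonglongrightarrow> z"
proof (rule LIM_zero_cancel)
  show "(\<lambda>j. y j - z) \<longlonglongrightarrow> 0"
  proof (rule Lim_null_comparison[OF _ LIMSEQ_Suc[OF lim_1_over_n]])
    show "\<forall>\<^sub>F j in sequentially. norm (y j - z) \<le> 1 / real (Suc j)"
      by (intro always_eventually allI less_imp_le assms)
  qed
qed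

text \<open>Only the points of the curve \<open>C\<close> remain. Descent from nearby points with
  |p| > r gives the lower bound \<open>c\<close> there. The upper bound is obtained not for a single
  point but for the sum over its whole fibre under \<open>p\<close>, where the kernels combine to ln
  |p w - \<zeta>|.\<close>

lemma lemniscate_measure:
  fixes p :: "complex poly"
  assumes p: "degree p > 0" and r: "r > 0"
  obtains \<omega> where "\<omega> \<in> prob_measures_on {z. cmod (poly p z) = r}"
    "\<And>z. log_potential \<omega> z =
      ereal ((ln (max r (cmod (poly p z))) - ln (cmod (lead_coeff p))) / degree p)"
proof -
  define C where "C = {z. cmod (poly p z) = r}"
  define b where "b = ln (cmod (lead_coeff p))"
  define c where "c = (ln r - b) / degree p"
  obtain \<omega> where \<omega>: "\<omega> \<in> prob_measures_on C"
    and off: "\<And>z. cmod (poly p z) \<noteq> r \<Longrightarrow> lpot \<omega> z = (ln (max r (cmod (poly p z))) - b) / degree p"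
    unfolding C_def b_def by (rule lemniscate_measure_aux[OF p r]) blast
  have clC: "closed C" unfolding C_def by (intro closed_Collect_eq continuous_intros)
  have "C = C \<inter> (poly p -` cball 0 r)" unfolding C_def by auto
  then have C: "compact C" using compact_poly_vimage[OF p, of r] clC by (metis closed_Int_compact)
  note D = prob_measures_onD[OF \<omega> clC]
  interpret prob_space \<omega> by (rule D)
  have p0: "p \<noteq> 0" using p by auto
  have ge: "ereal c \<le> log_potential \<omega> z" if z: "z \<in> C" for z
  proof -
    have "\<exists>y. cmod (y - z) < 1 / real (Suc j) \<and> cmod (poly p y) > r" for j
    proof -
      have "cmod (poly p z) = r" "poly p z \<noteq> 0" using z r unfolding C_def by auto
      then show ?thesis using poly_near_larger_value[OF p, of z "1 / real (Suc j)"] by (metis zero_less_divide_1_iff of_nat_0_less_iff zero_less_Suc)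
    qed
    then obtain y where y: "\<And>j. cmod (y j - z) < 1 / real (Suc j)" "\<And>j. cmod (poly p (y j)) > r" by metis
    have yl: "y \<longlonglongrightarrow> z" by (rule tendsto_if_cmod_less[OF y(1)])
    have w: "wconv (\<lambda>_. \<omega>) \<omega>" unfolding wconv_def by simp
    show ?thesis
    proof (rule log_potential_descent[OF \<omega> C \<omega> C w yl tendsto_const])
      fix j
      have "y j \<notin> C" using y(2)[of j] unfolding C_def by auto
      from log_potential_off(3)[OF \<omega> C this] have "log_potential \<omega> (y j) = ereal (lpot \<omega> (y j))" .
      moreover have "c \<le> lpot \<omega> (y j)"
        unfolding c_def off[OF less_imp_neq[OF y(2)[of j], symmetric]]
        using y(2)[of j] r less_trans[OF r y(2)[of j]] by (intro divide_right_mono) auto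
      ultimately show "ereal c \<le> log_potential \<omega> (y j)" by simp
    qed
  qed
  have on: "log_potential \<omega> z = ereal c" if z: "z \<in> C" for z
  proof -
    define \<zeta> where "\<zeta> = poly p z"
    have \<zeta>: "cmod \<zeta> = r" using z unfolding C_def \<zeta>_def by simp
    define M where "M = proots (p - [:\<zeta>:])"
    have q0: "p - [:\<zeta>:] \<noteq> 0" using degree_diff_const[OF p, of \<zeta>] p by auto
    have Mset: "set_mset M = {x. poly p x = \<zeta>}" unfolding M_def using q0 by (auto)
    have sizeM: "size M = degree p" unfolding M_def size_proots_complex degree_diff_const[OF p] ..
    have zM: "z \<in># M" using Mset \<zeta>_def by simp
    have MC: "x \<in> C" if "x \<in># M" for x using that Mset \<zeta> unfolding C_def by auto
    have fin: "log_potential \<omega> x \<noteq> -\<infinity>" if "x \<in># M" for x using ge[OF MC[OF that]] by auto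
    note F = log_potential_finiteD[OF \<omega> C fin]
    \<comment> \<open>The fibre over \<zeta> is compared with the fibre over (1 + e) \<zeta>, which
      lies outside the curve, where the potential is known. The integrands compare by
      \<open>cmod_diff_le_scaled\<close>, because |p| = r holds \<omega>-almost everywhere.\<close>
    have bound: "(\<Sum>x\<in>#M. lpot \<omega> x) \<le> ln ((1 + e) * r) - b" if e: "e > 0" for e
    proof -
      define \<eta> where "\<eta> = of_real (1 + e) * \<zeta>"
      have \<eta>: "cmod \<eta> = (1 + e) * r" unfolding \<eta>_def norm_mult \<zeta> norm_of_real using e by simp
      then have \<eta>r: "cmod \<eta> > r" using e r by simp
      define M' where "M' = proots (p - [:\<eta>:])"
      have q0': "p - [:\<eta>:] \<noteq> 0" using degree_diff_const[OF p, of \<eta>] p by auto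
      have Mset': "set_mset M' = {x. poly p x = \<eta>}" unfolding M'_def using q0' by (auto)
      have sizeM': "size M' = degree p" unfolding M'_def size_proots_complex degree_diff_const[OF p] ..
      have MC': "x \<notin> C" if "x \<in># M'" for x using that Mset' \<eta>r unfolding C_def by auto
      note F' = log_potential_off[OF \<omega> C MC']
      have s1: "integrable \<omega> (\<lambda>w. \<Sum>x\<in>#M. ln (cmod (x - w)))" "(\<integral>w. (\<Sum>x\<in>#M. ln (cmod (x - w))) \<partial>\<omega>) = (\<Sum>x\<in>#M. lpot \<omega> x)"
        unfolding lpot_def using integral_sum_mset[of M \<omega> "\<lambda>x w. ln (cmod (x - w))"] F(1) by auto
      have s2: "integrable \<omega> (\<lambda>w. \<Sum>x\<in>#M'. ln (cmod (x - w)))" "(\<integral>w. (\<Sum>x\<in>#M'. ln (cmod (x - w))) \<partial>\<omega>) = (\<Sum>x\<in>#M'. lpot \<omega> x)"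
        unfolding lpot_def using integral_sum_mset[of M' \<omega> "\<lambda>x w. ln (cmod (x - w))"] F'(1) by auto
      have "\<forall>x\<in>set_mset M. AE w in \<omega>. w \<noteq> x" by (intro ballI) (rule F(2))
      from eventually_ball_finite[OF finite_set_mset this]
      have ae: "AE w in \<omega>. \<forall>x\<in>set_mset M. w \<noteq> x" .
      have "(\<Sum>x\<in>#M. lpot \<omega> x) \<le> (\<Sum>x\<in>#M'. lpot \<omega> x)"
        unfolding s1(2)[symmetric] s2(2)[symmetric]
      proof (rule integral_mono_AE[OF s1(1) s2(1)])
        show "AE w in \<omega>. (\<Sum>x\<in>#M. ln (cmod (x - w))) \<le> (\<Sum>x\<in>#M'. ln (cmod (x - w)))"
          using ae D(4)
        proof eventually_elim
          case (elim w)
          have pw: "cmod (poly p w) = r" using elim unfolding C_def by simp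
          have nz: "poly (p - [:\<zeta>:]) w \<noteq> 0" using elim(1) Mset by auto
          have nz': "poly (p - [:\<eta>:]) w \<noteq> 0" using pw \<eta>r by auto
          have "b + (\<Sum>x\<in>#M. ln (cmod (x - w))) = ln (cmod (poly p w - \<zeta>))"
            using ln_cmod_poly[OF nz] unfolding lead_coeff_diff_const[OF p] M_def b_def
            by (simp add: norm_minus_commute)
          also have "\<dots> \<le> ln (cmod (poly p w - \<eta>))"
          proof -
            have pos: "0 < cmod (poly p w - \<zeta>)" using nz by simp
            have "cmod (poly p w - \<zeta>) \<le> cmod (poly p w - \<eta>)"
              unfolding \<eta>_def by (rule cmod_diff_le_scaled) (use pw \<zeta> e in auto)
            then show ?thesis using pos by (metis ln_le_cancel_iff order_less_le_trans)
          qed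
          also have "\<dots> = b + (\<Sum>x\<in>#M'. ln (cmod (x - w)))"
            using ln_cmod_poly[OF nz'] unfolding lead_coeff_diff_const[OF p] M'_def b_def
            by (simp add: norm_minus_commute)
          finally show ?case by simp
        qed
      qed
      also have "\<dots> = (\<Sum>x\<in>#M'. (ln ((1 + e) * r) - b) / degree p)"
      proof (intro arg_cong[where f=sum_mset] image_mset_cong)
        fix x assume "x \<in># M'"
        then have px: "cmod (poly p x) = (1 + e) * r" using Mset' \<eta> by auto
        moreover have "(1 + e) * r > r" using e r by simp
        ultimately show "lpot \<omega> x = (ln ((1 + e) * r) - b) / degree p"
          by (subst off) (auto simp: max_def)
      qed
      also have "\<dots> = ln ((1 + e) * r) - b" using p by (simp add: sizeM')
      finally show ?thesis .
    qed
    have lim: "((\<lambda>e. ln ((1 + e) * r) - b) \<longlongrightarrow> ln ((1 + 0) * r) - b) (at_right 0)"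
      using r by (intro tendsto_intros) auto
    have "(\<Sum>x\<in>#M. lpot \<omega> x) \<le> ln ((1 + 0) * r) - b"
      by (rule tendsto_lowerbound[OF lim]) (auto simp: eventually_at_filter intro!: always_eventually bound)
    \<comment> \<open>All summands are at least \<open>c\<close> and their sum is at most
      \<open>c\<close> times their number, so each one equals \<open>c\<close>.\<close>
    then have up: "(\<Sum>x\<in>#M. lpot \<omega> x) \<le> real (size M) * c"
      unfolding sizeM c_def using p by simp
    obtain M1 where M1: "M = add_mset z M1" using zM by (metis insert_DiffM)
    have low: "real (size A) * c \<le> (\<Sum>x\<in>#A. lpot \<omega> x)" if "\<forall>x\<in>#A. c \<le> lpot \<omega> x" for A
      using that by (induction A) (auto simp: algebra_simps)
    have "c \<le> lpot \<omega> x" if "x \<in># M" for x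
      using ge[OF MC[OF that]] F(3)[OF that] by simp
    then have "real (size M1) * c \<le> (\<Sum>x\<in>#M1. lpot \<omega> x)" by (intro low) (simp add: M1)
    moreover have "lpot \<omega> z + (\<Sum>x\<in>#M1. lpot \<omega> x) \<le> real (size M1) * c + c"
      using up unfolding M1 by (simp add: algebra_simps)
    ultimately have "lpot \<omega> z \<le> c" by linarith
    then show ?thesis using ge[OF z] F(3)[OF zM] by simp
  qed
  show thesis
  proof (rule that)
    show "\<omega> \<in> prob_measures_on {z. cmod (poly p z) = r}" using \<omega> unfolding C_def .
    fix z show "log_potential \<omega> z = ereal ((ln (max r (cmod (poly p z))) - ln (cmod (lead_coeff p))) / degree p)"
    proof (cases "z \<in> C")
      case True
      then show ?thesis using on[OF True] unfolding C_def c_def b_def by simp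
    next
      case False
      then show ?thesis using log_potential_off(3)[OF \<omega> C False] off[of z] unfolding C_def b_def by simp
    qed
  qed
qed

text \<open>A measure whose potential is constant on \<open>E\<close> maximizes the energy: a
  competitor of larger energy would satisfy the inequality of
  \<open>cen_parallelogram_unique\<close> and hence be \<omega> itself.\<close>

lemma equilibrium_measure_poly_vimage:
  fixes p :: "complex poly"
  assumes p: "degree p > 0" and r: "r > 0"
  defines "E \<equiv> poly p -` cball 0 r"
  shows "equilibrium_measure E \<in> prob_measures_on E"
    and "\<And>z. log_potential (equilibrium_measure E) z =
      ereal ((ln (max r (cmod (poly p z))) - ln (cmod (lead_coeff p))) / degree p)"
proof -
  have E: "compact E" unfolding E_def by (rule compact_poly_vimage[OF p])
  define c where "c = (ln r - ln (cmod (lead_coeff p))) / degree p"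
  obtain \<omega> where \<omega>': "\<omega> \<in> prob_measures_on {z. cmod (poly p z) = r}"
    and pot: "\<And>z. log_potential \<omega> z = ereal ((ln (max r (cmod (poly p z))) - ln (cmod (lead_coeff p))) / degree p)"
    by (rule lemniscate_measure[OF p r]) blast
  have cl: "closed {z. cmod (poly p z) = r}" by (intro closed_Collect_eq continuous_intros)
  have \<omega>: "\<omega> \<in> prob_measures_on E"
    by (rule prob_measures_on_mono[OF \<omega>' cl compact_imp_closed[OF E]]) (auto simp: E_def)
  have potE: "log_potential \<omega> z = ereal c" if "z \<in> E" for z
    using that unfolding pot c_def E_def by (auto simp: max_def)
  \<comment> \<open>Constancy of the potential on \<open>E\<close> gives every \<nu> on
    \<open>E\<close> the logarithmic mutual energy \<open>c\<close> with \<omega>.\<close>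
  have cen: "cen \<omega> \<nu> = ennreal ((\<integral>w. lwt w \<partial>\<nu>) + (\<integral>w. lwt w \<partial>\<omega>) - c)" "0 \<le> (\<integral>w. lwt w \<partial>\<nu>) + (\<integral>w. lwt w \<partial>\<omega>) - c"
    if \<nu>: "\<nu> \<in> prob_measures_on E" for \<nu>
  proof -
    note D = prob_measures_onD[OF \<nu> compact_imp_closed[OF E]]
    interpret prob_space \<nu> by (rule D)
    have ae: "AE z in \<nu>. log_potential \<omega> z = ereal c" using D(4) by eventually_elim (rule potE)
    show "cen \<omega> \<nu> = ennreal ((\<integral>w. lwt w \<partial>\<nu>) + (\<integral>w. lwt w \<partial>\<omega>) - c)" "0 \<le> (\<integral>w. lwt w \<partial>\<nu>) + (\<integral>w. lwt w \<partial>\<omega>) - c"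
      using cen_of_log_potential[OF \<omega> E \<nu> E ae] by (simp_all add: prob_space)
  qed
  have en: "log_energy \<omega> = ereal c"
    unfolding log_energy_eq[OF \<omega> E] cen(1)[OF \<omega>] using cen(2)[OF \<omega>] by (simp add: enn2ereal_ennreal)
  have max: "log_energy \<nu> \<le> ereal c" if \<nu>: "\<nu> \<in> prob_measures_on E" for \<nu>
  proof (rule ccontr)
    assume n: "\<not> log_energy \<nu> \<le> ereal c"
    define a where "a = (\<integral>w. lwt w \<partial>\<nu>)"
    define b where "b = (\<integral>w. lwt w \<partial>\<omega>)"
    have n': "ereal c < ereal (2 * a) - enn2ereal (cen \<nu> \<nu>)"
      using n unfolding log_energy_eq[OF \<nu> E] a_def by simp
    then obtain x where x: "cen \<nu> \<nu> = ennreal x" "0 \<le> x"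
      by (cases "cen \<nu> \<nu>") auto
    then have xl: "x < 2 * a - c" using n' by (simp add: enn2ereal_ennreal)
    have "cen \<nu> \<nu> + cen \<omega> \<omega> = ennreal (x + (b + b - c))"
      unfolding cen(1)[OF \<omega>] x(1) b_def using x cen(2)[OF \<omega>] by (subst ennreal_plus) auto
    also have "\<dots> \<le> ennreal (2 * (a + b - c))" using xl by (intro ennreal_leI) simp
    also have "\<dots> = 2 * cen \<nu> \<omega>"
    proof -
      have eq: "cen \<nu> \<omega> = cen \<omega> \<nu>"
        using prob_measures_onD[OF \<nu> compact_imp_closed[OF E]] prob_measures_onD[OF \<omega> compact_imp_closed[OF E]]
        by (intro cen_commute)
      have "ennreal (2 * x) = 2 * ennreal x" if "0 \<le> x" for x using that by (simp add: ennreal_mult)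
      then show ?thesis unfolding eq cen(1)[OF \<nu>] a_def b_def using cen(2)[OF \<nu>] by blast
    qed
    finally have "\<nu> = \<omega>"
      using cen(1)[OF \<omega>] x by (intro cen_parallelogram_unique[OF \<nu> E \<omega> E]) auto
    then show False using n en by simp
  qed
  have "equilibrium_measure E = \<omega>" by (rule equilibrium_measure_eqI[OF E \<omega> en max])
  then show "equilibrium_measure E \<in> prob_measures_on E"
    "\<And>z. log_potential (equilibrium_measure E) z =
      ereal ((ln (max r (cmod (poly p z))) - ln (cmod (lead_coeff p))) / degree p)"
    using \<omega> pot by auto
qed

section \<open>Frostman's theorem\<close>

text \<open>Harmonicity in the form used below. The series of Ln (1 - (z - z0) / (w - z0)) converges
  uniformly for w in \<open>C\<close> and is integrated term by term into a power series in z -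
  z0.\<close>

lemma lpot_local_Re_holomorphic:
  assumes \<mu>: "\<mu> \<in> prob_measures_on C" "compact C" and disj: "ball z0 \<rho> \<inter> C = {}" and \<rho>: "\<rho> > 0"
  obtains f where "f holomorphic_on ball z0 \<rho>" "\<And>z. z \<in> ball z0 \<rho> \<Longrightarrow> lpot \<mu> z = Re (f z)"
proof -
  note D = prob_measures_onD[OF \<mu>(1) compact_imp_closed[OF \<mu>(2)]]
  interpret prob_space \<mu> by (rule D)
  have z0C: "z0 \<notin> C" using disj \<rho> by (metis centre_in_ball disjoint_iff)
  have wge: "\<rho> \<le> cmod (w - z0)" if "w \<in> C" for w
  proof -
    have "w \<notin> ball z0 \<rho>" using disj that by blast
    then show ?thesis by (simp add: dist_norm norm_minus_commute)
  qed
  \<comment> \<open>For n = 0 division by zero gives 0, so the sum effectively starts at n = 1, as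
    the logarithmic series does.\<close>
  define G where "G z n w = ((z - z0) / (w - z0)) ^ n / of_nat n" for z w :: complex and n :: nat
  define a where "a n = (\<integral>w. (1 / (w - z0)) ^ n / of_nat n \<partial>\<mu>)" for n :: nat
  have Gi: "integrable \<mu> (G z n)" for z n
    unfolding G_def
  proof (rule integrable_continuous_compact[OF \<mu>])
    show "continuous_on C (\<lambda>w. ((z - z0) / (w - z0)) ^ n / of_nat n)"
      using z0C by (cases "n = 0") (auto intro!: continuous_intros)
  qed measurable
  have Ga: "(\<integral>w. G z n w \<partial>\<mu>) = a n * (z - z0) ^ n" for z n
  proof -
    have "G z n w = (1 / (w - z0)) ^ n / of_nat n * (z - z0) ^ n" for w
      unfolding G_def by (simp add: power_divide)
    then show ?thesis unfolding a_def by simp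
  qed
  have l0: "integrable \<mu> (\<lambda>w. ln (cmod (z0 - w)))" by (rule log_potential_off(1)[OF \<mu> z0C])
  have main: "(\<lambda>n. a n * (z - z0) ^ n) sums (\<integral>w. (\<Sum>n. G z n w) \<partial>\<mu>) \<and> lpot \<mu> z = lpot \<mu> z0 - Re (\<integral>w. (\<Sum>n. G z n w) \<partial>\<mu>)"
    if z: "z \<in> ball z0 \<rho>" for z
  proof -
    define q where "q = cmod (z - z0) / \<rho>"
    have q: "0 \<le> q" "q < 1" unfolding q_def using z \<rho> by (auto simp: dist_norm norm_minus_commute)
    have x: "cmod ((z - z0) / (w - z0)) \<le> q" if "w \<in> C" for w
      unfolding norm_divide q_def using wge[OF that] \<rho> by (intro divide_left_mono mult_pos_pos) auto
    have Gn: "norm (G z n w) \<le> q ^ n" if "w \<in> C" for n w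
    proof -
      have "norm (G z n w) = cmod ((z - z0) / (w - z0)) ^ n / real n"
        unfolding G_def by (simp add: norm_divide norm_power)
      also have "\<dots> \<le> cmod ((z - z0) / (w - z0)) ^ n"
        by (cases "n = 0") (auto simp: divide_le_eq mult_le_cancel_left1 intro: mult_left_le_one_le)
      also have "\<dots> \<le> q ^ n" by (intro power_mono x that) auto
      finally show ?thesis .
    qed
    have sq: "summable (\<lambda>n. q ^ n)" using q by (intro summable_geometric) auto
    have s1: "AE w in \<mu>. summable (\<lambda>n. norm (G z n w))"
      using D(4)
    proof eventually_elim
      case (elim w)
      show ?case by (rule summable_comparison_test'[OF sq]) (use Gn[OF elim] in auto)
    qed
    have s2: "summable (\<lambda>n. \<integral>w. norm (G z n w) \<partial>\<mu>)"
    proof (rule summable_comparison_test'[OF sq])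
      fix n
      have "(\<integral>w. norm (G z n w) \<partial>\<mu>) \<le> (\<integral>w. q ^ n \<partial>\<mu>)"
      proof (rule integral_mono_AE)
        show "AE w in \<mu>. norm (G z n w) \<le> q ^ n" using D(4) by eventually_elim (rule Gn)
      qed (use Gi in auto)
      then show "norm (\<integral>w. norm (G z n w) \<partial>\<mu>) \<le> q ^ n"
        by (simp add: prob_space Bochner_Integration.integral_nonneg)
    qed
    have sums: "(\<lambda>n. a n * (z - z0) ^ n) sums (\<integral>w. (\<Sum>n. G z n w) \<partial>\<mu>)"
      using sums_integral[OF Gi s1 s2] unfolding Ga .
    have Si: "integrable \<mu> (\<lambda>w. \<Sum>n. G z n w)" by (rule integrable_suminf[OF Gi s1 s2])
    have pt: "ln (cmod (z - w)) = ln (cmod (z0 - w)) - Re (\<Sum>n. G z n w)" if w: "w \<in> C" for w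
    proof -
      have wz: "w - z0 \<noteq> 0" using w z0C by auto
      define u where "u = (z - z0) / (w - z0)"
      have u: "cmod u < 1" using x[OF w] q unfolding u_def by linarith
      have "(\<lambda>n. - (u ^ n / of_nat n)) sums Ln (1 - u)"
        using Ln_series'[of "- u"] u by simp
      then have "(\<lambda>n. G z n w) sums (- Ln (1 - u))"
        unfolding G_def u_def[symmetric] using sums_minus by fastforce
      then have S: "(\<Sum>n. G z n w) = - Ln (1 - u)" by (rule sums_unique[symmetric])
      have u1: "1 - u \<noteq> 0" using u by auto
      have "z - w = (z0 - w) * (1 - u)" unfolding u_def using wz by (simp add: field_simps)
      then have "ln (cmod (z - w)) = ln (cmod (z0 - w)) + ln (cmod (1 - u))"
        using wz u1 by (simp add: norm_mult ln_mult)
      then show ?thesis unfolding S using u1 by simp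
    qed
    have "lpot \<mu> z = (\<integral>w. ln (cmod (z0 - w)) - Re (\<Sum>n. G z n w) \<partial>\<mu>)"
      unfolding lpot_def
    proof (rule integral_cong_AE)
      show "AE w in \<mu>. ln (cmod (z - w)) = ln (cmod (z0 - w)) - Re (\<Sum>n. G z n w)"
        using D(4) by eventually_elim (rule pt)
      show "(\<lambda>w. ln (cmod (z - w))) \<in> borel_measurable \<mu>" using D(2) by (simp cong: measurable_cong_sets)
      show "(\<lambda>w. ln (cmod (z0 - w)) - Re (\<Sum>n. G z n w)) \<in> borel_measurable \<mu>"
        using l0 Si by (intro borel_measurable_diff) auto
    qed
    also have "\<dots> = lpot \<mu> z0 - Re (\<integral>w. (\<Sum>n. G z n w) \<partial>\<mu>)"
      unfolding lpot_def using l0 Si by simp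
    finally show ?thesis using sums by blast
  qed
  define f where "f z = complex_of_real (lpot \<mu> z0) - (\<integral>w. (\<Sum>n. G z n w) \<partial>\<mu>)" for z
  show thesis
  proof (rule that[of f])
    have "(\<lambda>z. \<integral>w. (\<Sum>n. G z n w) \<partial>\<mu>) holomorphic_on ball z0 \<rho>"
      by (rule power_series_holomorphic[where a=a]) (rule conjunct1[OF main])
    then show "f holomorphic_on ball z0 \<rho>"
      unfolding f_def by (intro holomorphic_intros)
    show "lpot \<mu> z = Re (f z)" if "z \<in> ball z0 \<rho>" for z
      using main[OF that] unfolding f_def by simp
  qed
qed

lemma lpot_continuous_off:
  assumes \<mu>: "\<mu> \<in> prob_measures_on C" "compact C"
  shows "continuous_on (- C) (lpot \<mu>)"
proof (rule continuous_at_imp_continuous_on, intro ballI)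
  fix z assume "z \<in> - C"
  moreover have "open (- C)" using \<mu> by (simp add: compact_imp_closed open_Compl)
  ultimately obtain \<rho> where \<rho>: "\<rho> > 0" "ball z \<rho> \<subseteq> - C" using openE by blast
  then have "ball z \<rho> \<inter> C = {}" by auto
  from lpot_local_Re_holomorphic[OF \<mu> this \<rho>(1)] obtain f
    where f: "f holomorphic_on ball z \<rho>" "\<And>w. w \<in> ball z \<rho> \<Longrightarrow> lpot \<mu> w = Re (f w)" by blast
  have "continuous_on (ball z \<rho>) (\<lambda>w. Re (f w))"
    by (intro continuous_intros holomorphic_on_imp_continuous_on f)
  then have "continuous_on (ball z \<rho>) (lpot \<mu>)"
    by (rule continuous_on_eq) (simp add: f)
  then show "isCont (lpot \<mu>) z" using \<rho>(1) by (simp add: continuous_on_eq_continuous_at)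
qed

text \<open>For nonconstant \<open>f\<close> the open mapping theorem would put f x - e / 2 into the
  image of \<open>U\<close>. The minimum is local, on \<open>U\<close>, while constancy holds on all
  of \<open>B\<close>; so the lemma also serves as an identity theorem.\<close>

lemma holomorphic_Re_min_constant:
  assumes f: "f holomorphic_on B" "open B" "connected B" and U: "open U" "U \<subseteq> B" "x \<in> U"
    and min: "\<And>y. y \<in> U \<Longrightarrow> Re (f x) \<le> Re (f y)" and y: "y \<in> B"
  shows "f y = f x"
proof (rule ccontr)
  assume n: "f y \<noteq> f x"
  have "\<not> f constant_on B"
    unfolding constant_on_def using n y U by (metis subsetD)
  then have "open (f ` U)" using f U by (intro open_mapping_thm[where S=B]) auto
  then obtain e where e: "e > 0" "ball (f x) e \<subseteq> f ` U" using U(3) openE by (metis imageI)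
  have "f x - of_real (e / 2) \<in> ball (f x) e" using e by (simp add: dist_norm)
  then obtain w where w: "w \<in> U" "f w = f x - of_real (e / 2)" using e by (metis imageE subsetD)
  then show False using min[OF w(1)] e by simp
qed

text \<open>Unique continuation along the connected set \<open>- C\<close>. On a ball the difference
  is the real part of a holomorphic function; where it vanishes on a smaller ball it is trivially
  minimal, so that function is constant.\<close>

lemma lpot_identity:
  assumes \<mu>: "\<mu> \<in> prob_measures_on C" and \<nu>: "\<nu> \<in> prob_measures_on C" and C: "compact C" "connected (- C)"
    and eq: "\<And>z. cmod z \<ge> R \<Longrightarrow> lpot \<mu> z = lpot \<nu> z" and z: "z \<in> - C"
  shows "lpot \<mu> z = lpot \<nu> z"
proof -
  define u where "u z = lpot \<mu> z - lpot \<nu> z" for z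
  have oC: "open (- C)" using C by (simp add: compact_imp_closed open_Compl)
  obtain R' where R': "R' > 0" "\<And>z. z \<in> C \<Longrightarrow> cmod z < R'"
    using compact_imp_bounded[OF C(1)] unfolding bounded_pos_less by blast
  define P where "P z \<longleftrightarrow> (\<exists>e>0. \<forall>w\<in>ball z e. u w = 0)" for z
  define a where "a = complex_of_real (max R R' + 1)"
  have ca: "cmod a = max R R' + 1" unfolding a_def norm_of_real using R'(1) by simp
  have far: "cmod w \<ge> max R R'" if "w \<in> ball a 1" for w
  proof -
    have "cmod a - cmod w \<le> cmod (a - w)" by (rule norm_triangle_ineq2)
    then show ?thesis using that ca unfolding mem_ball dist_norm by linarith
  qed
  have Pa: "P a" unfolding P_def u_def
    by (rule exI[of _ 1]) (use far eq in auto)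
  have aC: "a \<in> - C" using R'(2)[of a] ca by auto
  have "P z"
  proof (rule connected_induction_simple[where P=P, OF C(2) aC z Pa])
    fix b assume "b \<in> - C"
    then obtain \<rho> where \<rho>: "\<rho> > 0" "ball b \<rho> \<subseteq> - C" using oC openE by blast
    then have disj: "ball b \<rho> \<inter> C = {}" by auto
    obtain f where f: "f holomorphic_on ball b \<rho>" "\<And>w. w \<in> ball b \<rho> \<Longrightarrow> lpot \<mu> w = Re (f w)"
      using lpot_local_Re_holomorphic[OF \<mu> C(1) disj \<rho>(1)] by blast
    obtain g where g: "g holomorphic_on ball b \<rho>" "\<And>w. w \<in> ball b \<rho> \<Longrightarrow> lpot \<nu> w = Re (g w)"
      using lpot_local_Re_holomorphic[OF \<nu> C(1) disj \<rho>(1)] by blast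
    have h: "(\<lambda>w. f w - g w) holomorphic_on ball b \<rho>" by (intro holomorphic_intros f g)
    have spread: "P y" if x: "x \<in> ball b \<rho>" and y: "y \<in> ball b \<rho>" and Px: "P x" for x y
    proof -
      obtain e where e: "e > 0" "\<And>w. w \<in> ball x e \<Longrightarrow> u w = 0" using Px unfolding P_def by blast
      have uRe: "u w = Re (f w - g w)" if "w \<in> ball b \<rho>" for w
        unfolding u_def f(2)[OF that] g(2)[OF that] by simp
      have ux: "u x = 0" using e by simp
      have fg: "f w - g w = f x - g x" if "w \<in> ball b \<rho>" for w
      proof (rule holomorphic_Re_min_constant[OF h])
        show "open (ball x e \<inter> ball b \<rho>)" by (intro open_Int) auto
        show "x \<in> ball x e \<inter> ball b \<rho>" using e x by auto
        fix v assume "v \<in> ball x e \<inter> ball b \<rho>"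
        then show "Re (f x - g x) \<le> Re (f v - g v)"
          using e(2)[of v] ux uRe[of v] uRe[OF x] by auto
      qed (use that in auto)
      then have "u w = 0" if "w \<in> ball b \<rho>" for w
        using uRe[OF that] uRe[OF x] ux fg[OF that] by simp
      then have z: "\<forall>w\<in>ball b \<rho>. u w = 0" by blast
      obtain d where d: "d > 0" "ball y d \<subseteq> ball b \<rho>"
        by (rule openE[OF open_ball y])
      have "\<forall>w\<in>ball y d. u w = 0" using z d(2) by (meson subsetD)
      then show ?thesis unfolding P_def using d(1) by (intro exI[of _ d] conjI)
    qed
    show "\<exists>T. openin (top_of_set (- C)) T \<and> b \<in> T \<and> (\<forall>x\<in>T. \<forall>y\<in>T. P x \<longrightarrow> P y)"
    proof (intro exI[of _ "ball b \<rho>"] conjI ballI impI)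
      show "openin (top_of_set (- C)) (ball b \<rho>)" using \<rho> oC by (simp add: openin_open_eq)
      show "b \<in> ball b \<rho>" using \<rho> by simp
    qed (rule spread)
  qed
  then show ?thesis unfolding P_def u_def by auto
qed

text \<open>By Lindelof, countably many of the null balls already cover \<open>W\<close>.\<close>

lemma AE_notin_if_locally_null:
  fixes W :: "complex set"
  assumes "\<And>z. z \<in> W \<Longrightarrow> \<exists>e>0. AE w in \<mu>. w \<notin> ball z e"
  shows "AE w in \<mu>. w \<notin> W"
proof -
  define F where "F = {ball z e | z e. AE w in \<mu>. w \<notin> ball z e}"
  have "\<And>S. S \<in> F \<Longrightarrow> open S" unfolding F_def by auto
  from Lindelof[OF this] obtain F' where F': "F' \<subseteq> F" "countable F'" "\<Union>F' = \<Union>F" by blast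
  have "\<forall>S\<in>F'. AE w in \<mu>. w \<notin> S" using F'(1) unfolding F_def by auto
  then have "AE w in \<mu>. \<forall>S\<in>F'. w \<notin> S" using F'(2) by (simp add: AE_ball_countable)
  moreover have "W \<subseteq> \<Union>F"
  proof
    fix z assume "z \<in> W"
    then obtain e where "e > 0" "AE w in \<mu>. w \<notin> ball z e" using assms by blast
    then show "z \<in> \<Union>F" unfolding F_def by (intro UnionI[of "ball z e"]) auto
  qed
  ultimately show ?thesis using F'(3) by (auto elim!: eventually_mono)
qed

lemma lpot_lower_bound_far:
  assumes \<mu>: "\<mu> \<in> prob_measures_on (cball 0 R)" and d: "d > 0" and z: "cmod z \<ge> R + d"
  shows "lpot \<mu> z \<ge> ln d"
proof -
  note D = prob_measures_onD[OF \<mu> closed_cball]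
  interpret prob_space \<mu> by (rule D)
  have zn: "z \<notin> cball 0 R" using z d by auto
  have "(\<integral>w. ln d \<partial>\<mu>) \<le> lpot \<mu> z"
    unfolding lpot_def
  proof (rule integral_mono_AE)
    show "integrable \<mu> (\<lambda>w. ln (cmod (z - w)))" by (rule log_potential_off(1)[OF \<mu> compact_cball zn])
    show "AE w in \<mu>. ln d \<le> ln (cmod (z - w))"
      using D(4)
    proof eventually_elim
      case (elim w)
      have "d \<le> cmod (z - w)" using norm_triangle_ineq2[of z w] z elim by auto
      then show ?case using d by (simp add: ln_mono)
    qed
  qed auto
  then show ?thesis by (simp add: prob_space)
qed

lemma lpot_measurable:
  assumes "prob_space \<mu>" "sets \<mu> = sets borel"
  shows "lpot \<mu> \<in> borel_measurable borel"
proof -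
  interpret prob_space \<mu> by fact
  have "(\<lambda>p. ln (cmod (fst p - snd p))) \<in> borel_measurable (borel \<Otimes>\<^sub>M borel)" by measurable
  then have "(\<lambda>(z, w). ln (cmod (z - w))) \<in> borel_measurable (borel \<Otimes>\<^sub>M \<mu>)"
    using assms(2) by (simp add: split_beta' cong: measurable_cong_sets sets_pair_measure_cong)
  from borel_measurable_lebesgue_integral[OF this]
  show ?thesis unfolding lpot_def by simp
qed

text \<open>Reciprocity of potentials. Passing through the symmetric nonnegative energy
  \<open>cen\<close> makes integrability of the second potential a conclusion, drawn from that of
  the first.\<close>

lemma lpot_swap:
  assumes \<mu>: "\<mu> \<in> prob_measures_on C" "compact C" and \<nu>: "\<nu> \<in> prob_measures_on D" "compact D"
    and v: "AE z in \<mu>. log_potential \<nu> z = ereal (v z)" "integrable \<mu> v"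
  shows "integrable \<nu> (lpot \<mu>)" "(\<integral>z. lpot \<mu> z \<partial>\<nu>) = (\<integral>z. v z \<partial>\<mu>)"
    "AE z in \<nu>. log_potential \<mu> z = ereal (lpot \<mu> z)"
proof -
  note Dm = prob_measures_onD[OF \<mu>(1) compact_imp_closed[OF \<mu>(2)]]
  note Dn = prob_measures_onD[OF \<nu>(1) compact_imp_closed[OF \<nu>(2)]]
  interpret prob_space \<nu> by (rule Dn)
  note c = cen_of_log_potential[OF \<nu> \<mu> v]
  have fin: "(\<integral>\<^sup>+z. cpot \<mu> z \<partial>\<nu>) \<noteq> \<infinity>"
    using c(1) cen_commute[OF Dm(1,2) Dn(1,2)] unfolding cen_def by simp
  have m: "cpot \<mu> \<in> borel_measurable \<nu>"
    using cpot_measurable[OF Dm(1,2)] Dn(2) by (simp cong: measurable_cong_sets)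
  have lm: "lpot \<mu> \<in> borel_measurable \<nu>"
    using lpot_measurable[OF Dm(1,2)] Dn(2) by (simp cong: measurable_cong_sets)
  have "AE z in \<nu>. cpot \<mu> z \<noteq> \<infinity>" by (rule nn_integral_PInf_AE[OF m fin])
  then show ae: "AE z in \<nu>. log_potential \<mu> z = ereal (lpot \<mu> z)"
  proof eventually_elim
    case (elim z)
    then have "log_potential \<mu> z \<noteq> -\<infinity>" unfolding log_potential_eq[OF \<mu>] by (cases "cpot \<mu> z") auto
    then show ?case by (rule log_potential_finiteD(3)[OF \<mu>])
  qed
  have l: "integrable \<nu> lwt" by (rule integrable_lwt[OF \<nu>])
  define L where "L = (\<integral>w. lwt w \<partial>\<mu>)"
  have cp: "AE z in \<nu>. cpot \<mu> z = ennreal (lwt z + L - lpot \<mu> z)" "AE z in \<nu>. 0 \<le> lwt z + L - lpot \<mu> z"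
    unfolding L_def
    subgoal using ae by eventually_elim (rule cpot_of_log_potential(1)[OF \<mu>])
    subgoal using ae by eventually_elim (rule cpot_of_log_potential(2)[OF \<mu>])
    done
  have "integrable \<nu> (\<lambda>z. lwt z + L - lpot \<mu> z)"
  proof (rule integrableI_nonneg)
    show "(\<lambda>z. lwt z + L - lpot \<mu> z) \<in> borel_measurable \<nu>" using l lm by measurable
    show "AE z in \<nu>. 0 \<le> lwt z + L - lpot \<mu> z" by (rule cp)
    have "(\<integral>\<^sup>+z. ennreal (lwt z + L - lpot \<mu> z) \<partial>\<nu>) = (\<integral>\<^sup>+z. cpot \<mu> z \<partial>\<nu>)"
      by (rule nn_integral_cong_AE) (use cp(1) in \<open>auto elim: eventually_mono\<close>)
    then show "(\<integral>\<^sup>+z. ennreal (lwt z + L - lpot \<mu> z) \<partial>\<nu>) < \<infinity>"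
      using fin by (simp add: top.not_eq_extremum)
  qed
  moreover have "integrable \<nu> (\<lambda>z. lwt z + L)" using l by simp
  ultimately have "integrable \<nu> (\<lambda>z. (lwt z + L) - (lwt z + L - lpot \<mu> z))"
    using Bochner_Integration.integrable_diff by blast
  then show i: "integrable \<nu> (lpot \<mu>)" by simp
  note d = cen_of_log_potential[OF \<mu> \<nu> ae i]
  show "(\<integral>z. lpot \<mu> z \<partial>\<nu>) = (\<integral>z. v z \<partial>\<mu>)"
  proof -
    have "ennreal ((\<integral>w. lwt w \<partial>\<mu>) + (\<integral>w. lwt w \<partial>\<nu>) - (\<integral>z. v z \<partial>\<mu>))
        = ennreal ((\<integral>w. lwt w \<partial>\<nu>) + (\<integral>w. lwt w \<partial>\<mu>) - (\<integral>z. lpot \<mu> z \<partial>\<nu>))"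
      using c(1) d(1) cen_commute[OF Dm(1,2) Dn(1,2)] by simp
    then have "(\<integral>w. lwt w \<partial>\<mu>) + (\<integral>w. lwt w \<partial>\<nu>) - (\<integral>z. v z \<partial>\<mu>)
        = (\<integral>w. lwt w \<partial>\<nu>) + (\<integral>w. lwt w \<partial>\<mu>) - (\<integral>z. lpot \<mu> z \<partial>\<nu>)"
      by (subst (asm) ennreal_inj[OF c(2) d(2)])
    then show ?thesis by linarith
  qed
qed

section \<open>The equilibrium potential on the carrier\<close>

lemma uniform_measure_on:
  assumes \<omega>: "\<omega> \<in> prob_measures_on C" "closed C" and A: "A \<in> sets borel" "measure \<omega> A > 0"
  shows "uniform_measure \<omega> A \<in> prob_measures_on C"
proof -
  note D = prob_measures_onD[OF \<omega>]
  interpret prob_space \<omega> by (rule D)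
  have e: "emeasure \<omega> A \<noteq> 0" "emeasure \<omega> A \<noteq> \<infinity>" using A(2) by (auto simp: emeasure_eq_measure)
  show ?thesis
  proof (rule prob_measures_onI[OF _ _ \<omega>(2)])
    show "prob_space (uniform_measure \<omega> A)" using e by (rule prob_space_uniform_measure)
    show "sets (uniform_measure \<omega> A) = sets borel" using D(2) by simp
    show "AE x in uniform_measure \<omega> A. x \<in> C"
      by (rule AE_uniform_measureI) (use A D in \<open>auto elim: eventually_mono\<close>)
  qed
qed

lemma nn_integral_uniform_measure_le:
  assumes \<omega>: "prob_space \<omega>" "sets \<omega> = sets borel" and A: "A \<in> sets borel" and f: "f \<in> borel_measurable borel"
  shows "(\<integral>\<^sup>+z. f z \<partial>uniform_measure \<omega> A) \<le> (\<integral>\<^sup>+z. f z \<partial>\<omega>) / emeasure \<omega> A"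
proof -
  have "f \<in> borel_measurable \<omega>" "A \<in> sets \<omega>" using assms by (simp_all cong: measurable_cong_sets)
  then have "(\<integral>\<^sup>+z. f z \<partial>uniform_measure \<omega> A) = (\<integral>\<^sup>+z. f z * indicator A z \<partial>\<omega>) / emeasure \<omega> A"
    by (rule nn_integral_uniform_measure)
  also have "\<dots> \<le> (\<integral>\<^sup>+z. f z \<partial>\<omega>) / emeasure \<omega> A"
    by (intro divide_right_mono_ennreal nn_integral_mono) (auto split: split_indicator)
  finally show ?thesis .
qed

text \<open>The first variation of the energy at \<omega> towards \<tau>: the derivative at t = 0
  cannot be positive. In logarithmic terms, the mutual energy of \<tau> and \<omega> is at most the
  energy of \<omega>.\<close>

lemma log_energy_maximizer_variation:
  assumes C: "compact C" and \<omega>: "\<omega> \<in> prob_measures_on C" and \<tau>: "\<tau> \<in> prob_measures_on C"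
    and max: "\<And>\<nu>. \<nu> \<in> prob_measures_on C \<Longrightarrow> log_energy \<nu> \<le> log_energy \<omega>"
    and cen: "cen \<tau> \<tau> = ennreal x" "cen \<tau> \<omega> = ennreal y" "cen \<omega> \<omega> = ennreal z"
    and nn: "0 \<le> x" "0 \<le> y" "0 \<le> z"
  shows "(\<integral>w. lwt w \<partial>\<tau>) - y \<le> (\<integral>w. lwt w \<partial>\<omega>) - z"
proof -
  define M L where "M = (\<integral>w. lwt w \<partial>\<tau>)" and "L = (\<integral>w. lwt w \<partial>\<omega>)"
  have e: "log_energy \<omega> = ereal (2 * L - z)"
    unfolding log_energy_eq[OF \<omega> C] cen L_def using nn by (simp add: enn2ereal_ennreal)
  have le: "2 * (M - L - y + z) \<le> t * (x - 2 * y + z)" if t: "0 < t" "t \<le> 1" for t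
  proof -
    have t': "0 \<le> t" "t \<le> 1" using t by auto
    have "2 * (t * M + (1 - t) * L) - (t\<^sup>2 * x + 2 * t * (1 - t) * y + (1 - t)\<^sup>2 * z) \<le> 2 * L - z"
      using max[OF mixture_on[OF \<tau> \<omega> compact_imp_closed[OF C] t']]
      unfolding log_energy_mixture[OF \<tau> \<omega> C cen nn t'] e M_def L_def by simp
    then have "t * (2 * (M - L - y + z)) \<le> t * (t * (x - 2 * y + z))"
      by (simp add: power2_eq_square algebra_simps)
    then show ?thesis using t by simp
  qed
  have "((\<lambda>t. t * (x - 2 * y + z)) \<longlongrightarrow> 0 * (x - 2 * y + z)) (at_right 0)"
    by (intro tendsto_intros)
  moreover have "eventually (\<lambda>t. 2 * (M - L - y + z) \<le> t * (x - 2 * y + z)) (at_right (0::real))"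
    unfolding eventually_at_right_field using le by (intro exI[of _ 1]) auto
  ultimately have "2 * (M - L - y + z) \<le> 0 * (x - 2 * y + z)"
    by (intro tendsto_lowerbound) auto
  then show ?thesis unfolding M_def L_def by simp
qed

text \<open>If the potential exceeded \<open>c\<close> on a set of positive measure, shifting mass
  to \<omega> conditioned on that set would raise the energy to first order. Hence it is at most
  \<open>c\<close> almost everywhere, and equality follows because its mean is
  \<open>c\<close>.\<close>

lemma equilibrium_potential_AE:
  assumes C: "compact C" and \<omega>: "\<omega> \<in> prob_measures_on C" and e: "log_energy \<omega> = ereal c"
    and max: "\<And>\<nu>. \<nu> \<in> prob_measures_on C \<Longrightarrow> log_energy \<nu> \<le> ereal c"
  shows "AE z in \<omega>. log_potential \<omega> z = ereal c"
proof -
  have cl: "closed C" using C by (rule compact_imp_closed)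
  note D = prob_measures_onD[OF \<omega> cl]
  interpret prob_space \<omega> by (rule D)
  define L where "L = (\<integral>w. lwt w \<partial>\<omega>)"
  have X: "cen \<omega> \<omega> = ennreal (2 * L - c)" "0 \<le> 2 * L - c"
    using cen_eq_of_log_energy[OF \<omega> C e] unfolding L_def .
  have cm: "cpot \<omega> \<in> borel_measurable borel" by (rule cpot_measurable[OF D(1,2)])
  have cm': "cpot \<omega> \<in> borel_measurable \<omega>" using cm D(2) by (simp cong: measurable_cong_sets)
  define g where "g z = enn2real (cpot \<omega> z)" for z
  have gm: "g \<in> borel_measurable borel" unfolding g_def using cm by measurable
  have g0: "0 \<le> g z" for z unfolding g_def by simp
  have finae: "AE z in \<omega>. cpot \<omega> z \<noteq> \<infinity>"
    by (rule nn_integral_PInf_AE[OF cm']) (use X(1) in \<open>simp add: cen_def\<close>)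
  have l: "integrable \<omega> lwt" by (rule integrable_lwt[OF \<omega> C])
  have main: "integrable \<rho> g \<and> cen \<omega> \<rho> = ennreal (\<integral>z. g z \<partial>\<rho>)"
    if \<rho>: "\<rho> \<in> prob_measures_on C" and ae: "AE z in \<rho>. cpot \<omega> z \<noteq> \<infinity>" and fin: "cen \<omega> \<rho> \<noteq> \<infinity>" for \<rho>
  proof -
    note Dr = prob_measures_onD[OF \<rho> cl]
    have eq: "AE z in \<rho>. cpot \<omega> z = ennreal (g z)"
      using ae by eventually_elim (simp add: g_def top.not_eq_extremum)
    have n: "cen \<omega> \<rho> = (\<integral>\<^sup>+z. ennreal (g z) \<partial>\<rho>)"
      unfolding cen_def by (rule nn_integral_cong_AE[OF eq])
    have i: "integrable \<rho> g"
    proof (rule integrableI_nonneg)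
      show "g \<in> borel_measurable \<rho>" using gm Dr(2) by (simp cong: measurable_cong_sets)
      show "(\<integral>\<^sup>+z. ennreal (g z) \<partial>\<rho>) < \<infinity>" using fin n by (simp add: top.not_eq_extremum)
    qed (simp add: g0)
    then show ?thesis unfolding n by (simp add: nn_integral_eq_integral g0)
  qed
  have gi: "integrable \<omega> g" and gI: "(\<integral>z. g z \<partial>\<omega>) = 2 * L - c"
  proof -
    have "cen \<omega> \<omega> \<noteq> \<infinity>" using X(1) by simp
    from main[OF \<omega> finae this] show "integrable \<omega> g" and "(\<integral>z. g z \<partial>\<omega>) = 2 * L - c"
      using X by (auto simp: Bochner_Integration.integral_nonneg g0)
  qed
  \<comment> \<open>As the potential is lwt z + L - g z where finite, this is the set where it
    exceeds \<open>c\<close>.\<close>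
  define A where "A = {z. lwt z - g z > c - L}"
  have Am: "A \<in> sets borel" unfolding A_def using gm by measurable
  have "measure \<omega> A = 0"
  proof (rule ccontr)
    assume "measure \<omega> A \<noteq> 0"
    then have a: "measure \<omega> A > 0" using measure_nonneg[of \<omega> A] by linarith
    define \<tau> where "\<tau> = uniform_measure \<omega> A"
    have \<tau>: "\<tau> \<in> prob_measures_on C" unfolding \<tau>_def by (rule uniform_measure_on[OF \<omega> cl Am a])
    note Dt = prob_measures_onD[OF \<tau> cl]
    interpret t: prob_space \<tau> by (rule Dt)
    have ae: "emeasure \<omega> A \<noteq> 0" using a by (auto simp: emeasure_eq_measure)
    \<comment> \<open>Conditioning multiplies densities by at most 1 / \<omega>(A), so the energies
      that involve \<tau> stay finite.\<close>
    have finle: "u / emeasure \<omega> A \<noteq> \<infinity>" if "u \<noteq> \<infinity>" for u :: ennreal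
      using that ae by (simp add: ennreal_divide_eq_top_iff)
    have "cen \<omega> \<tau> \<le> cen \<omega> \<omega> / emeasure \<omega> A"
      unfolding cen_def \<tau>_def by (rule nn_integral_uniform_measure_le[OF D(1,2) Am cm])
    then have finJ: "cen \<omega> \<tau> \<noteq> \<infinity>" using finle[of "cen \<omega> \<omega>"] X(1) by (auto simp: top_unique)
    have "cen \<tau> \<tau> = (\<integral>\<^sup>+z. cpot \<tau> z \<partial>uniform_measure \<omega> A)" unfolding cen_def \<tau>_def ..
    also have "\<dots> \<le> cen \<tau> \<omega> / emeasure \<omega> A"
      unfolding cen_def by (rule nn_integral_uniform_measure_le[OF D(1,2) Am cpot_measurable[OF Dt(1,2)]])
    finally have finZ: "cen \<tau> \<tau> \<noteq> \<infinity>"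
      using finle[of "cen \<tau> \<omega>"] finJ cen_commute[OF D(1,2) Dt(1,2)] by (auto simp: top_unique)
    have aet: "AE z in \<tau>. cpot \<omega> z \<noteq> \<infinity>" "AE z in \<tau>. z \<in> A"
      unfolding \<tau>_def using finae Am D(2) by (auto intro!: AE_uniform_measureI elim: eventually_mono)
    note mt = main[OF \<tau> aet(1) finJ]
    obtain x where x: "cen \<tau> \<tau> = ennreal x" "0 \<le> x" using finZ by (cases "cen \<tau> \<tau>") auto
    have max': "log_energy \<nu> \<le> log_energy \<omega>" if "\<nu> \<in> prob_measures_on C" for \<nu>
      using max[OF that] unfolding e .
    have y: "cen \<tau> \<omega> = ennreal (\<integral>z. g z \<partial>\<tau>)" using mt cen_commute[OF D(1,2) Dt(1,2)] by simp
    have gt0: "0 \<le> (\<integral>z. g z \<partial>\<tau>)" by (intro Bochner_Integration.integral_nonneg g0)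
    have le: "(\<integral>w. lwt w \<partial>\<tau>) - (\<integral>z. g z \<partial>\<tau>) \<le> L - (2 * L - c)"
      unfolding L_def[symmetric]
      using log_energy_maximizer_variation[OF C \<omega> \<tau> max' x(1) y X(1) x(2) gt0 X(2)] unfolding L_def .
    have lt: "integrable \<tau> lwt" by (rule integrable_lwt[OF \<tau> C])
    have "(\<integral>z. c - L \<partial>\<tau>) < (\<integral>z. lwt z - g z \<partial>\<tau>)"
    proof (rule t.integral_less_AE_space)
      show "AE z in \<tau>. c - L < lwt z - g z" using aet(2) unfolding A_def by simp
      show "emeasure \<tau> (space \<tau>) \<noteq> 0" by (simp add: t.emeasure_space_1)
    qed (use lt mt in auto)
    then show False using le lt mt by (simp add: t.prob_space)
  qed
  then have "emeasure \<omega> A = 0" by (simp add: emeasure_eq_measure)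
  then have "AE z in \<omega>. z \<notin> A" using Am D(2) by (intro AE_not_in) (auto simp: null_sets_def)
  then have le: "AE z in \<omega>. 0 \<le> (c - L) - (lwt z - g z)"
    by eventually_elim (simp add: A_def)
  have i: "integrable \<omega> (\<lambda>z. (c - L) - (lwt z - g z))" using l gi by simp
  have "(\<integral>z. (c - L) - (lwt z - g z) \<partial>\<omega>) = 0"
    using l gi gI by (simp add: prob_space L_def)
  then have "AE z in \<omega>. (c - L) - (lwt z - g z) = 0"
    using integral_nonneg_eq_0_iff_AE[OF i le] by simp
  with finae show ?thesis
  proof eventually_elim
    case (elim z)
    then have "cpot \<omega> z = ennreal (g z)" by (simp add: g_def top.not_eq_extremum)
    then show ?case
      unfolding log_potential_eq[OF \<omega> C] using elim(2) g0[of z] by (simp add: enn2ereal_ennreal L_def)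
  qed
qed

section \<open>Lower bound for the potential off the support\<close>

text \<open>\<open>S\<close> is the closed support: the union of all null balls is removed, which is
  itself a null set.\<close>

lemma ex_support:
  assumes \<omega>: "\<omega> \<in> prob_measures_on C" and C: "compact C"
  obtains S where "compact S" "S \<subseteq> C" "\<omega> \<in> prob_measures_on S"
    "\<And>z e. z \<in> S \<Longrightarrow> e > 0 \<Longrightarrow> \<not> (AE w in \<omega>. w \<notin> ball z e)"
proof -
  have cl: "closed C" using C by (rule compact_imp_closed)
  note D = prob_measures_onD[OF \<omega> cl]
  define W where "W = {z. \<exists>e>0. AE w in \<omega>. w \<notin> ball z e}"
  have "open W"
  unfolding open_contains_ball
  proof (intro ballI)
    fix z assume "z \<in> W"
    then obtain e where e: "e > 0" "AE w in \<omega>. w \<notin> ball z e" unfolding W_def by blast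
    have "ball z e \<subseteq> W"
    proof
      fix y assume "y \<in> ball z e"
      then obtain d where d: "d > 0" "ball y d \<subseteq> ball z e" by (rule openE[OF open_ball])
      have "AE w in \<omega>. w \<notin> ball y d" using e(2) by eventually_elim (use d(2) in blast)
      then show "y \<in> W" unfolding W_def using d(1) by blast
    qed
    then show "\<exists>e>0. ball z e \<subseteq> W" using e(1) by blast
  qed
  have "AE w in \<omega>. w \<notin> W" by (rule AE_notin_if_locally_null) (simp add: W_def)
  then have ae: "AE w in \<omega>. w \<in> C - W" using D(4) by eventually_elim simp
  have c: "compact (C - W)" using C \<open>open W\<close> by (rule compact_diff)
  show thesis
  proof (rule that[OF c])
    show "\<omega> \<in> prob_measures_on (C - W)"
      by (rule prob_measures_onI[OF D(1,2) compact_imp_closed[OF c] ae])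
    show "\<not> (AE w in \<omega>. w \<notin> ball z e)" if "z \<in> C - W" "e > 0" for z e
      using that unfolding W_def by blast
  qed auto
qed

lemma measure_cball_vanishes:
  assumes \<mu>: "prob_space \<mu>" "sets \<mu> = sets borel" and ae: "AE w in \<mu>. w \<noteq> z" and e: "e > 0"
  obtains d :: real where "d > 0" "measure \<mu> (cball z d) < e"
proof -
  interpret prob_space \<mu> by fact
  have "(\<lambda>n. \<integral>w. indicator (cball z (1 / real (Suc n))) w \<partial>\<mu>) \<longlonglongrightarrow> (\<integral>w. (0::real) \<partial>\<mu>)"
  proof (rule integral_dominated_convergence[where w="\<lambda>_. 1"])
    show "AE w in \<mu>. (\<lambda>n. indicator (cball z (1 / real (Suc n))) w) \<longlonglongrightarrow> (0::real)"
      using ae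
    proof eventually_elim
      case (elim w)
      then have "dist z w > 0" by simp
      then obtain N where N: "1 / real (Suc N) < dist z w" using nat_approx_posE by blast
      have "indicator (cball z (1 / real (Suc n))) w = (0::real)" if "n \<ge> N" for n
      proof -
        have "1 / real (Suc n) \<le> 1 / real (Suc N)" using that by (intro divide_left_mono) auto
        then show ?thesis using N by (simp add: indicator_def)
      qed
      then show ?case by (intro tendsto_eventually) (auto simp: eventually_sequentially)
    qed
    show "indicator (cball z (1 / real (Suc n))) \<in> borel_measurable \<mu>" for n
      using \<mu>(2) by (intro borel_measurable_indicator) simp
  qed (auto simp: indicator_def)
  then have "(\<lambda>n. measure \<mu> (cball z (1 / real (Suc n)))) \<longlonglongrightarrow> 0"
    using \<mu>(2) by simp
  then have "eventually (\<lambda>n. measure \<mu> (cball z (1 / real (Suc n))) < e) sequentially"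
    using e by (rule order_tendstoD(2))
  then obtain n where "measure \<mu> (cball z (1 / real (Suc n))) < e"
    by (auto simp: eventually_sequentially)
  then show thesis using that[of "1 / real (Suc n)"] by simp
qed

text \<open>Replacing \<open>z\<close> by \<open>y\<close> costs at most ln 2 for \<open>w\<close>
  near \<open>z0\<close>, since |y - w| <= 2 |z - w|. For \<open>w\<close> outside the disc of
  radius \<open>d\<close>, where |z - w| > d / 2, ln x <= x - 1 makes the cost proportional to |z -
  z0|.\<close>

lemma ln_cmod_nearest_point:
  fixes z y w z0 :: complex
  assumes near: "cmod (z - y) \<le> cmod (z - w)" "cmod (z - y) \<le> cmod (z - z0)"
    and d: "d > 0" "cmod (z - z0) < d / 2" and ne: "w \<noteq> y" "w \<noteq> z"
  shows "ln (cmod (y - w)) - ln 2 * indicator (cball z0 d) w - 2 * cmod (z - z0) / d \<le> ln (cmod (z - w))"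
proof -
  have tri: "cmod (y - w) \<le> cmod (z - y) + cmod (z - w)"
    using norm_triangle_ineq4[of "z - w" "z - y"] by (simp add: add.commute)
  have pos: "0 < cmod (y - w)" "0 < cmod (z - w)" using ne by auto
  show ?thesis
  proof (cases "w \<in> cball z0 d")
    case True
    have "cmod (y - w) \<le> 2 * cmod (z - w)" using tri near(1) by simp
    then have "ln (cmod (y - w)) \<le> ln (2 * cmod (z - w))" using pos by (simp add: ln_mono)
    also have "\<dots> = ln 2 + ln (cmod (z - w))" using pos by (simp add: ln_mult)
    finally have "ln (cmod (y - w)) - ln 2 \<le> ln (cmod (z - w))" by simp
    moreover have "0 \<le> 2 * cmod (z - z0) / d" using d by simp
    ultimately show ?thesis using True by simp
  next
    case False
    then have "d < cmod (z0 - w)" by (simp add: dist_norm)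
    also have "\<dots> \<le> cmod (z - w) + cmod (z - z0)"
      using norm_triangle_ineq4[of "z - w" "z - z0"] by simp
    finally have zw: "d / 2 < cmod (z - w)" using d by simp
    have "ln (cmod (y - w)) - ln (cmod (z - w)) = ln (cmod (y - w) / cmod (z - w))"
      using pos by (simp add: ln_div)
    also have "\<dots> \<le> cmod (y - w) / cmod (z - w) - 1" using pos by (intro ln_le_minus_one) auto
    also have "\<dots> = (cmod (y - w) - cmod (z - w)) / cmod (z - w)" using pos by (simp add: diff_divide_distrib)
    also have "\<dots> \<le> cmod (z - z0) / cmod (z - w)" using tri near(2) pos by (intro divide_right_mono) auto
    also have "\<dots> \<le> cmod (z - z0) / (d / 2)" using zw d pos by (intro divide_left_mono) auto
    finally show ?thesis using False by (simp add: mult.commute)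
  qed
qed

text \<open>Continuity principle: compare the potential at \<open>z\<close> with that at the point of the support nearest
  to \<open>z\<close>, which at most doubles distances to the support.\<close>

lemma lpot_liminf_at_support:
  assumes S: "compact S" "\<omega> \<in> prob_measures_on S" and ge: "\<And>y. y \<in> S \<Longrightarrow> ereal c \<le> log_potential \<omega> y"
    and z0: "z0 \<in> S" and e: "e > 0"
  obtains r where "r > 0" "\<And>z. z \<in> ball z0 r \<Longrightarrow> z \<notin> S \<Longrightarrow> c - e \<le> lpot \<omega> z"
proof -
  have cl: "closed S" using S(1) by (rule compact_imp_closed)
  note D = prob_measures_onD[OF S(2) cl]
  interpret prob_space \<omega> by (rule D)
  have fin: "log_potential \<omega> y \<noteq> -\<infinity>" if "y \<in> S" for y using ge[OF that] by auto
  note F = log_potential_finiteD[OF S(2,1) fin]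
  \<comment> \<open>The finite potential at \<open>z0\<close> excludes an atom, so a disc of this
    small mass exists, and the loss of ln 2 on it amounts to at most e / 2.\<close>
  have "e / (2 * ln 2) > 0" using e by simp
  then obtain d where d: "d > 0" "measure \<omega> (cball z0 d) < e / (2 * ln 2)"
    using measure_cball_vanishes[OF D(1,2) F(2)[OF z0]] by blast
  then have dm: "ln 2 * measure \<omega> (cball z0 d) \<le> e / 2"
    by (simp add: field_simps)
  \<comment> \<open>The second entry keeps the loss 2 |z - z0| / d outside the disc below e /
    2.\<close>
  define r where "r = min (d / 2) (e * d / 4)"
  have r: "r > 0" unfolding r_def using d e by simp
  show thesis
  proof (rule that[OF r])
    fix z assume z: "z \<in> ball z0 r" and zS: "z \<notin> S"
    have zz: "cmod (z - z0) < d / 2" "cmod (z - z0) < e * d / 4"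
      using z unfolding r_def by (auto simp: dist_norm norm_minus_commute)
    have "S \<noteq> {}" using z0 by blast
    then obtain y where y: "y \<in> S" "\<And>x. x \<in> S \<Longrightarrow> dist z y \<le> dist z x"
      using distance_attains_inf[OF cl] by metis
    note Fy = F[OF y(1)]
    note Fz = log_potential_off[OF S(2,1) zS]
    have ci: "cball z0 d \<in> sets \<omega>" using D(2) by auto
    have "(\<integral>w. ln (cmod (y - w)) - ln 2 * indicator (cball z0 d) w - 2 * cmod (z - z0) / d \<partial>\<omega>) \<le> lpot \<omega> z"
      unfolding lpot_def
    proof (rule integral_mono_AE)
      show "AE w in \<omega>. ln (cmod (y - w)) - ln 2 * indicator (cball z0 d) w - 2 * cmod (z - z0) / d \<le> ln (cmod (z - w))"
        using D(4) Fy(2) Fz(2)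
      proof eventually_elim
        case (elim w)
        then show ?case using y(2)[of w] y(2)[OF z0] d(1) zz
          by (intro ln_cmod_nearest_point) (auto simp: dist_norm)
      qed
      show "integrable \<omega> (\<lambda>w. ln (cmod (y - w)) - ln 2 * indicator (cball z0 d) w - 2 * cmod (z - z0) / d)"
        using Fy(1) ci by (intro Bochner_Integration.integrable_diff) (auto simp: emeasure_eq_measure)
    qed (rule Fz(1))
    also have "(\<integral>w. ln (cmod (y - w)) - ln 2 * indicator (cball z0 d) w - 2 * cmod (z - z0) / d \<partial>\<omega>)
        = lpot \<omega> y - ln 2 * measure \<omega> (cball z0 d) - 2 * cmod (z - z0) / d"
      unfolding lpot_def using Fy(1) ci by (simp add: prob_space emeasure_eq_measure)
    finally have A: "lpot \<omega> y - ln 2 * measure \<omega> (cball z0 d) - 2 * cmod (z - z0) / d \<le> lpot \<omega> z" .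
    have "2 * cmod (z - z0) / d \<le> e / 2" using zz(2) d(1) by (simp add: field_simps)
    moreover have "c \<le> lpot \<omega> y" using ge[OF y(1)] Fy(3) by simp
    ultimately show "c - e \<le> lpot \<omega> z" using A dm by linarith
  qed
qed

text \<open>If the potential fell below \<open>c\<close> at \<open>z\<close>, the set
  \<open>A\<close> of points off \<open>S\<close> with a value at most that at \<open>z\<close>
  would be compact: growth at infinity bounds it, and \<open>lpot_liminf_at_support\<close> keeps it
  away from \<open>S\<close>. A minimum would be attained on it, and local constancy would spread
  that minimum over the plane.\<close>

lemma lpot_minimum_principle:
  assumes S: "compact S" "\<omega> \<in> prob_measures_on S" and ge: "\<And>y. y \<in> S \<Longrightarrow> ereal c \<le> log_potential \<omega> y"
    and z: "z \<notin> S"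
  shows "c \<le> lpot \<omega> z"
proof (rule ccontr)
  assume "\<not> c \<le> lpot \<omega> z"
  then have lt: "lpot \<omega> z < c" by simp
  have cl: "closed S" using S(1) by (rule compact_imp_closed)
  have oS: "open (- S)" using cl by (simp add: open_Compl)
  define A where "A = {y. y \<notin> S \<and> lpot \<omega> y \<le> lpot \<omega> z}"
  have zA: "z \<in> A" unfolding A_def using z by simp
  obtain R where R: "S \<subseteq> cball 0 R"
    using compact_imp_bounded[OF S(1)] unfolding bounded_iff by (auto simp: subset_iff)
  have \<omega>R: "\<omega> \<in> prob_measures_on (cball 0 R)" by (rule prob_measures_on_mono[OF S(2) cl closed_cball R])
  \<comment> \<open>At distance exp c beyond the disc the potential is at least ln (exp c) =
    c.\<close>
  have bd: "A \<subseteq> cball 0 (R + exp c)"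
  proof
    fix y assume y: "y \<in> A"
    show "y \<in> cball 0 (R + exp c)"
    proof (rule ccontr)
      assume "y \<notin> cball 0 (R + exp c)"
      then have "cmod y \<ge> R + exp c" by simp
      from lpot_lower_bound_far[OF \<omega>R exp_gt_zero this] y lt show False unfolding A_def by simp
    qed
  qed
  have cont: "continuous_on (- S) (lpot \<omega>)" by (rule lpot_continuous_off[OF S(2,1)])
  have "open (- A)"
  unfolding open_contains_ball
  proof (intro ballI)
    fix y assume y: "y \<in> - A"
    show "\<exists>e>0. ball y e \<subseteq> - A"
    proof (cases "y \<in> S")
      case True
      obtain r where r: "r > 0" "\<And>x. x \<in> ball y r \<Longrightarrow> x \<notin> S \<Longrightarrow> c - (c - lpot \<omega> z) / 2 \<le> lpot \<omega> x"
        using lpot_liminf_at_support[OF S ge True, of "(c - lpot \<omega> z) / 2"] lt by auto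
      have "x \<in> - A" if "x \<in> ball y r" for x
      proof
        assume "x \<in> A"
        then have "c - (c - lpot \<omega> z) / 2 \<le> lpot \<omega> z" using r(2)[OF that] unfolding A_def by auto
        then show False using lt by (simp add: field_simps)
      qed
      then show ?thesis using r(1) by blast
    next
      case False
      then have gt: "lpot \<omega> z < lpot \<omega> y" using y unfolding A_def by auto
      have o: "open {x \<in> - S. lpot \<omega> z < lpot \<omega> x}"
        using continuous_open_preimage[OF cont oS open_greaterThan[of "lpot \<omega> z"]]
        by (simp add: vimage_def Int_def)
      have y': "y \<in> {x \<in> - S. lpot \<omega> z < lpot \<omega> x}" using gt False by simp
      obtain e where e: "e > 0" "ball y e \<subseteq> {x \<in> - S. lpot \<omega> z < lpot \<omega> x}" by (rule openE[OF o y'])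
      have "{x \<in> - S. lpot \<omega> z < lpot \<omega> x} \<subseteq> - A" unfolding A_def by auto
      then show ?thesis using e by (meson order_trans)
    qed
  qed
  then have clA: "closed A" by (simp add: closed_def)
  have cA: "compact A" using clA bd by (metis bounded_cball bounded_subset compact_eq_bounded_closed)
  have "A \<subseteq> - S" unfolding A_def by auto
  then obtain m where m: "m \<in> A" "\<And>y. y \<in> A \<Longrightarrow> lpot \<omega> m \<le> lpot \<omega> y"
    using continuous_attains_inf[OF cA _ continuous_on_subset[OF cont]] zA by blast
  have mz: "lpot \<omega> m \<le> lpot \<omega> z" using m(2)[OF zA] .
  have minS: "lpot \<omega> m \<le> lpot \<omega> y" if "y \<notin> S" for y
    using that m(2)[of y] mz unfolding A_def by fastforce
  \<comment> \<open>The minimum set is open by \<open>holomorphic_Re_min_constant\<close> and closed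
    in the plane, hence everything, although \<open>A\<close> is bounded.\<close>
  define B where "B = {y \<in> A. lpot \<omega> y \<le> lpot \<omega> m}"
  have "open B"
  unfolding open_contains_ball
  proof (intro ballI)
    fix a assume a: "a \<in> B"
    then have aS: "a \<in> - S" and am: "lpot \<omega> a = lpot \<omega> m"
      using minS unfolding B_def A_def by fastforce+
    obtain \<rho> where \<rho>: "\<rho> > 0" "ball a \<rho> \<subseteq> - S" using openE[OF oS aS] by blast
    have disj: "ball a \<rho> \<inter> S = {}" using \<rho>(2) by blast
    obtain f where f: "f holomorphic_on ball a \<rho>" "\<And>w. w \<in> ball a \<rho> \<Longrightarrow> lpot \<omega> w = Re (f w)"
      using lpot_local_Re_holomorphic[OF S(2,1) disj \<rho>(1)] by blast
    have aB: "a \<in> ball a \<rho>" using \<rho> by simp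
    have "y \<in> B" if y: "y \<in> ball a \<rho>" for y
    proof -
      have "f y = f a"
      proof (rule holomorphic_Re_min_constant[OF f(1) open_ball _ open_ball subset_refl aB _ y])
        show "Re (f a) \<le> Re (f x)" if "x \<in> ball a \<rho>" for x
          using minS[of x] \<rho>(2) that am f(2)[OF that] f(2)[OF aB] by auto
      qed simp
      then have "lpot \<omega> y = lpot \<omega> m" using f(2)[OF y] f(2)[OF aB] am by simp
      then show ?thesis using y \<rho>(2) mz unfolding B_def A_def by auto
    qed
    then show "\<exists>e>0. ball a e \<subseteq> B" using \<rho>(1) by blast
  qed
  moreover have "closed B"
  proof -
    have "B = A \<inter> lpot \<omega> -` {..lpot \<omega> m}" unfolding B_def by auto
    then show ?thesis
      using continuous_closed_preimage[OF continuous_on_subset[OF cont \<open>A \<subseteq> - S\<close>] clA closed_atMost] by simp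
  qed
  ultimately have "B = {} \<or> B = UNIV" by (metis clopen)
  moreover have "m \<in> B" unfolding B_def using m by simp
  ultimately have "B = UNIV" by blast
  then have "UNIV \<subseteq> cball (0::complex) (R + exp c)" using bd unfolding B_def by blast
  then show False using not_bounded_UNIV bounded_subset[OF bounded_cball] by metis
qed

text \<open>Every ball around a point of the support has positive mass and so contains points with
  potential exactly \<open>c\<close>. Descent along such points removes the exceptional null set and
  gives the bound on the entire support, from which the minimum principle carries it
  outward.\<close>

lemma frostman:
  assumes C: "compact C" and \<omega>: "\<omega> \<in> prob_measures_on C" and e: "log_energy \<omega> = ereal c"
    and max: "\<And>\<nu>. \<nu> \<in> prob_measures_on C \<Longrightarrow> log_energy \<nu> \<le> ereal c"
    and z: "z \<notin> C"
  shows "c \<le> lpot \<omega> z"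
proof -
  obtain S where S: "compact S" "S \<subseteq> C" "\<omega> \<in> prob_measures_on S"
    and supp: "\<And>z e. z \<in> S \<Longrightarrow> e > 0 \<Longrightarrow> \<not> (AE w in \<omega>. w \<notin> ball z e)"
    by (rule ex_support[OF \<omega> C]) blast
  have ae: "AE z in \<omega>. log_potential \<omega> z = ereal c"
    by (rule equilibrium_potential_AE[OF C \<omega> e max])
  have ge: "ereal c \<le> log_potential \<omega> y" if y: "y \<in> S" for y
  proof -
    have "\<exists>x. cmod (x - y) < 1 / real (Suc j) \<and> log_potential \<omega> x = ereal c" for j
    proof (rule ccontr)
      assume n: "\<not> ?thesis"
      have "AE w in \<omega>. w \<notin> ball y (1 / real (Suc j))"
        using ae
      proof eventually_elim
        case (elim w)
        then show ?case using n by (auto simp: dist_norm norm_minus_commute)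
      qed
      then show False using supp[OF y, of "1 / real (Suc j)"] by simp
    qed
    then obtain x where x: "\<And>j. cmod (x j - y) < 1 / real (Suc j)" "\<And>j. log_potential \<omega> (x j) = ereal c" by metis
    have w: "wconv (\<lambda>_. \<omega>) \<omega>" unfolding wconv_def by simp
    show ?thesis
      by (rule log_potential_descent[OF \<omega> C \<omega> C w tendsto_if_cmod_less[OF x(1)] tendsto_const]) (simp add: x(2))
  qed
  show ?thesis using lpot_minimum_principle[OF S(1,3) ge] z S(2) by blast
qed

section \<open>Maximum principle\<close>

text \<open>The potential averaged over the circle of radius \<open>\<rho>\<close>.\<close>

definition tpot :: "real \<Rightarrow> complex measure \<Rightarrow> complex \<Rightarrow> real" where
  "tpot \<rho> \<mu> z = (\<integral>w. ln (max \<rho> (cmod (w - z))) \<partial>\<mu>)"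

lemma continuous_ln_max: "\<rho> > 0 \<Longrightarrow> continuous_on A (\<lambda>w. ln (max \<rho> (cmod (w - z))))"
  by (intro continuous_intros) (auto simp: max_def)

lemma integrable_ln_max:
  assumes "\<mu> \<in> prob_measures_on C" "compact C" "\<rho> > 0"
  shows "integrable \<mu> (\<lambda>w. ln (max \<rho> (cmod (w - z))))"
  by (intro integrable_continuous_compact[OF assms(1,2)] continuous_ln_max assms(3)) measurable

text \<open>\<kappa> is the lemniscate measure of the linear polynomial w - z, so its potential is
  the truncated logarithm, and reciprocity computes circle averages of any potential.\<close>

lemma circle_measure:
  assumes \<rho>: "\<rho> > 0"
  obtains \<kappa> where "\<kappa> \<in> prob_measures_on (sphere z \<rho>)"
    "\<And>\<nu> D. \<nu> \<in> prob_measures_on D \<Longrightarrow> compact D \<Longrightarrow>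
      integrable \<kappa> (lpot \<nu>) \<and> (\<integral>\<zeta>. lpot \<nu> \<zeta> \<partial>\<kappa>) = tpot \<rho> \<nu> z"
proof -
  let ?p = "[:- z, 1:]"
  have deg: "degree ?p > 0" by simp
  obtain \<kappa> where \<kappa>: "\<kappa> \<in> prob_measures_on {w. cmod (poly ?p w) = \<rho>}"
    and pot: "\<And>w. log_potential \<kappa> w = ereal ((ln (max \<rho> (cmod (poly ?p w))) - ln (cmod (lead_coeff ?p))) / degree ?p)"
    by (rule lemniscate_measure[OF deg \<rho>]) blast
  have s: "{w. cmod (poly ?p w) = \<rho>} = sphere z \<rho>" by (auto simp: dist_norm norm_minus_commute)
  have pot': "log_potential \<kappa> w = ereal (ln (max \<rho> (cmod (w - z))))" for w
    unfolding pot by (simp add: algebra_simps)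
  show thesis
  proof (rule that)
    show \<kappa>': "\<kappa> \<in> prob_measures_on (sphere z \<rho>)" using \<kappa> unfolding s .
    fix \<nu> D assume \<nu>: "\<nu> \<in> prob_measures_on D" and D: "compact D"
    have ae: "AE w in \<nu>. log_potential \<kappa> w = ereal (ln (max \<rho> (cmod (w - z))))"
      by (intro AE_I2 pot')
    note L = lpot_swap[OF \<nu> D \<kappa>' compact_sphere ae integrable_ln_max[OF \<nu> D \<rho>]]
    show "integrable \<kappa> (lpot \<nu>) \<and> (\<integral>\<zeta>. lpot \<nu> \<zeta> \<partial>\<kappa>) = tpot \<rho> \<nu> z"
      using L(1,2) unfolding tpot_def by blast
  qed
qed

text \<open>The mean value property: the truncation does not act on a measure without mass in the
  ball.\<close>

lemma tpot_off:
  assumes \<mu>: "\<mu> \<in> prob_measures_on C" "compact C" and z: "ball z \<rho> \<inter> C = {}" and \<rho>: "\<rho> > 0"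
  shows "tpot \<rho> \<mu> z = lpot \<mu> z"
proof -
  note D = prob_measures_onD[OF \<mu>(1) compact_imp_closed[OF \<mu>(2)]]
  show ?thesis
    unfolding tpot_def lpot_def
  proof (rule integral_cong_AE)
    show "AE w in \<mu>. ln (max \<rho> (cmod (w - z))) = ln (cmod (z - w))"
      using D(4)
    proof eventually_elim
      case (elim w)
      then have "w \<notin> ball z \<rho>" using z by blast
      then show ?case by (simp add: dist_norm max_def norm_minus_commute)
    qed
  qed (use D(2) in \<open>simp_all cong: measurable_cong_sets\<close>)
qed

text \<open>Subharmonicity with its equality case. The excess of the average is the integral of a
  function that is positive inside the ball and 0 outside, so equality leaves no mass in the
  ball.\<close>

lemma lpot_le_tpot:
  assumes \<mu>: "\<mu> \<in> prob_measures_on C" "compact C" and fin: "log_potential \<mu> z \<noteq> -\<infinity>" and \<rho>: "\<rho> > 0"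
  shows "lpot \<mu> z \<le> tpot \<rho> \<mu> z"
    and "tpot \<rho> \<mu> z \<le> lpot \<mu> z \<Longrightarrow> AE w in \<mu>. w \<notin> ball z \<rho>"
proof -
  note F = log_potential_finiteD[OF \<mu> fin]
  have le: "AE w in \<mu>. 0 \<le> ln (max \<rho> (cmod (w - z))) - ln (cmod (z - w))"
    using F(2)
  proof eventually_elim
    case (elim w)
    then have "0 < cmod (z - w)" by simp
    then have "ln (cmod (z - w)) \<le> ln (max \<rho> (cmod (w - z)))"
      by (intro ln_mono) (auto simp: norm_minus_commute)
    then show ?case by simp
  qed
  have i: "integrable \<mu> (\<lambda>w. ln (max \<rho> (cmod (w - z))) - ln (cmod (z - w)))"
    using integrable_ln_max[OF \<mu> \<rho>] F(1) by (rule Bochner_Integration.integrable_diff)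
  have e: "(\<integral>w. ln (max \<rho> (cmod (w - z))) - ln (cmod (z - w)) \<partial>\<mu>) = tpot \<rho> \<mu> z - lpot \<mu> z"
    unfolding tpot_def lpot_def using integrable_ln_max[OF \<mu> \<rho>] F(1) by (rule Bochner_Integration.integral_diff)
  show *: "lpot \<mu> z \<le> tpot \<rho> \<mu> z" using integral_nonneg_AE[OF le] unfolding e by simp
  assume "tpot \<rho> \<mu> z \<le> lpot \<mu> z"
  then have "(\<integral>w. ln (max \<rho> (cmod (w - z))) - ln (cmod (z - w)) \<partial>\<mu>) = 0" using * unfolding e by simp
  then have "AE w in \<mu>. ln (max \<rho> (cmod (w - z))) - ln (cmod (z - w)) = 0"
    using integral_nonneg_eq_0_iff_AE[OF i le] by simp
  then show "AE w in \<mu>. w \<notin> ball z \<rho>"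
    using F(2)
  proof eventually_elim
    case (elim w)
    have "0 < cmod (z - w)" using elim by simp
    then have "max \<rho> (cmod (w - z)) = cmod (z - w)"
      using elim(1) \<rho> by (subst (asm) right_minus_eq, subst (asm) ln_inj_iff) auto
    then show ?case by (auto simp: dist_norm norm_minus_commute max_def split: if_splits)
  qed
qed

text \<open>At a point where the two potentials touch, averaging over a circle gives equality in the
  sub-mean-value property, so \<nu> has no mass in the disc. Both potentials are then harmonic
  there, their difference is minimal at the centre, and they touch on the whole disc. Connectedness
  of \<open>- K\<close> spreads the contact, and with it the absence of mass.\<close>

lemma strong_maximum_principle:
  assumes K: "compact K" "connected (- K)" and \<omega>: "\<omega> \<in> prob_measures_on K"
    and \<nu>: "\<nu> \<in> prob_measures_on D" "compact D"
    and fin: "\<And>z. log_potential \<nu> z \<noteq> -\<infinity>"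
    and le: "\<And>z. z \<notin> K \<Longrightarrow> lpot \<nu> z \<le> lpot \<omega> z"
    and z0: "z0 \<notin> K" "lpot \<omega> z0 \<le> lpot \<nu> z0"
  shows "\<nu> \<in> prob_measures_on K"
proof -
  note DD = prob_measures_onD[OF \<nu>(1) compact_imp_closed[OF \<nu>(2)]]
  define P where "P z \<longleftrightarrow> lpot \<omega> z \<le> lpot \<nu> z" for z
  have oK: "open (- K)" using K by (simp add: compact_imp_closed open_Compl)
  have null: "AE w in \<nu>. w \<notin> ball x r" if r: "r > 0" and x: "cball x r \<subseteq> - K" and Px: "P x" for x r
  proof -
    obtain \<kappa> where \<kappa>: "\<kappa> \<in> prob_measures_on (sphere x r)"
      and mean: "\<And>\<mu> C. \<mu> \<in> prob_measures_on C \<Longrightarrow> compact C \<Longrightarrow>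
        integrable \<kappa> (lpot \<mu>) \<and> (\<integral>\<zeta>. lpot \<mu> \<zeta> \<partial>\<kappa>) = tpot r \<mu> x"
      by (rule circle_measure[OF r]) blast
    note M = mean[OF \<nu>] and N = mean[OF \<omega> K(1)]
    have ae: "AE \<zeta> in \<kappa>. \<zeta> \<in> sphere x r" by (rule prob_measures_onD(4)[OF \<kappa> closed_sphere])
    have "tpot r \<nu> x = (\<integral>\<zeta>. lpot \<nu> \<zeta> \<partial>\<kappa>)" using M by simp
    also have "\<dots> \<le> (\<integral>\<zeta>. lpot \<omega> \<zeta> \<partial>\<kappa>)"
    proof (rule integral_mono_AE)
      show "AE \<zeta> in \<kappa>. lpot \<nu> \<zeta> \<le> lpot \<omega> \<zeta>"
        using ae
      proof eventually_elim
        case (elim \<zeta>)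
        then have "\<zeta> \<in> cball x r" by auto
        then show ?case using x by (intro le) auto
      qed
    qed (use M N in auto)
    also have "\<dots> = tpot r \<omega> x" using N by simp
    also have "\<dots> = lpot \<omega> x"
    proof (rule tpot_off[OF \<omega> K(1) _ r])
      show "ball x r \<inter> K = {}" using x ball_subset_cball[of x r] by blast
    qed
    also have "\<dots> \<le> lpot \<nu> x" using Px unfolding P_def .
    finally show ?thesis by (rule lpot_le_tpot(2)[OF \<nu> fin r])
  qed
  have spread: "P y" if r: "r > 0" and x: "cball x r \<subseteq> - K" and Px: "P x" and y: "y \<in> ball x r" for x y r
  proof -
    define D' where "D' = D - ball x r"
    have D': "compact D'" unfolding D'_def using \<nu>(2) by (rule compact_diff) simp
    have ae: "AE w in \<nu>. w \<in> D'"
      using null[OF r x Px] DD(4) unfolding D'_def by eventually_elim simp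
    have \<nu>': "\<nu> \<in> prob_measures_on D'"
      by (rule prob_measures_onI[OF DD(1,2) compact_imp_closed[OF D'] ae])
    have d1: "ball x r \<inter> D' = {}" unfolding D'_def by blast
    have d2: "ball x r \<inter> K = {}" using x ball_subset_cball[of x r] by blast
    obtain f where f: "f holomorphic_on ball x r" "\<And>w. w \<in> ball x r \<Longrightarrow> lpot \<nu> w = Re (f w)"
      using lpot_local_Re_holomorphic[OF \<nu>' D' d1 r] by blast
    obtain g where g: "g holomorphic_on ball x r" "\<And>w. w \<in> ball x r \<Longrightarrow> lpot \<omega> w = Re (g w)"
      using lpot_local_Re_holomorphic[OF \<omega> K(1) d2 r] by blast
    have xB: "x \<in> ball x r" using r by simp
    have h: "(\<lambda>w. g w - f w) holomorphic_on ball x r" by (intro holomorphic_intros f g)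
    have "g y - f y = g x - f x"
    proof (rule holomorphic_Re_min_constant[OF h open_ball _ open_ball subset_refl xB _ y])
      fix v assume v: "v \<in> ball x r"
      then have "v \<notin> K" using d2 by blast
      from le[OF this] show "Re (g x - f x) \<le> Re (g v - f v)"
        using Px f(2)[OF v] g(2)[OF v] f(2)[OF xB] g(2)[OF xB] unfolding P_def by simp
    qed simp
    then have "Re (g y - f y) = Re (g x - f x)" by simp
    then show "P y" using Px f(2)[OF y] g(2)[OF y] f(2)[OF xB] g(2)[OF xB] unfolding P_def by simp
  qed
  have all: "P z" if z: "z \<in> - K" for z
  proof (rule connected_induction_simple[where P=P, OF K(2) _ z])
    show "z0 \<in> - K" "P z0" using z0 unfolding P_def by auto
    fix a assume "a \<in> - K"
    then obtain d where d: "d > 0" "ball a d \<subseteq> - K" by (rule openE[OF oK])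
    \<comment> \<open>For any x and y in the ball of radius d / 3 about a, the closed disc of radius
      2 d / 3 about x contains y and stays inside the ball of radius d about a.\<close>
    define \<rho> where "\<rho> = d / 3"
    have \<rho>: "\<rho> > 0" unfolding \<rho>_def using d by simp
    show "\<exists>T. openin (top_of_set (- K)) T \<and> a \<in> T \<and> (\<forall>x\<in>T. \<forall>y\<in>T. P x \<longrightarrow> P y)"
    proof (intro exI[of _ "ball a \<rho>"] conjI ballI impI)
      have "ball a \<rho> \<subseteq> ball a d" unfolding \<rho>_def using d(1) by (intro subset_ball) simp
      then show "openin (top_of_set (- K)) (ball a \<rho>)" using d(2) oK by (simp add: openin_open_eq)
      show "a \<in> ball a \<rho>" using \<rho> by simp
      fix x y assume x: "x \<in> ball a \<rho>" and y: "y \<in> ball a \<rho>" and "P x"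
      have "cball x (2 * \<rho>) \<subseteq> ball a d"
      proof
        fix v assume "v \<in> cball x (2 * \<rho>)"
        then show "v \<in> ball a d" using x dist_triangle[of a v x] unfolding \<rho>_def by simp
      qed
      then have "cball x (2 * \<rho>) \<subseteq> - K" using d(2) by blast
      moreover have "y \<in> ball x (2 * \<rho>)"
        using x y dist_triangle[of x y a] by (simp add: dist_commute)
      ultimately show "P y" using spread[of "2 * \<rho>" x y] \<rho> \<open>P x\<close> by simp
    qed
  qed
  have "AE w in \<nu>. w \<notin> - K"
  proof (rule AE_notin_if_locally_null)
    fix z assume z: "z \<in> - K"
    then obtain d where d: "d > 0" "ball z d \<subseteq> - K" by (rule openE[OF oK])
    have "cball z (d / 2) \<subseteq> ball z d" using d(1) by (simp add: subset_iff)
    then have "AE w in \<nu>. w \<notin> ball z (d / 2)" using d by (intro null all z) auto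
    then show "\<exists>e>0. AE w in \<nu>. w \<notin> ball z e" using d(1) by (intro exI[of _ "d / 2"]) auto
  qed
  then have "AE w in \<nu>. w \<in> K" by eventually_elim simp
  then show ?thesis by (intro prob_measures_onI DD compact_imp_closed K)
qed

section \<open>Derivatives of polynomials\<close>

lemma deriv_funpow_poly: "(deriv ^^ m) (poly p) = poly ((pderiv ^^ m) p)" for p :: "complex poly"
proof (induction m)
  case (Suc m)
  have "deriv (poly s) = poly (pderiv s)" for s :: "complex poly"
    by (rule ext) (rule DERIV_imp_deriv, rule poly_DERIV)
  then show ?case using Suc by simp
qed simp

text \<open>Cauchy's inequality with the maximum on the circle attained at an actual point
  \<open>x\<close>, because the descent argument needs a sequence of points, not a supremum.\<close>

lemma higher_pderiv_le:
  fixes p :: "complex poly"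
  assumes \<delta>: "\<delta> > 0"
  obtains x where "cmod (z - x) = \<delta>"
    "cmod (poly ((pderiv ^^ m) p) z) \<le> fact m / \<delta> ^ m * cmod (poly p x)"
proof -
  have "sphere z \<delta> \<noteq> {}" using \<delta> by simp
  moreover have "continuous_on (sphere z \<delta>) (\<lambda>x. cmod (poly p x))" by (intro continuous_intros)
  ultimately obtain x where x: "x \<in> sphere z \<delta>" "\<And>y. y \<in> sphere z \<delta> \<Longrightarrow> cmod (poly p y) \<le> cmod (poly p x)"
    using continuous_attains_sup[OF compact_sphere] by blast
  have "cmod ((deriv ^^ m) (poly p) z) \<le> fact m * cmod (poly p x) / \<delta> ^ m"
    by (rule Cauchy_inequality[OF _ _ \<delta>]) (auto intro!: holomorphic_intros continuous_intros x(2) simp: dist_norm)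
  then show thesis using x(1) unfolding deriv_funpow_poly by (intro that[of x]) (auto simp: dist_norm)
qed

lemma degree_higher_pderiv: "degree ((pderiv ^^ m) p) = degree p - m" for p :: "complex poly"
  by (induction m) (auto simp: degree_pderiv)

lemma lead_coeff_pderiv_complex: "lead_coeff (pderiv p) = of_nat (degree p) * lead_coeff p" for p :: "complex poly"
  by (cases "degree p") (auto simp: degree_pderiv coeff_pderiv pderiv_eq_0_iff coeff_eq_0)

text \<open>Differentiation contributes \<open>m\<close> integer factors, each between 1 and the
  degree; on the scale of n-th roots they disappear.\<close>

lemma lead_coeff_higher_pderiv:
  fixes p :: "complex poly"
  assumes "m \<le> degree p"
  shows "cmod (lead_coeff p) \<le> cmod (lead_coeff ((pderiv ^^ m) p))"
    and "cmod (lead_coeff ((pderiv ^^ m) p)) \<le> real (degree p) ^ m * cmod (lead_coeff p)"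
proof -
  have "cmod (lead_coeff p) \<le> cmod (lead_coeff ((pderiv ^^ m) p)) \<and>
    cmod (lead_coeff ((pderiv ^^ m) p)) \<le> real (degree p) ^ m * cmod (lead_coeff p)"
    using assms
  proof (induction m)
    case (Suc m)
    let ?q = "(pderiv ^^ m) p"
    have d: "degree ?q = degree p - m" by (rule degree_higher_pderiv)
    have e: "cmod (lead_coeff ((pderiv ^^ Suc m) p)) = real (degree p - m) * cmod (lead_coeff ?q)"
      using lead_coeff_pderiv_complex[of ?q] d by (simp add: norm_mult)
    have IH: "cmod (lead_coeff p) \<le> cmod (lead_coeff ?q)" "cmod (lead_coeff ?q) \<le> real (degree p) ^ m * cmod (lead_coeff p)"
      using Suc by auto
    have "1 * cmod (lead_coeff ?q) \<le> real (degree p - m) * cmod (lead_coeff ?q)"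
      using Suc.prems by (intro mult_right_mono) auto
    moreover have "real (degree p - m) * cmod (lead_coeff ?q) \<le> real (degree p) * (real (degree p) ^ m * cmod (lead_coeff p))"
      using IH(2) by (intro mult_mono) auto
    ultimately show ?case using IH(1) unfolding e by simp
  qed simp
  then show "cmod (lead_coeff p) \<le> cmod (lead_coeff ((pderiv ^^ m) p))"
    "cmod (lead_coeff ((pderiv ^^ m) p)) \<le> real (degree p) ^ m * cmod (lead_coeff p)" by auto
qed

lemma pderiv_prod_linear:
  fixes z :: complex
  assumes "\<forall>w\<in>#M. z \<noteq> w"
  shows "poly (pderiv (\<Prod>w\<in>#M. [:- w, 1:])) z = (\<Prod>w\<in>#M. z - w) * (\<Sum>w\<in>#M. 1 / (z - w))"
  using assms
proof (induction M)
  case (add w M)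
  have "z - w \<noteq> 0" using add.prems by auto
  moreover have "poly (pderiv (\<Prod>w\<in>#M. [:- w, 1:])) z = (\<Prod>w\<in>#M. z - w) * (\<Sum>w\<in>#M. 1 / (z - w))"
    using add by auto
  moreover have "poly (pderiv [:- w, 1:]) z = 1" "poly [:- w, 1:] z = z - w"
    by (simp_all add: pderiv_pCons)
  ultimately show ?case
    unfolding image_mset_add_mset prod_mset.add_mset sum_mset.add_mset pderiv_mult poly_add poly_mult poly_prod_linear
    by (simp only:) (simp add: field_simps del: poly_pCons)
qed simp

text \<open>The map 1 / (1 - \<zeta>) sends the closed unit disc without 1 into the half-plane Re >=
  1 / 2; here \<zeta> = w / z.\<close>

lemma Re_quotient_ge_half:
  assumes "cmod w \<le> cmod z" "z \<noteq> w"
  shows "1 / 2 \<le> Re (z / (z - w))"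
proof -
  have pos: "0 < (cmod (z - w))\<^sup>2" using assms by simp
  have "Re (z / (z - w)) = Re (z * cnj (z - w)) / (cmod (z - w))\<^sup>2"
    unfolding complex_div_cnj[of z "z - w"] by (simp add: Re_divide_of_real)
  moreover have "2 * Re (z * cnj (z - w)) = (cmod (z - w))\<^sup>2 + ((cmod z)\<^sup>2 - (cmod w)\<^sup>2)"
    unfolding cmod_power2 by (simp add: power2_eq_square algebra_simps)
  moreover have "(cmod w)\<^sup>2 \<le> (cmod z)\<^sup>2" using assms by (intro power_mono) auto
  ultimately have N: "(cmod (z - w))\<^sup>2 \<le> 2 * Re (z * cnj (z - w))"
    and e: "Re (z / (z - w)) = Re (z * cnj (z - w)) / (cmod (z - w))\<^sup>2" by linarith+
  have "1 / 2 \<le> y / x" if "x \<le> 2 * y" "0 < x" for x y :: real using that by (simp add: field_simps)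
  from this[OF N pos] show ?thesis unfolding e .
qed

text \<open>The logarithmic derivative times \<open>z\<close> is the sum of z / (z - w) over the
  roots, and each summand has real part at least 1 / 2.\<close>

lemma cmod_pderiv_ge:
  fixes p :: "complex poly"
  assumes roots: "{z. poly p z = 0} \<subseteq> ball 0 R" and z: "cmod z \<ge> R" "R > 0" and p: "p \<noteq> 0"
  shows "real (degree p) / (2 * cmod z) * cmod (poly p z) \<le> cmod (poly (pderiv p) z)"
proof -
  have z0: "z \<noteq> 0" using z by auto
  have in_R: "cmod w < R" if "w \<in># proots p" for w
  proof -
    have "w \<in> {z. poly p z = 0}" using that p by simp
    then show ?thesis using roots by auto
  qed
  have ne: "\<forall>w\<in>#proots p. z \<noteq> w" using in_R z by fastforce
  define S where "S = (\<Sum>w\<in>#proots p. 1 / (z - w))"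
  have "pderiv p = smult (lead_coeff p) (pderiv (\<Prod>w\<in>#proots p. [:- w, 1:]))"
    using complex_poly_decompose_multiset[of p] by (metis pderiv_smult)
  then have eq: "poly (pderiv p) z = poly p z * S"
    unfolding S_def using pderiv_prod_linear[OF ne] poly_eq_prod_proots[of p z] by simp
  have "real (size M) / 2 \<le> Re (z * (\<Sum>w\<in>#M. 1 / (z - w)))" if "\<forall>w\<in>#M. cmod w \<le> cmod z \<and> z \<noteq> w" for M
    using that
  proof (induction M)
    case (add w M)
    have "1 / 2 \<le> Re (z / (z - w))" using add.prems by (intro Re_quotient_ge_half) auto
    then show ?case using add by (simp add: distrib_left add_divide_distrib)
  qed simp
  from this[of "proots p"] have "real (degree p) / 2 \<le> Re (z * S)"
    unfolding S_def size_proots_complex using in_R ne z by fastforce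
  also have "\<dots> \<le> cmod z * cmod S" using complex_Re_le_cmod[of "z * S"] by (simp add: norm_mult)
  finally have "real (degree p) / (2 * cmod z) \<le> cmod S" using z0 by (simp add: field_simps)
  then have "real (degree p) / (2 * cmod z) * cmod (poly p z) \<le> cmod S * cmod (poly p z)"
    by (intro mult_right_mono) auto
  then show ?thesis unfolding eq by (simp add: norm_mult mult.commute)
qed

text \<open>The estimate itself excludes roots of the derivative outside the disc, a Gauss-Lucas
  statement that the induction carries along so that the next derivative can be treated.\<close>

lemma cmod_higher_pderiv_ge:
  fixes p :: "complex poly"
  assumes roots: "{z. poly p z = 0} \<subseteq> ball 0 R" and R: "R > 0" and m: "m \<le> degree p" "p \<noteq> 0"
  shows "{z. poly ((pderiv ^^ m) p) z = 0} \<subseteq> ball 0 R \<and>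
    (\<forall>z. cmod z \<ge> R \<longrightarrow> cmod (poly p z) / (2 * cmod z) ^ m \<le> cmod (poly ((pderiv ^^ m) p) z))"
  using m
proof (induction m)
  case 0
  then show ?case using roots by simp
next
  case (Suc m)
  let ?q = "(pderiv ^^ m) p"
  have d: "degree ?q \<ge> 1" using Suc.prems by (simp add: degree_higher_pderiv)
  then have q0: "?q \<noteq> 0" by auto
  have IH: "{z. poly ?q z = 0} \<subseteq> ball 0 R"
    "\<And>z. cmod z \<ge> R \<Longrightarrow> cmod (poly p z) / (2 * cmod z) ^ m \<le> cmod (poly ?q z)"
    using Suc by auto
  have ge: "cmod (poly ?q z) / (2 * cmod z) \<le> cmod (poly (pderiv ?q) z)" if z: "cmod z \<ge> R" for z
  proof -
    have "1 * (cmod (poly ?q z) / (2 * cmod z)) \<le> real (degree ?q) * (cmod (poly ?q z) / (2 * cmod z))"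
      using d by (intro mult_right_mono) auto
    then show ?thesis using cmod_pderiv_ge[OF IH(1) z R q0] by simp
  qed
  have A: "cmod (poly p z) / (2 * cmod z) ^ Suc m \<le> cmod (poly (pderiv ?q) z)" if z: "cmod z \<ge> R" for z
  proof -
    have "cmod (poly p z) / (2 * cmod z) ^ Suc m = cmod (poly p z) / (2 * cmod z) ^ m / (2 * cmod z)"
      by simp
    also have "\<dots> \<le> cmod (poly ?q z) / (2 * cmod z)"
      using IH(2)[OF z] by (intro divide_right_mono) auto
    finally show ?thesis using ge[OF z] by simp
  qed
  have B: "poly (pderiv ?q) z \<noteq> 0" if z: "cmod z \<ge> R" for z
  proof
    assume "poly (pderiv ?q) z = 0"
    then have "cmod (poly ?q z) / (2 * cmod z) \<le> 0" using ge[OF z] by simp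
    then have "poly ?q z = 0" using z R by (auto simp: divide_le_0_iff)
    then show False using IH(1) z by auto
  qed
  have S: "(pderiv ^^ Suc m) p = pderiv ?q" by simp
  show ?case
    unfolding S
  proof (intro conjI subsetI allI impI)
    fix z assume "z \<in> {z. poly (pderiv ?q) z = 0}"
    then have "\<not> cmod z \<ge> R" using B[of z] by blast
    then show "z \<in> ball 0 R" by simp
  qed (rule A)
qed

section \<open>The limit argument\<close>

lemma not_eventually_subseq:
  assumes "\<not> eventually P sequentially"
  obtains s :: "nat \<Rightarrow> nat" where "strict_mono s" "\<And>k. \<not> P (s k)"
proof -
  have "infinite {k. \<not> P k}"
  proof
    assume "finite {k. \<not> P k}"
    then obtain b where b: "\<forall>k\<in>{k. \<not> P k}. k \<le> b"
      unfolding finite_nat_set_iff_bounded_le by (elim exE)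
    have "P k" if "Suc b \<le> k" for k using b that by fastforce
    then have "eventually P sequentially" by (rule eventually_sequentiallyI)
    then show False using assms by contradiction
  qed
  then show thesis using that[of "enumerate {k. \<not> P k}"] enumerate_in_set[of "{k. \<not> P k}"]
    by (auto simp: strict_mono_enumerate)
qed

lemma lpot_upper_bound:
  assumes \<mu>: "\<mu> \<in> prob_measures_on (cball 0 R)" and z: "cmod z > R" "R > 0"
  shows "lpot \<mu> z \<le> ln (cmod z + R)"
proof -
  note D = prob_measures_onD[OF \<mu> closed_cball]
  interpret prob_space \<mu> by (rule D)
  have zn: "z \<notin> cball 0 R" using z by auto
  have "lpot \<mu> z \<le> (\<integral>w. ln (cmod z + R) \<partial>\<mu>)"
    unfolding lpot_def
  proof (rule integral_mono_AE)
    show "integrable \<mu> (\<lambda>w. ln (cmod (z - w)))" by (rule log_potential_off(1)[OF \<mu> compact_cball zn])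
    show "AE w in \<mu>. ln (cmod (z - w)) \<le> ln (cmod z + R)"
      using D(4)
    proof eventually_elim
      case (elim w)
      have "cmod (z - w) \<le> cmod z + R" using norm_triangle_ineq4[of z w] elim by auto
      moreover have "0 < cmod (z - w)" using elim zn by auto
      ultimately show ?case by (simp add: ln_mono)
    qed
  qed auto
  then show ?thesis by (simp add: prob_space)
qed

text \<open>Both potentials lie between ln (x - R) and ln (x + R), whose difference tends to
  0.\<close>

lemma lpot_diff_const_far:
  assumes \<mu>: "\<mu> \<in> prob_measures_on (cball 0 R)" and \<nu>: "\<nu> \<in> prob_measures_on (cball 0 R)" and R: "R > 0"
    and const: "\<And>z. cmod z > R \<Longrightarrow> lpot \<mu> z - lpot \<nu> z = d"
  shows "d = 0"
proof -
  have le: "\<bar>d\<bar> \<le> ln (x + R) - ln (x - R)" if x: "x > R" for x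
  proof -
    have c: "cmod (complex_of_real x) = x" using x R by simp
    have "lpot \<mu> x \<le> ln (x + R)" "lpot \<nu> x \<le> ln (x + R)"
      using lpot_upper_bound[OF \<mu>, of x] lpot_upper_bound[OF \<nu>, of x] x R c by auto
    moreover have "ln (x - R) \<le> lpot \<mu> x" "ln (x - R) \<le> lpot \<nu> x"
      using lpot_lower_bound_far[OF \<mu>, of "x - R" x] lpot_lower_bound_far[OF \<nu>, of "x - R" x] x c by auto
    ultimately show ?thesis using const[of x] c x by auto
  qed
  have "((\<lambda>x. ln (x + R) - ln (x - R)) \<longlongrightarrow> 0) at_top" by real_asymp
  then have "\<bar>d\<bar> \<le> 0"
    by (rule tendsto_lowerbound[OF _ eventually_mono[OF eventually_gt_at_top[of R] le]]) simp_all
  then show ?thesis by simp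
qed

text \<open>Common setting of the limit argument, along a subsequence of \<open>q\<close> on which the zero-counting
  measures and the equilibrium measures converge weakly.\<close>

locale regular_centered =
  fixes K :: "complex set" and \<omega> :: "complex measure" and c R r :: real and m :: nat
    and q :: "nat \<Rightarrow> complex poly" and \<sigma> :: "complex measure"
  assumes K: "compact K" "connected (- K)" and \<omega>: "\<omega> \<in> prob_measures_on K"
    and en: "log_energy \<omega> = ereal c"
    and max: "\<And>\<nu>. \<nu> \<in> prob_measures_on K \<Longrightarrow> log_energy \<nu> \<le> ereal c"
    and deg: "filterlim (\<lambda>k. degree (q k)) at_top sequentially"
    and deg_m: "\<And>k. m < degree (q k)"
    and R: "R > 0" "K \<subseteq> ball 0 R" and roots: "\<And>k. {z. poly (q k) z = 0} \<subseteq> ball 0 R"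
    and reg: "\<And>z. cmod z \<ge> R \<Longrightarrow>
      (\<lambda>k. ln (cmod (poly (q k) z)) / degree (q k)) \<longlonglongrightarrow> lpot \<omega> z - c"
    and cent: "\<And>L. closed L \<Longrightarrow> L \<inter> K = {} \<Longrightarrow>
      \<exists>M. \<forall>k. size (filter_mset (\<lambda>z. z \<in> L) (proots (q k))) \<le> M"
    and r: "r > 0"
    and conv: "wconv (\<lambda>k. zero_measure (q k)) \<sigma>" and \<sigma>: "\<sigma> \<in> prob_measures_on (cball 0 R)"
begin

definition p where "p k = (pderiv ^^ m) (q k)"

definition W where "W k = equilibrium_measure (poly (p k) -` cball 0 r)"

definition n where "n k = real (degree (q k))"

definition N where "N k = real (degree (p k))"

definition la where "la k = ln (cmod (lead_coeff (q k)))"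

definition lb where "lb k = ln (cmod (lead_coeff (p k)))"

lemma deg_q: "degree (q k) > 0"
  using deg_m[of k] by simp

lemma q_nonzero: "q k \<noteq> 0"
  using deg_q[of k] by auto

lemma deg_p: "degree (p k) > 0" "N k = n k - m"
  using deg_m[of k] unfolding p_def N_def n_def by (auto simp: degree_higher_pderiv)

lemma N_pos: "N k > 0" "n k > 0" "N k \<le> n k"
  using deg_p[of k] deg_q[of k] unfolding N_def n_def by auto

lemma n_lim: "filterlim n at_top sequentially"
  unfolding n_def by (rule filterlim_compose[OF filterlim_real_sequentially deg])

lemma ratio_lim: "(\<lambda>k. n k / N k) \<longlonglongrightarrow> 1" "(\<lambda>k. N k / n k) \<longlonglongrightarrow> 1"
  "(\<lambda>k. u / N k) \<longlonglongrightarrow> 0" "(\<lambda>k. u / n k) \<longlonglongrightarrow> 0" "(\<lambda>k. ln (n k) / N k) \<longlonglongrightarrow> 0"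
proof -
  have "((\<lambda>x. x / (x - real m)) \<longlongrightarrow> 1) at_top" "((\<lambda>x. (x - real m) / x) \<longlongrightarrow> 1) at_top"
    "((\<lambda>x. u / (x - real m)) \<longlongrightarrow> 0) at_top" "((\<lambda>x. u / x) \<longlongrightarrow> 0) at_top"
    "((\<lambda>x. ln x / (x - real m)) \<longlongrightarrow> 0) at_top" by real_asymp+
  from this[THEN filterlim_compose, OF n_lim] show
    "(\<lambda>k. n k / N k) \<longlonglongrightarrow> 1" "(\<lambda>k. N k / n k) \<longlonglongrightarrow> 1"
    "(\<lambda>k. u / N k) \<longlonglongrightarrow> 0" "(\<lambda>k. u / n k) \<longlonglongrightarrow> 0" "(\<lambda>k. ln (n k) / N k) \<longlonglongrightarrow> 0"
    unfolding deg_p(2) by auto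
qed

lemma W_on: "W k \<in> prob_measures_on (poly (p k) -` cball 0 r)"
  unfolding W_def by (rule equilibrium_measure_poly_vimage(1)[OF deg_p(1) r])

lemma W_compact: "compact (poly (p k) -` cball 0 r)"
  by (rule compact_poly_vimage[OF deg_p(1)])

lemma W_pot: "log_potential (W k) z = ereal ((ln (max r (cmod (poly (p k) z))) - lb k) / N k)"
  unfolding W_def lb_def N_def by (rule equilibrium_measure_poly_vimage(2)[OF deg_p(1) r])

lemma W_lpot: "lpot (W k) z = (ln (max r (cmod (poly (p k) z))) - lb k) / N k"
  using log_potential_finiteD(3)[OF W_on W_compact, of k z] unfolding W_pot by simp

lemma K_on: "\<omega> \<in> prob_measures_on (cball 0 R)"
  by (rule prob_measures_on_mono[OF \<omega>]) (use K R in \<open>auto simp: compact_imp_closed\<close>)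

lemma zero_on: "zero_measure (q k) \<in> prob_measures_on (cball 0 R)"
  by (rule zero_measure_on[OF deg_q closed_cball]) (use roots[of k] in auto)

lemma zero_lpot:
  assumes "poly (q k) z \<noteq> 0"
  shows "log_potential (zero_measure (q k)) z = ereal ((ln (cmod (poly (q k) z)) - la k) / n k)"
    and "lpot (zero_measure (q k)) z = (ln (cmod (poly (q k) z)) - la k) / n k"
  using lpot_zero_measure[OF deg_q assms] unfolding la_def n_def by auto

text \<open>Centering bounds the number of zeros at distance at least e / 2 from \<open>K\<close>
  independently of \<open>k\<close>; divided by the degree, their share of the mass tends to
  0.\<close>

lemma sigma_on_K: "\<sigma> \<in> prob_measures_on K"
proof -
  note D = prob_measures_onD[OF \<sigma> closed_cball]
  have "K \<noteq> {}" using \<omega> by (auto simp: prob_measures_on_def)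
  show ?thesis
  proof (rule wconv_support[OF D(1,2) conv compact_imp_closed[OF K(1)] \<open>K \<noteq> {}\<close>])
    show "(\<lambda>k. \<integral>z. min 1 (infdist z K) \<partial>zero_measure (q k)) \<longlonglongrightarrow> 0"
    proof (rule LIMSEQ_I)
      fix e :: real assume e: "e > 0"
      define L where "L = {z. infdist z K \<ge> e / 2}"
      have cL: "closed L" unfolding L_def by (intro closed_Collect_le continuous_intros)
      have "L \<inter> K = {}" unfolding L_def using e by auto
      then obtain M where M: "\<And>k. size (filter_mset (\<lambda>z. z \<in> L) (proots (q k))) \<le> M"
        using cent[OF cL] by blast
      have le: "(\<integral>z. min 1 (infdist z K) \<partial>zero_measure (q k)) \<le> e / 2 + real M / n k" for k
      proof -
        note Dk = prob_measures_onD[OF zero_on[of k] closed_cball]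
        interpret prob_space "zero_measure (q k)" by (rule Dk)
        have Lm: "L \<in> sets (zero_measure (q k))" using cL Dk(2) by auto
        have "(\<integral>z. min 1 (infdist z K) \<partial>zero_measure (q k)) \<le> (\<integral>z. e / 2 + indicator L z \<partial>zero_measure (q k))"
        proof (rule integral_mono)
          show "integrable (zero_measure (q k)) (\<lambda>z. min 1 (infdist z K))"
            by (rule integrable_continuous_compact[OF zero_on compact_cball])
              (auto intro!: continuous_intros borel_measurable_continuous_onI)
          show "min 1 (infdist z K) \<le> e / 2 + indicator L z" for z
            using e unfolding L_def by (auto simp: indicator_def)
        qed (use Lm in \<open>auto simp: emeasure_eq_measure\<close>)
        also have "\<dots> = e / 2 + measure (zero_measure (q k)) L"
          using Lm by (simp add: prob_space emeasure_eq_measure)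
        also have "measure (zero_measure (q k)) L \<le> real M / n k"
          unfolding n_def using M[of k] cL by (subst measure_zero_measure[OF deg_q]) (auto intro: divide_right_mono)
        finally show ?thesis by simp
      qed
      have "eventually (\<lambda>k. real M / n k < e / 2) sequentially"
        using ratio_lim(4)[of "real M"] e by (intro order_tendstoD(2)) auto
      then obtain k0 where k0: "\<And>k. k \<ge> k0 \<Longrightarrow> real M / n k < e / 2"
        by (auto simp: eventually_sequentially)
      have "norm ((\<integral>z. min 1 (infdist z K) \<partial>zero_measure (q k)) - 0) < e" if "k \<ge> k0" for k
      proof -
        have "0 \<le> (\<integral>z. min 1 (infdist z K) \<partial>zero_measure (q k))"
          by (intro Bochner_Integration.integral_nonneg) (simp add: infdist_nonneg)
        then show ?thesis using le[of k] k0[OF that] unfolding real_norm_def by linarith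
      qed
      then show "\<exists>k0. \<forall>k\<ge>k0. norm ((\<integral>z. min 1 (infdist z K) \<partial>zero_measure (q k)) - 0) < e" by blast
    qed
  qed
qed

lemma la_lim_far:
  assumes z: "cmod z > R"
  shows "(\<lambda>k. la k / n k) \<longlonglongrightarrow> lpot \<omega> z - c - lpot \<sigma> z"
proof -
  have nz: "poly (q k) z \<noteq> 0" for k using roots[of k] z by auto
  have zn: "z \<notin> cball 0 R" using z by simp
  have "(\<lambda>k. ln (cmod (poly (q k) z)) / n k - lpot (zero_measure (q k)) z) \<longlonglongrightarrow> (lpot \<omega> z - c) - lpot \<sigma> z"
    unfolding n_def using z
    by (intro tendsto_diff reg wconv_lpot_off[OF zero_on compact_cball \<sigma> conv zn]) auto
  then show ?thesis unfolding zero_lpot(2)[OF nz] by (simp add: diff_divide_distrib)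
qed

text \<open>The limit in \<open>la_lim_far\<close> is taken by a sequence free of \<open>z\<close>,
  so the two potentials differ by a constant, which the common behaviour ln |z| at infinity makes
  0.\<close>

lemma lpot_sigma_far: "cmod z > R \<Longrightarrow> lpot \<omega> z = lpot \<sigma> z"
proof -
  define z1 where "z1 = complex_of_real (R + 1)"
  have z1: "cmod z1 > R" unfolding z1_def norm_of_real using R by simp
  have const: "lpot \<omega> z - lpot \<sigma> z = lpot \<omega> z1 - lpot \<sigma> z1" if "cmod z > R" for z
    using LIMSEQ_unique[OF la_lim_far[OF that] la_lim_far[OF z1]] by simp
  have "lpot \<omega> z1 - lpot \<sigma> z1 = 0"
    by (rule lpot_diff_const_far[OF K_on \<sigma> R(1) const])
  then show "cmod z > R \<Longrightarrow> lpot \<omega> z = lpot \<sigma> z" using const[of z] by simp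
qed

text \<open>Since exp c is the logarithmic capacity of \<open>K\<close>, this is the familiar fact
  that the n-th roots of the leading coefficients tend to the reciprocal of the capacity.\<close>

lemma la_lim: "(\<lambda>k. la k / n k) \<longlonglongrightarrow> - c"
proof -
  have z1: "cmod (complex_of_real (R + 1)) > R" unfolding norm_of_real using R by simp
  from la_lim_far[OF z1] lpot_sigma_far[OF z1] show ?thesis by simp
qed

lemma lpot_sigma: "z \<notin> K \<Longrightarrow> lpot \<sigma> z = lpot \<omega> z"
proof -
  have "lpot \<omega> z = lpot \<sigma> z" if "cmod z \<ge> R + 1" for z
    using that by (intro lpot_sigma_far) simp
  from lpot_identity[OF \<omega> sigma_on_K K this] show "z \<notin> K \<Longrightarrow> lpot \<sigma> z = lpot \<omega> z" by simp
qed

lemma la_le_lb: "la k \<le> lb k" "lb k \<le> real m * ln (n k) + la k"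
proof -
  have a: "0 < cmod (lead_coeff (q k))" using q_nonzero[of k] by simp
  have le: "m \<le> degree (q k)" using deg_m[of k] by simp
  note L = lead_coeff_higher_pderiv[OF le, folded p_def]
  show "la k \<le> lb k" unfolding la_def lb_def using L(1) a by (simp add: ln_mono)
  have b: "0 < cmod (lead_coeff (p k))" using L(1) a by linarith
  have "lb k \<le> ln (n k ^ m * cmod (lead_coeff (q k)))"
    unfolding lb_def n_def using L(2) b by (simp add: ln_mono)
  also have "\<dots> = real m * ln (n k) + la k"
    unfolding la_def using a N_pos(2)[of k] by (simp add: ln_mult ln_realpow)
  finally show "lb k \<le> real m * ln (n k) + la k" .
qed

lemma la_lim': "(\<lambda>k. la k / N k) \<longlonglongrightarrow> - c"
proof -
  have "(\<lambda>k. la k / n k * (n k / N k)) \<longlonglongrightarrow> - c * 1" by (intro tendsto_mult la_lim ratio_lim)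
  moreover have "la k / n k * (n k / N k) = la k / N k" for k using N_pos(2)[of k] by simp
  ultimately show ?thesis by (simp only: mult_1_right)
qed

lemma lb_lim: "(\<lambda>k. lb k / N k) \<longlonglongrightarrow> - c"
proof (rule real_tendsto_sandwich[OF _ _ la_lim'])
  have "(\<lambda>k. real m * (ln (n k) / N k) + la k / N k) \<longlonglongrightarrow> real m * 0 + - c"
    by (intro tendsto_intros ratio_lim la_lim')
  then show "(\<lambda>k. (real m * ln (n k) + la k) / N k) \<longlonglongrightarrow> - c" by (simp add: add_divide_distrib)
  show "\<forall>\<^sub>F k in sequentially. la k / N k \<le> lb k / N k"
    using la_le_lb N_pos by (intro always_eventually allI divide_right_mono) (auto intro: less_imp_le)
  show "\<forall>\<^sub>F k in sequentially. lb k / N k \<le> (real m * ln (n k) + la k) / N k"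
    using la_le_lb N_pos by (intro always_eventually allI divide_right_mono) (auto intro: less_imp_le)
qed

lemma bottom_lim: "(\<lambda>k. (ln r - lb k) / N k) \<longlonglongrightarrow> c"
proof -
  have "(\<lambda>k. ln r / N k - lb k / N k) \<longlonglongrightarrow> 0 - - c"
    by (intro tendsto_diff ratio_lim lb_lim)
  then show ?thesis by (simp add: diff_divide_distrib)
qed

lemma W_ge_bottom: "(ln r - lb k) / N k \<le> lpot (W k) z"
  unfolding W_lpot using N_pos[of k] r by (intro divide_right_mono diff_right_mono ln_mono) auto

lemma lpot_omega_ge: "z \<notin> K \<Longrightarrow> c \<le> lpot \<omega> z"
  by (rule frostman[OF K(1) \<omega> en max])

lemma lpot_omega_cont: "continuous_on (- K) (lpot \<omega>)"
  by (rule lpot_continuous_off[OF \<omega> K(1)])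

text \<open>Off \<open>K\<close>, Cauchy's inequality bounds \<open>p k\<close> by values of \<open>q k\<close> nearby, which descent controls.\<close>

lemma W_locally_le:
  assumes s: "strict_mono s" and z: "zs \<longlonglongrightarrow> z" "z \<notin> K" and e: "e > 0"
  shows "\<exists>k. lpot (W (s k)) (zs k) \<le> lpot \<omega> (zs k) + e"
proof (rule ccontr)
  assume "\<not> ?thesis"
  then have gt: "lpot \<omega> (zs k) + e < lpot (W (s k)) (zs k)" for k by (simp add: not_le)
  define h where "h = lpot \<omega>"
  have oK: "open (- K)" using K by (simp add: compact_imp_closed open_Compl)
  have "isCont h z" using lpot_omega_cont oK z(2) unfolding h_def by (simp add: continuous_on_eq_continuous_at)
  then obtain d where d: "d > 0" "\<And>x. dist x z < d \<Longrightarrow> dist (h x) (h z) < e / 4"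
    unfolding continuous_at_eps_delta using e by (metis divide_pos_pos zero_less_numeral)
  have "z \<in> - K" using z(2) by simp
  then obtain d' where d': "d' > 0" "ball z d' \<subseteq> - K" by (rule openE[OF oK])
  \<comment> \<open>The circle of radius \<delta> about \<open>z\<close> stays off \<open>K\<close>,
    and \<open>h\<close> varies by less than e / 4 between the centre and the circle.\<close>
  define \<delta> where "\<delta> = min d d' / 2"
  have \<delta>: "\<delta> > 0" "\<delta> < d" "\<delta> < d'" unfolding \<delta>_def using d(1) d'(1) by auto
  have h_lim: "(\<lambda>k. h (zs k)) \<longlonglongrightarrow> h z"
    using \<open>isCont h z\<close> z(1) by (rule isCont_tendsto_compose)
  obtain xs where xs: "\<And>k. cmod (zs k - xs k) = \<delta>"
    and xs_le: "\<And>k. cmod (poly (p (s k)) (zs k)) \<le> fact m / \<delta> ^ m * cmod (poly (q (s k)) (xs k))"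
  proof -
    have "\<exists>x. cmod (zs k - x) = \<delta> \<and> cmod (poly (p (s k)) (zs k)) \<le> fact m / \<delta> ^ m * cmod (poly (q (s k)) x)" for k
      using higher_pderiv_le[OF \<delta>(1), of "zs k" m "q (s k)"] unfolding p_def by blast
    then show thesis using that by metis
  qed
  have ys_lim: "(\<lambda>k. xs k - zs k) k \<in> sphere 0 \<delta>" for k
    using xs[of k] by (simp add: norm_minus_commute)
  then obtain u t where u: "u \<in> sphere 0 \<delta>" and t: "strict_mono t" and ul: "((\<lambda>k. xs k - zs k) \<circ> t) \<longlonglongrightarrow> u"
    using compact_sphere[of "0::complex" \<delta>] unfolding compact_def by metis
  have st: "strict_mono (s \<circ> t)" using s t by (rule strict_mono_o)
  have zt: "(\<lambda>k. zs (t k)) \<longlonglongrightarrow> z" using LIMSEQ_subseq_LIMSEQ[OF z(1) t] by (simp add: o_def)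
  have xt: "(\<lambda>k. xs (t k)) \<longlonglongrightarrow> u + z"
    using tendsto_add[OF ul zt] by (simp add: o_def)
  have dist_x: "dist (u + z) z = \<delta>" using u by (simp add: dist_norm)
  have xK: "u + z \<notin> K" using d'(2) dist_x \<delta>(3) by (auto simp: dist_commute subset_iff)
  define B where "B = ln (fact m / \<delta> ^ m)"
  \<comment> \<open>The lower bound for the potential of the zero measure at \<open>xs (t k)\<close>
    that the assumption \<open>gt\<close> yields through Cauchy's inequality; passing from degree N
    to n and the factor \<open>B\<close> cost nothing in the limit.\<close>
  define cs where "cs k = (N (s (t k)) / n (s (t k))) * (h (zs (t k)) + e) - B / n (s (t k))" for k
  have sub: "filterlim (\<lambda>k. s (t k)) sequentially sequentially"
    using filterlim_subseq[OF st] by (simp add: o_def)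
  have "cs \<longlonglongrightarrow> 1 * (h z + e) - 0"
    unfolding cs_def
    by (intro tendsto_intros filterlim_compose[OF ratio_lim(2) sub] filterlim_compose[OF ratio_lim(4) sub]
        LIMSEQ_subseq_LIMSEQ[OF h_lim t, unfolded o_def])
  then have cs: "cs \<longlonglongrightarrow> h z + e" by simp
  have "eventually (\<lambda>k. (ln r - lb (s (t k))) / N (s (t k)) < c + e / 2) sequentially"
    using filterlim_compose[OF bottom_lim sub] e by (intro order_tendstoD(2)) auto
  moreover have "eventually (\<lambda>k. h z - e / 4 < h (zs (t k))) sequentially"
    using LIMSEQ_subseq_LIMSEQ[OF h_lim t] e by (intro order_tendstoD(1)) (auto simp: o_def)
  ultimately have "eventually (\<lambda>k. ereal (cs k) \<le> log_potential (zero_measure (q (s (t k)))) (xs (t k))) sequentially"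
  proof eventually_elim
    case (elim k)
    define i where "i = s (t k)"
    define P where "P = cmod (poly (p i) (zs (t k)))"
    have hc: "c \<le> h z" unfolding h_def by (rule lpot_omega_ge[OF z(2)])
    have G: "h (zs (t k)) + e < (ln (max r P) - lb i) / N i"
      using gt[of "t k"] unfolding W_lpot h_def P_def i_def .
    \<comment> \<open>Otherwise the potential of \<open>W i\<close> would be at its floor, hence
      below c + e / 2 <= h z + e / 2, whereas \<open>G\<close> puts it above h z + 3 e / 4. Here
      Frostman's bound c <= h z is used.\<close>
    have "r < P"
    proof (rule ccontr)
      assume "\<not> r < P"
      then have "(ln (max r P) - lb i) / N i = (ln r - lb i) / N i" by (simp add: max_def)
      then show False using G elim hc e unfolding i_def by linarith
    qed
    then have Pp: "0 < P" and mx: "max r P = P" using r by auto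
    have Ni: "0 < N i" "0 < n i" using N_pos by auto
    have "N i * (h (zs (t k)) + e) < ln P - lb i"
      using G Ni unfolding mx by (simp add: field_simps)
    define Q where "Q = cmod (poly (q i) (xs (t k)))"
    have PQ: "P \<le> fact m / \<delta> ^ m * Q" using xs_le[of "t k"] unfolding P_def Q_def i_def .
    have fpos: "0 < (fact m / \<delta> ^ m :: real)" using \<delta>(1) by simp
    have Qp: "0 < Q" using PQ Pp fpos by (smt (verit) mult_nonneg_nonpos)
    have "ln P \<le> ln (fact m / \<delta> ^ m * Q)" using PQ Pp by (simp only: ln_mono)
    also have "\<dots> = B + ln Q" unfolding B_def using fpos Qp by (rule ln_mult_pos)
    finally have "N i * (h (zs (t k)) + e) - B \<le> ln Q - la i"
      using \<open>N i * (h (zs (t k)) + e) < ln P - lb i\<close> la_le_lb(1)[of i] by linarith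
    then have "(N i * (h (zs (t k)) + e) - B) / n i \<le> (ln Q - la i) / n i"
      using Ni by (intro divide_right_mono) auto
    then have "cs k \<le> (ln Q - la i) / n i" unfolding cs_def i_def by (simp add: diff_divide_distrib)
    moreover have "poly (q i) (xs (t k)) \<noteq> 0" using Qp unfolding Q_def by auto
    ultimately show ?case using zero_lpot(1)[of i "xs (t k)"] unfolding Q_def i_def by simp
  qed
  then obtain k0 where k0: "\<And>k. k0 \<le> k \<Longrightarrow> ereal (cs k) \<le> log_potential (zero_measure (q (s (t k)))) (xs (t k))"
    by (auto simp: eventually_sequentially)
  define v where "v k = s (t (k + k0))" for k
  have v: "strict_mono v" unfolding v_def using s t by (simp add: strict_mono_def)
  have conv': "wconv (\<lambda>k. zero_measure (q (v k))) \<sigma>"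
    using wconv_subseq[OF conv v] by (simp add: o_def)
  \<comment> \<open>Descent moves the excess e to the limit point u + z on the circle, where the
    potential of \<sigma> equals \<open>h\<close> and so exceeds h z by less than e / 4.\<close>
  have "ereal (h z + e) \<le> log_potential \<sigma> (u + z)"
  proof (rule log_potential_descent[OF zero_on compact_cball sigma_on_K K(1) conv'])
    show "(\<lambda>k. xs (t (k + k0))) \<longlonglongrightarrow> u + z" using LIMSEQ_ignore_initial_segment[OF xt] .
    show "(\<lambda>k. cs (k + k0)) \<longlonglongrightarrow> h z + e" using LIMSEQ_ignore_initial_segment[OF cs] .
    show "ereal (cs (k + k0)) \<le> log_potential (zero_measure (q (v k))) (xs (t (k + k0)))" for k
      unfolding v_def by (rule k0) simp
  qed
  then have "h z + e \<le> h (u + z)"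
    using log_potential_off(3)[OF sigma_on_K K(1) xK] lpot_sigma[OF xK] unfolding h_def by simp
  moreover have "dist (h (u + z)) (h z) < e / 4" using d(2)[of "u + z"] dist_x \<delta>(2) by simp
  ultimately show False using e by (simp add: dist_real_def)
qed

text \<open>\<open>W_locally_le\<close> allows moving points, so a failure of uniformity, caught
  along a convergent subsequence of bad points, contradicts it.\<close>

lemma W_uniformly_le:
  assumes S: "compact S" "S \<inter> K = {}" and e: "e > 0"
  shows "eventually (\<lambda>k. \<forall>z\<in>S. lpot (W k) z \<le> lpot \<omega> z + e) sequentially"
proof (rule ccontr)
  assume nt: "\<not> ?thesis"
  obtain s :: "nat \<Rightarrow> nat" where s: "strict_mono s" and n: "\<And>k. \<not> (\<forall>z\<in>S. lpot (W (s k)) z \<le> lpot \<omega> z + e)"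
    by (rule not_eventually_subseq[OF nt]) blast
  from n have "\<forall>k. \<exists>z. z \<in> S \<and> \<not> lpot (W (s k)) z \<le> lpot \<omega> z + e" by blast
  then obtain zs where zs: "\<And>k. zs k \<in> S" "\<And>k. \<not> lpot (W (s k)) (zs k) \<le> lpot \<omega> (zs k) + e" by metis
  obtain z t where z: "z \<in> S" and t: "strict_mono t" and zl: "(zs \<circ> t) \<longlonglongrightarrow> z"
    using S(1) zs(1) unfolding compact_def by metis
  have "z \<notin> K" using z S(2) by blast
  from W_locally_le[OF strict_mono_o[OF s t] zl this e] zs(2) show False by auto
qed

lemma limit_eq:
  assumes W: "\<And>k. W k \<in> prob_measures_on (cball 0 R')" and \<nu>: "\<nu> \<in> prob_measures_on (cball 0 R')"
    and wc: "wconv W \<nu>"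
  shows "\<nu> = \<omega>"
proof -
  have ge: "ereal c \<le> log_potential \<nu> z" for z
  proof (rule log_potential_descent[OF W compact_cball \<nu> compact_cball wc tendsto_const bottom_lim])
    show "ereal ((ln r - lb k) / N k) \<le> log_potential (W k) z" for k
      using W_ge_bottom[of k z] unfolding W_pot W_lpot by simp
  qed
  have fin: "log_potential \<nu> z \<noteq> -\<infinity>" for z using ge[of z] by auto
  have le: "lpot \<nu> z \<le> lpot \<omega> z" if z: "z \<notin> K" for z
  proof -
    have oK: "open (- K)" using K by (simp add: compact_imp_closed open_Compl)
    have "z \<in> - K" using z by simp
    then obtain d where d: "d > 0" "ball z d \<subseteq> - K" by (rule openE[OF oK])
    define \<rho> where "\<rho> = d / 2"
    have \<rho>: "\<rho> > 0" "\<rho> < d" unfolding \<rho>_def using d(1) by auto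
    have sK: "sphere z \<rho> \<inter> K = {}" using d(2) \<rho>(2) by (auto simp: subset_iff)
    have bK: "ball z \<rho> \<inter> K = {}" using d(2) \<rho>(2) by (auto simp: subset_iff)
    obtain \<kappa> where \<kappa>: "\<kappa> \<in> prob_measures_on (sphere z \<rho>)"
      and mean: "\<And>\<mu> C. \<mu> \<in> prob_measures_on C \<Longrightarrow> compact C \<Longrightarrow>
        integrable \<kappa> (lpot \<mu>) \<and> (\<integral>\<zeta>. lpot \<mu> \<zeta> \<partial>\<kappa>) = tpot \<rho> \<mu> z"
      by (rule circle_measure[OF \<rho>(1)]) blast
    note Dk = prob_measures_onD[OF \<kappa> closed_sphere]
    interpret k: prob_space \<kappa> by (rule Dk)
    \<comment> \<open>The bound holds uniformly on the circle for large \<open>k\<close>, the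
      averages converge under weak convergence, and the average dominates the value at the
      centre.\<close>
    have up: "lpot \<nu> z \<le> lpot \<omega> z + e" if e: "e > 0" for e
    proof -
      have "eventually (\<lambda>k. tpot \<rho> (W k) z \<le> lpot \<omega> z + e) sequentially"
        using W_uniformly_le[OF compact_sphere sK e]
      proof eventually_elim
        case (elim k)
        have "tpot \<rho> (W k) z = (\<integral>\<zeta>. lpot (W k) \<zeta> \<partial>\<kappa>)" using mean[OF W compact_cball] by simp
        also have "\<dots> \<le> (\<integral>\<zeta>. lpot \<omega> \<zeta> + e \<partial>\<kappa>)"
        proof (rule integral_mono_AE)
          show "AE \<zeta> in \<kappa>. lpot (W k) \<zeta> \<le> lpot \<omega> \<zeta> + e"
            using Dk(4) by eventually_elim (use elim in blast)
        qed (use mean[OF W compact_cball] mean[OF \<omega> K(1)] in auto)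
        also have "\<dots> = tpot \<rho> \<omega> z + e" using mean[OF \<omega> K(1)] by (simp add: k.prob_space)
        also have "tpot \<rho> \<omega> z = lpot \<omega> z" by (rule tpot_off[OF \<omega> K(1) bK \<rho>(1)])
        finally show ?case .
      qed
      moreover have "(\<lambda>k. tpot \<rho> (W k) z) \<longlonglongrightarrow> tpot \<rho> \<nu> z"
        unfolding tpot_def by (intro wconvD[OF wc] continuous_ln_max \<rho>(1))
      ultimately have "tpot \<rho> \<nu> z \<le> lpot \<omega> z + e" by (intro tendsto_upperbound) auto
      then show ?thesis using lpot_le_tpot(1)[OF \<nu> compact_cball fin \<rho>(1), of z] by simp
    qed
    show ?thesis by (rule field_le_epsilon) (rule up)
  qed
  \<comment> \<open>The single point of contact that the strong maximum principle asks for, chosen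
    beyond all zeros of the polynomials.\<close>
  define z0 where "z0 = complex_of_real (R + 1)"
  have z0: "cmod z0 > R" unfolding z0_def norm_of_real using R by simp
  then have z0K: "z0 \<notin> K" using R(2) by (auto simp: subset_iff)
  have "ereal (lpot \<omega> z0) \<le> log_potential \<nu> z0"
  proof (rule log_potential_descent[OF W compact_cball \<nu> compact_cball wc tendsto_const])
    define lq where "lq k = ln (cmod (poly (q k) z0))" for k
    \<comment> \<open>The logarithm of the factor (2 |z0|) ^ m lost in \<open>m\<close> applications
      of the logarithmic derivative bound; divided by N it tends to 0.\<close>
    define B where "B = real m * ln (2 * cmod z0)"
    show "(\<lambda>k. (lq k - B - lb k) / N k) \<longlonglongrightarrow> lpot \<omega> z0"
    proof -
      have "(\<lambda>k. lq k / n k * (n k / N k) - B / N k - lb k / N k) \<longlonglongrightarrow> (lpot \<omega> z0 - c) * 1 - 0 - - c"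
        unfolding lq_def n_def[symmetric]
        by (intro tendsto_diff tendsto_mult ratio_lim lb_lim reg[of z0, folded n_def]) (use z0 in simp)
      moreover have "lq k / n k * (n k / N k) - B / N k - lb k / N k = (lq k - B - lb k) / N k" for k
        using N_pos(2)[of k] by (simp add: diff_divide_distrib)
      ultimately show ?thesis by simp
    qed
    fix k
    have nz: "poly (q k) z0 \<noteq> 0" using roots[of k] z0 by auto
    have mle: "m \<le> degree (q k)" using deg_m[of k] by simp
    have z0p: "0 < cmod z0" using z0 R by linarith
    have "cmod (poly (q k) z0) / (2 * cmod z0) ^ m \<le> cmod (poly (p k) z0)"
      using cmod_higher_pderiv_ge[OF roots R(1) mle q_nonzero] z0 unfolding p_def by auto
    also have "\<dots> \<le> max r (cmod (poly (p k) z0))" by simp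
    finally have "ln (cmod (poly (q k) z0) / (2 * cmod z0) ^ m) \<le> ln (max r (cmod (poly (p k) z0)))"
      using nz z0p by (intro ln_mono) auto
    moreover have "ln (cmod (poly (q k) z0) / (2 * cmod z0) ^ m) = lq k - B"
    proof -
      have X: "ln (x / y ^ m) = ln x - real m * ln y" if "0 < x" "0 < y" for x y :: real
        using that by (simp add: ln_div ln_realpow)
      show ?thesis unfolding lq_def B_def using nz z0p by (intro X) auto
    qed
    ultimately show "ereal ((lq k - B - lb k) / N k) \<le> log_potential (W k) z0"
      unfolding W_pot using N_pos(1)[of k] by (auto intro!: divide_right_mono)
  qed
  then have far: "lpot \<omega> z0 \<le> lpot \<nu> z0"
    using log_potential_finiteD(3)[OF \<nu> compact_cball fin, of z0] by simp
  have \<nu>K: "\<nu> \<in> prob_measures_on K"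
    by (rule strong_maximum_principle[OF K \<omega> \<nu> compact_cball fin le z0K far])
  have "ereal c \<le> log_energy \<nu>"
    by (rule log_energy_ge_of_log_potential_ge[OF \<nu>K K(1)]) (intro AE_I2 ge)
  then have "log_energy \<nu> = ereal c" using max[OF \<nu>K] by (rule antisym[rotated])
  then show ?thesis by (rule energy_maximizer_unique[OF K(1) \<nu>K \<omega> _ en max])
qed

end

section \<open>A common disc for all lemniscates\<close>

lemma cmod_poly_le:
  assumes "{z. poly p z = 0} \<subseteq> cball 0 R" "p \<noteq> 0"
  shows "cmod (poly p z) \<le> cmod (lead_coeff p) * (cmod z + R) ^ degree p"
proof -
  have "cmod (\<Prod>x\<in>#M. z - x) \<le> (cmod z + R) ^ size M" if "\<forall>x\<in>#M. cmod x \<le> R" for M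
    using that
  proof (induction M)
    case (add x M)
    have le: "cmod (z - x) \<le> cmod z + R" using norm_triangle_ineq4[of z x] add.prems by auto
    then have "0 \<le> cmod z + R" using norm_ge_zero order_trans by blast
    then have "cmod (z - x) * cmod (\<Prod>x\<in>#M. z - x) \<le> (cmod z + R) * (cmod z + R) ^ size M"
      using add le by (intro mult_mono) auto
    then show ?case by (simp add: norm_mult)
  qed simp
  moreover have "\<forall>x\<in>#proots p. cmod x \<le> R" using assms by (auto simp: subset_iff)
  ultimately have "cmod (\<Prod>x\<in>#proots p. z - x) \<le> (cmod z + R) ^ degree p"
    by (metis size_proots_complex)
  then show ?thesis
    by (subst poly_eq_prod_proots) (simp add: norm_mult mult_left_mono)
qed

text \<open>Weak compactness requires one disc for all equilibrium measures. Convergence at the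
  single point R bounds the leading coefficients from below by exp (- n B), and as all roots lie
  within R, the derivative exceeds \<open>r\<close> at a fixed distance beyond.\<close>

lemma higher_pderiv_vimage_bounded:
  fixes q :: "nat \<Rightarrow> complex poly"
  assumes deg: "filterlim (\<lambda>k. degree (q k)) at_top sequentially" and R: "R > 0"
    and roots: "\<And>k. k \<ge> i \<Longrightarrow> {z. poly (q k) z = 0} \<subseteq> ball 0 R"
    and lim: "(\<lambda>k. ln (cmod (poly (q k) (of_real R))) / degree (q k)) \<longlonglongrightarrow> l"
    and r: "r > 0"
  obtains R' k0 where "\<And>k. k \<ge> k0 \<Longrightarrow> poly ((pderiv ^^ m) (q k)) -` cball 0 r \<subseteq> cball 0 R'"
proof -
  define B where "B = \<bar>l - 1 - ln (2 * R)\<bar>"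
  \<comment> \<open>For n > 2 m + 1 the degree n - m is at least n / 2, so the power of D
    contributes at least n (B + 1) to the logarithm: this absorbs - n B and leaves n > ln r.\<close>
  define D where "D = exp (2 * B + 2)"
  have D: "D > 0" unfolding D_def by simp
  have dn: "filterlim (\<lambda>k. real (degree (q k))) at_top sequentially"
    by (rule filterlim_compose[OF filterlim_real_sequentially deg])
  have "eventually (\<lambda>k. poly ((pderiv ^^ m) (q k)) -` cball 0 r \<subseteq> cball 0 (R + D)) sequentially"
    using order_tendstoD(1)[OF lim, of "l - 1", simplified] filterlim_at_top_dense[THEN iffD1, OF dn, rule_format, of "2 * real m + 1"]
      filterlim_at_top_dense[THEN iffD1, OF dn, rule_format, of "ln r"] eventually_ge_at_top[of i]
  proof eventually_elim
    case (elim k)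
    define n where "n = real (degree (q k))"
    have n: "2 * real m + 1 < n" "ln r < n" "0 < n" using elim unfolding n_def by auto
    then have mle: "m \<le> degree (q k)" unfolding n_def by linarith
    have q0: "q k \<noteq> 0" using n unfolding n_def by auto
    note rt = roots[OF elim(4)]
    have rtc: "{z. poly (q k) z = 0} \<subseteq> cball 0 R" using rt ball_subset_cball by blast
    define a where "a = cmod (lead_coeff (q k))"
    have a: "0 < a" unfolding a_def using q0 by simp
    have qR: "poly (q k) (of_real R) \<noteq> 0" using rt R by auto
    have "cmod (poly (q k) (of_real R)) \<le> a * (2 * R) ^ degree (q k)"
      using cmod_poly_le[OF rtc q0, of "of_real R"] R unfolding a_def by simp
    then have "ln (cmod (poly (q k) (of_real R))) \<le> ln (a * (2 * R) ^ degree (q k))"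
      using qR by (intro ln_mono) auto
    also have "\<dots> = ln a + n * ln (2 * R)"
    proof -
      have X: "ln (x * y ^ degree (q k)) = ln x + n * ln y" if "0 < x" "0 < y" for x y :: real
        using that unfolding n_def by (simp add: ln_mult ln_realpow)
      show ?thesis using a R by (intro X) auto
    qed
    finally have "n * (l - 1) \<le> ln a + n * ln (2 * R)"
      using elim(1) n unfolding n_def[symmetric] by (simp add: field_simps)
    then have "n * (l - 1 - ln (2 * R)) \<le> ln a" by (simp add: algebra_simps)
    moreover have "n * (- B) \<le> n * (l - 1 - ln (2 * R))"
      unfolding B_def using n by (intro mult_left_mono) auto
    ultimately have la: "- (n * B) \<le> ln a" by simp
    let ?p = "(pderiv ^^ m) (q k)"
    have dp: "real (degree ?p) = n - m" using mle unfolding n_def degree_higher_pderiv by simp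
    have "degree ?p \<noteq> 0" using dp n by auto
    then have p0: "?p \<noteq> 0" by auto
    have rp: "{z. poly ?p z = 0} \<subseteq> cball 0 R"
      using cmod_higher_pderiv_ge[OF rt R mle q0] ball_subset_cball by blast
    show ?case
    proof
      fix z assume z: "z \<in> poly ?p -` cball 0 r"
      show "z \<in> cball 0 (R + D)"
      proof (rule ccontr)
        assume "z \<notin> cball 0 (R + D)"
        then have zl: "D \<le> cmod z - R" "R \<le> cmod z" using D by auto
        have "a * D ^ degree ?p \<le> cmod (lead_coeff ?p) * (cmod z - R) ^ degree ?p"
          unfolding a_def using zl D lead_coeff_higher_pderiv(1)[OF mle]
          by (intro mult_mono power_mono) auto
        also have "\<dots> \<le> cmod (poly ?p z)" using zl R p0 by (intro cmod_poly_ge rp) auto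
        also have "\<dots> \<le> r" using z by simp
        finally have "ln (a * D ^ degree ?p) \<le> ln r" using a D by (intro ln_mono) auto
        moreover have "ln (a * D ^ degree ?p) = ln a + (n - m) * (2 * B + 2)"
          using a D by (simp add: ln_mult ln_realpow dp) (simp add: D_def)
        moreover have "n / 2 * (2 * B + 2) \<le> (n - m) * (2 * B + 2)"
          using n unfolding B_def by (intro mult_right_mono) auto
        ultimately have "n \<le> ln r" using la by (simp add: algebra_simps)
        then show False using n by simp
      qed
    qed
  qed
  then show thesis using that unfolding eventually_sequentially by blast
qed

theorem corollary1:
  fixes K :: "complex set" and q :: "nat \<Rightarrow> complex poly" and m :: nat and r :: real
  assumes "compact K" and "\<not> polar K" and "polynomially_convex K"
    and "filterlim (\<lambda>k. degree (q k)) at_top sequentially"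
    and "K_regular K q" and "centers_on q K"
    and "m \<ge> 1" and "r > 0"
  shows "weak_star_converges
           (\<lambda>k. equilibrium_measure (poly ((pderiv ^^ m) (q k)) -` cball 0 r))
           (equilibrium_measure K)"
proof -
  obtain \<omega> c where \<omega>: "\<omega> \<in> prob_measures_on K" and en: "log_energy \<omega> = ereal c"
    and max: "\<And>\<nu>. \<nu> \<in> prob_measures_on K \<Longrightarrow> log_energy \<nu> \<le> ereal c"
    by (rule ex_energy_maximizer[OF assms(1,2)]) blast
  have eqK: "equilibrium_measure K = \<omega>" by (rule equilibrium_measure_eqI[OF assms(1) \<omega> en max])
  have con: "connected (- K)" using assms(3) unfolding polynomially_convex_def .
  obtain R0 where R0: "R0 > 0" "K \<subseteq> ball 0 R0"
    and unif: "uniform_limit (- ball 0 R0) (\<lambda>k z. 1 / real (degree (q k)) * ln (cmod (poly (q k) z))) (green K) sequentially"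
    using assms(5) unfolding K_regular_def by blast
  obtain k1 R1 where "R1 > 0 \<and> (\<forall>k\<ge>k1. {z. poly (q k) z = 0} \<subseteq> ball 0 R1) \<and>
      (\<forall>L. closed L \<and> L \<inter> K = {} \<longrightarrow>
        (\<exists>M>0. \<forall>k\<ge>k1. size (filter_mset (\<lambda>z. z \<in> L) (proots (q k))) \<le> M))"
    using assms(6) unfolding centers_on_def by (elim exE)
  then have R1: "R1 > 0" and roots1: "\<And>k. k \<ge> k1 \<Longrightarrow> {z. poly (q k) z = 0} \<subseteq> ball 0 R1"
    and cent: "\<And>L. closed L \<Longrightarrow> L \<inter> K = {} \<Longrightarrow>
      \<exists>M>0. \<forall>k\<ge>k1. size (filter_mset (\<lambda>z. z \<in> L) (proots (q k))) \<le> M"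
    by simp_all
  \<comment> \<open>Enlarging either radius preserves its property, so one radius serves both
    regularity and the zeros.\<close>
  define R where "R = Max {R0, R1}"
  have R: "R > 0" "R0 \<le> R" "R1 \<le> R" unfolding R_def using R0 R1 by auto
  have KR: "K \<subseteq> ball 0 R" using R0(2) R(2) by (meson order_trans subset_ball)
  have roots: "{z. poly (q k) z = 0} \<subseteq> ball 0 R" if "k \<ge> k1" for k
    using roots1[OF that] R(3) by (meson order_trans subset_ball)
  have reg: "(\<lambda>k. ln (cmod (poly (q k) z)) / degree (q k)) \<longlonglongrightarrow> lpot \<omega> z - c" if z: "cmod z \<ge> R" for z
  proof -
    have zK: "z \<notin> K" using KR z by auto
    have "z \<in> - ball 0 R0" using z R by auto
    from tendsto_uniform_limitI[OF unif this]
    have "(\<lambda>k. 1 / real (degree (q k)) * ln (cmod (poly (q k) z))) \<longlonglongrightarrow> green K z" .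
    \<comment> \<open>Off \<open>K\<close> the potential is finite, so the conversion to a real
      number in \<open>green\<close> loses nothing.\<close>
    moreover have "green K z = lpot \<omega> z - c"
      unfolding green_def eqK en log_potential_off(3)[OF \<omega> assms(1) zK] by simp
    ultimately show ?thesis by simp
  qed
  have Rr: "cmod (complex_of_real R) \<ge> R" using R by simp
  obtain R' k2 where bound: "\<And>k. k \<ge> k2 \<Longrightarrow> poly ((pderiv ^^ m) (q k)) -` cball 0 r \<subseteq> cball 0 R'"
  proof (rule higher_pderiv_vimage_bounded[where m=m and i=k1, OF assms(4) R(1) _ reg[OF Rr] assms(8)])
    show "{z. poly (q k) z = 0} \<subseteq> ball 0 R" if "k1 \<le> k" for k by (rule roots[OF that])
  qed (rule that)
  have "eventually (\<lambda>k. m < degree (q k)) sequentially"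
    using assms(4)[unfolded filterlim_at_top, rule_format, of "Suc m"] by (simp add: Suc_le_eq)
  then obtain k3 where deg: "\<And>k. k \<ge> k3 \<Longrightarrow> m < degree (q k)" unfolding eventually_sequentially by blast
  define k0 where "k0 = k1 + k2 + k3"
  define V where "V k = equilibrium_measure (poly ((pderiv ^^ m) (q k)) -` cball 0 r)" for k
  have V_on: "V k \<in> prob_measures_on (cball 0 R')" if "k \<ge> k0" for k
  proof -
    have "degree ((pderiv ^^ m) (q k)) > 0" using deg[of k] that unfolding k0_def degree_higher_pderiv by simp
    then show ?thesis
      unfolding V_def using bound[of k] that assms(8) unfolding k0_def
      by (intro prob_measures_on_mono[OF equilibrium_measure_poly_vimage(1)] compact_imp_closed compact_poly_vimage) auto
  qed
  have "weak_star_converges V \<omega>"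
    unfolding weak_star_converges_def
  \<comment> \<open>It suffices that every subsequence has a further subsequence converging to
    \<omega>; a failing test function would fix a subsequence on which this is impossible.\<close>
  proof (intro allI impI, rule ccontr)
    fix f :: "complex \<Rightarrow> real"
    assume f: "continuous_on UNIV f \<and> compact (closure {z. f z \<noteq> 0})"
      and "\<not> (\<lambda>k. \<integral>z. f z \<partial>V k) \<longlonglongrightarrow> (\<integral>z. f z \<partial>\<omega>)"
    then obtain e where e: "e > 0" "\<not> eventually (\<lambda>k. dist (\<integral>z. f z \<partial>V k) (\<integral>z. f z \<partial>\<omega>) < e) sequentially"
      unfolding tendsto_iff by blast
    obtain s :: "nat \<Rightarrow> nat" where s: "strict_mono s" "\<And>k. \<not> dist (\<integral>z. f z \<partial>V (s k)) (\<integral>z. f z \<partial>\<omega>) < e"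
      by (rule not_eventually_subseq[OF e(2)]) blast
    \<comment> \<open>The shift by \<open>k0\<close> discards the finitely many indices at which
      degrees, zeros or lemniscates are not yet under control.\<close>
    define s1 where "s1 k = s (k + k0)" for k
    have s1: "strict_mono s1" using s(1) unfolding s1_def by (simp add: strict_mono_def)
    have s1k: "s1 k \<ge> k0" for k unfolding s1_def using seq_suble[OF s(1), of "k + k0"] by simp
    have zero_on: "zero_measure (q (s1 k)) \<in> prob_measures_on (cball 0 R)" for k
      using deg[of "s1 k"] roots[of "s1 k"] s1k[of k] unfolding k0_def
      by (intro zero_measure_on) (auto simp: subset_iff)
    obtain s2 \<sigma> where s2: "strict_mono s2" and \<sigma>: "\<sigma> \<in> prob_measures_on (cball 0 R)"
      and c2: "wconv ((\<lambda>k. zero_measure (q (s1 k))) \<circ> s2) \<sigma>"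
      by (rule wconv_compactness[of "\<lambda>k. zero_measure (q (s1 k))", OF zero_on compact_cball]) blast
    obtain s3 \<nu> where s3: "strict_mono s3" and \<nu>: "\<nu> \<in> prob_measures_on (cball 0 R')"
      and c3: "wconv ((\<lambda>k. V (s1 (s2 k))) \<circ> s3) \<nu>"
      by (rule wconv_compactness[of "\<lambda>k. V (s1 (s2 k))", OF V_on[OF s1k] compact_cball]) blast
    \<comment> \<open>Two successive extractions: along \<open>t\<close> both the zero measures and
      the lemniscate measures converge.\<close>
    define t where "t k = s1 (s2 (s3 k))" for k
    have t: "strict_mono t" using s1 s2 s3 unfolding t_def by (simp add: strict_mono_def)
    have tk: "k0 \<le> t k" for k unfolding t_def by (rule s1k)
    have sub: "filterlim t sequentially sequentially" by (rule filterlim_subseq[OF t])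
    interpret regular_centered K \<omega> c R r m "\<lambda>k. q (t k)" \<sigma>
    proof
      show "filterlim (\<lambda>k. degree (q (t k))) at_top sequentially"
        by (rule filterlim_compose[OF assms(4) sub])
      show "m < degree (q (t k))" for k using deg[of "t k"] tk[of k] unfolding k0_def by simp
      show "{z. poly (q (t k)) z = 0} \<subseteq> ball 0 R" for k using roots[of "t k"] tk[of k] unfolding k0_def by simp
      show "(\<lambda>k. ln (cmod (poly (q (t k)) z)) / degree (q (t k))) \<longlonglongrightarrow> lpot \<omega> z - c" if "R \<le> cmod z" for z
        by (rule filterlim_compose[OF reg[OF that] sub])
      show "\<exists>M. \<forall>k. size (filter_mset (\<lambda>z. z \<in> L) (proots (q (t k)))) \<le> M" if "closed L" "L \<inter> K = {}" for L
        using cent[OF that] tk unfolding k0_def by (meson add_leD1)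
      show "wconv (\<lambda>k. zero_measure (q (t k))) \<sigma>"
        using wconv_subseq[OF c2 s3] unfolding t_def by (simp add: o_def)
    qed (fact assms con \<omega> en max R KR \<sigma>)+
    have WV: "W k = V (t k)" for k unfolding W_def p_def V_def ..
    have "W = (\<lambda>k. V (t k))" by (rule ext) (rule WV)
    then have wc: "wconv W \<nu>" using c3 unfolding t_def o_def by simp
    have "\<nu> = \<omega>"
      by (rule limit_eq[OF _ \<nu> wc]) (unfold WV, rule V_on[OF tk])
    then have "(\<lambda>k. \<integral>z. f z \<partial>V (t k)) \<longlonglongrightarrow> (\<integral>z. f z \<partial>\<omega>)"
      using wconvD[OF wc, of f] f unfolding WV by simp
    then have "eventually (\<lambda>k. dist (\<integral>z. f z \<partial>V (t k)) (\<integral>z. f z \<partial>\<omega>) < e) sequentially"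
      using e(1) unfolding tendsto_iff by blast
    then obtain k where "dist (\<integral>z. f z \<partial>V (t k)) (\<integral>z. f z \<partial>\<omega>) < e"
      unfolding eventually_sequentially by blast
    then show False using s(2) unfolding t_def s1_def by blast
  qed
  then show ?thesis unfolding eqK V_def .
qed

end
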